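(* Let $n\ge2$ and let $D\subset\mathbb{R}^n$ be a regular domain. Then all the panharmonic measures $H^x_\mu(D;\cdot)$, $\mu\ge0$, $x\in D$, are mutually equivalent (mutually absolutely continuous). For every $\mu\ge 0$ and $x\in D$, the Radon--Nikodym derivative of $H^x_\mu(D;\cdot)$ with respect to the harmonic measure $H^x(D;\cdot)$ is the function $$Z^x_\mu(D;y)=\mathbb{E}^x\left[e^{-\frac{\mu^2}{2}\tau_D}\,\Big|\,W(\tau_D)=y\right],\quad y\in\partial D.$$ Moreover, $Z^x_\mu(D;y)$ is strictly decreasing in $\mu$, and $0<Z^x_\mu(D;y)\le1$.
   Context: $W$ is standard $n$-dimensional Brownian motion (generator $\frac12\Delta$), starting from $x$ under $\mathbb{P}^x$ (expectation $\mathbb{E}^x$). For a domain $D\subset\mathbb{R}^n$, $\tau_D=\inf\{t>0: W(t)\in D^c\}$, with $\inf\emptyset=\infty$. $D$ is regular if $\mathbb{P}^x[\tau_D=0]=1$ for all $x\in\partial D$. A regular domain $D$ is small if $\mathbb{P}^x[\tau_D<\infty]=1$ for all $x\in D$. A function is $\mu$-panharmonic on $D$ if it is $C^2$ on $D$ and satisfies $\Delta u=\mu^2u$ there. Harmonic measure ($\mu=0$) is the hitting measure $H^x(D;\mathrm{d}y)=H_0^x(D;\mathrm{d}y)=\mathbb{P}^x[W(\tau_D)\in\mathrm{d}y,\ \tau_D<\infty]$. The $\mu$-panharmonic measure on $\partial D$ with pole $x\in D$ (for $D$ small, or for $D$ regular and $\mu>0$) is the Borel measure $H^x_\mu(D;\cdot)$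 on $\partial D$ such that $u(x)=\int_{\partial D}u(y)\,H^x_\mu(D;\mathrm{d}y)$ for every bounded continuous $u:\overline D\to\mathbb{R}$ that is $\mu$-panharmonic on $D$; for small $D$ and $\mu=0$ this agrees with the hitting measure. The conditional expectation defining $Z^x_\mu(D;y)$ is taken on $\{\tau_D<\infty\}$ and, simultaneously for all $\mu\ge0$, with respect to one fixed regular conditional distribution $\kappa^x_y$ of $\tau_D$ given $W(\tau_D)=y$ (and $\tau_D<\infty$), with $\kappa^x_y$ a probability measure on $(0,\infty)$; i.e. $Z^x_\mu(D;y)=\int_{(0,\infty)}e^{-\frac{\mu^2}{2}t}\,\kappa^x_y(\mathrm{d}t)$. *)

theory Defs
  imports "HOL-Probability.Probability"
begin

section \<open>Brownian motion and exit times\<close>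

text \<open>
  Only the values \<open>W t\<close> for \<open>t \<ge> 0\<close> matter. An increment over a time span \<open>h\<close> has density
  \<open>(2 * pi * h) powr (- n / 2) * exp (- (norm z)\<^sup>2 / (2 * h))\<close>, written below as a product of
  one-dimensional normal densities of standard deviation \<open>sqrt h\<close>.
\<close>

definition brownian_motion ::
    "'w measure \<Rightarrow> (real \<Rightarrow> 'w \<Rightarrow> 'a::euclidean_space) \<Rightarrow> 'a \<Rightarrow> bool" where
  "brownian_motion M W x \<longleftrightarrow>
     prob_space M \<and>
     (\<forall>t\<ge>0. W t \<in> borel_measurable M) \<and>
     (\<forall>\<omega>\<in>space M. continuous_on {0..} (\<lambda>t. W t \<omega>)) \<and>
     (AE \<omega> in M. W 0 \<omega> = x) \<and>
     (\<forall>s t. 0 \<le> s \<and> s < t \<longrightarrow>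
        distributed M lborel (\<lambda>\<omega>. W t \<omega> - W s \<omega>)
          (\<lambda>z. ennreal (\<Prod>b\<in>Basis. normal_density 0 (sqrt (t - s)) (z \<bullet> b)))) \<and>
     (\<forall>t::nat \<Rightarrow> real. 0 \<le> t 0 \<and> strict_mono t \<longrightarrow>
        prob_space.indep_vars M (\<lambda>_. borel) (\<lambda>i \<omega>. W (t (Suc i)) \<omega> - W (t i) \<omega>) UNIV)"

definition brownian_family ::
    "('a::euclidean_space \<Rightarrow> 'w measure) \<Rightarrow> (real \<Rightarrow> 'w \<Rightarrow> 'a) \<Rightarrow> bool" where
  "brownian_family P W \<longleftrightarrow>
     (\<forall>x y. sets (P x) = sets (P y)) \<and> (\<forall>x. brownian_motion (P x) W x)"

definition exit_time :: "(real \<Rightarrow> 'w \<Rightarrow> 'a) \<Rightarrow> 'a set \<Rightarrow> 'w \<Rightarrow> ereal" where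
  "exit_time W D \<omega> = Inf (ereal ` {t. 0 < t \<and> W t \<omega> \<in> - D})"

text \<open>To be used only where \<open>exit_time W D \<omega> < \<infinity>\<close>.\<close>

definition exit_point :: "(real \<Rightarrow> 'w \<Rightarrow> 'a) \<Rightarrow> 'a set \<Rightarrow> 'w \<Rightarrow> 'a" where
  "exit_point W D \<omega> = W (real_of_ereal (exit_time W D \<omega>)) \<omega>"

definition regular_domain ::
    "('a::euclidean_space \<Rightarrow> 'w measure) \<Rightarrow> (real \<Rightarrow> 'w \<Rightarrow> 'a) \<Rightarrow> 'a set \<Rightarrow> bool" where
  "regular_domain P W D \<longleftrightarrow>
     open D \<and> connected D \<and> D \<noteq> {} \<and>
     (\<forall>x\<in>frontier D. measure (P x) {\<omega>\<in>space (P x). exit_time W D \<omega> = 0} = 1)"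

section \<open>Panharmonic functions\<close>

definition partial :: "'a \<Rightarrow> ('a::euclidean_space \<Rightarrow> real) \<Rightarrow> 'a \<Rightarrow> real" where
  "partial b u x = deriv (\<lambda>t. u (x + t *\<^sub>R b)) 0"

definition C1_on :: "'a set \<Rightarrow> ('a::euclidean_space \<Rightarrow> real) \<Rightarrow> bool" where
  "C1_on D u \<longleftrightarrow>
     continuous_on D u \<and>
     (\<forall>b\<in>Basis. (\<forall>x\<in>D. (\<lambda>t. u (x + t *\<^sub>R b)) differentiable (at 0)) \<and>
        continuous_on D (partial b u))"

definition C2_on :: "'a set \<Rightarrow> ('a::euclidean_space \<Rightarrow> real) \<Rightarrow> bool" where
  "C2_on D u \<longleftrightarrow> C1_on D u \<and> (\<forall>b\<in>Basis. C1_on D (partial b u))"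

definition laplacian :: "('a::euclidean_space \<Rightarrow> real) \<Rightarrow> 'a \<Rightarrow> real" where
  "laplacian u x = (\<Sum>b\<in>Basis. partial b (partial b u) x)"

definition panharmonic_on :: "real \<Rightarrow> 'a set \<Rightarrow> ('a::euclidean_space \<Rightarrow> real) \<Rightarrow> bool" where
  "panharmonic_on \<mu> D u \<longleftrightarrow> C2_on D u \<and> (\<forall>x\<in>D. laplacian u x = \<mu>\<^sup>2 * u x)"

section \<open>Harmonic and panharmonic measures\<close>

text \<open>
  The hitting measure is a Borel measure on \<open>frontier D\<close> of total mass
  \<open>P x (exit_time W D < \<infinity>)\<close>. The push-forward is formed on the whole space first because
  \<open>exit_point\<close> is known to lie in \<open>frontier D\<close> only almost surely.
\<close>

definition harmonic_measure ::
    "('a::euclidean_space \<Rightarrow> 'w measure) \<Rightarrow> (real \<Rightarrow> 'w \<Rightarrow> 'a) \<Rightarrow> 'a set \<Rightarrow> 'a \<Rightarrow> 'a measure" where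
  "harmonic_measure P W D x =
     restrict_space
       (distr (restrict_space (P x) {\<omega>. exit_time W D \<omega> < \<infinity>}) borel (exit_point W D))
       (frontier D)"

definition represents_panharmonic ::
    "real \<Rightarrow> 'a set \<Rightarrow> 'a \<Rightarrow> 'a::euclidean_space measure \<Rightarrow> bool" where
  "represents_panharmonic \<mu> D x H \<longleftrightarrow>
     sets H = sets (restrict_space borel (frontier D)) \<and>
     (\<forall>u. continuous_on (closure D) u \<and> bounded (u ` closure D) \<and> panharmonic_on \<mu> D u \<longrightarrow>
        integrable H u \<and> u x = (\<integral>y. u y \<partial>H))"

text \<open>
  For \<open>\<mu> = 0\<close> the representation property does not determine a measure on every regular domain,
  so there the measure is the hitting measure.
\<close>

definition panharmonic_measure ::
    "('a::euclidean_space \<Rightarrow> 'w measure) \<Rightarrow> (real \<Rightarrow> 'w \<Rightarrow> 'a) \<Rightarrow> real \<Rightarrow> 'a set \<Rightarrow> 'a \<Rightarrow> 'a measure"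
  where
  "panharmonic_measure P W \<mu> D x =
     (if \<mu> = 0 then harmonic_measure P W D x else (THE H. represents_panharmonic \<mu> D x H))"

section \<open>Conditional law of the exit time given the exit point\<close>

definition exit_time_kernel ::
    "('a::euclidean_space \<Rightarrow> 'w measure) \<Rightarrow> (real \<Rightarrow> 'w \<Rightarrow> 'a) \<Rightarrow> 'a set \<Rightarrow> 'a \<Rightarrow>
     ('a \<Rightarrow> real measure) \<Rightarrow> bool" where
  "exit_time_kernel P W D x \<kappa> \<longleftrightarrow>
     \<kappa> \<in> restrict_space borel (frontier D) \<rightarrow>\<^sub>M prob_algebra (restrict_space borel {0<..}) \<and>
     (\<forall>A\<in>sets (restrict_space borel (frontier D)). \<forall>B\<in>sets (restrict_space borel {0<..}).
        emeasure (P x) {\<omega>\<in>space (P x). exit_time W D \<omega> < \<infinity> \<and> exit_point W D \<omega> \<in> A \<and>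
                          real_of_ereal (exit_time W D \<omega>) \<in> B}
        = (\<integral>\<^sup>+ y. emeasure (\<kappa> y) B * indicator A y \<partial>harmonic_measure P W D x))"

definition Z :: "('a \<Rightarrow> real measure) \<Rightarrow> real \<Rightarrow> 'a \<Rightarrow> real" where
  "Z \<kappa> \<mu> y = (\<integral>t. exp (- (\<mu>\<^sup>2 / 2) * t) \<partial>\<kappa> y)"

end

theory Submission
  imports Defs
begin

text \<open>
  Put \<open>\<lambda> = \<mu>\<^sup>2 / 2\<close> and \<open>v\<^sub>f x = E\<^sup>x[exp (- \<lambda> \<tau>) f(W \<tau>); \<tau> < \<infinity>]\<close>. By the Markov property at a fixed time \<open>h\<close> and
  a maximal inequality, \<open>v\<^sub>f\<close> differs inside \<open>D\<close> from the discounted Gaussian average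
  \<open>exp (- \<lambda> h) E[v\<^sub>f(x + W h)]\<close> only by \<open>O(h\<^sup>2)\<close>; this alone forces \<open>v\<^sub>f\<close> to be \<open>C\<^sup>2\<close> with
  \<open>\<Delta> v\<^sub>f = \<mu>\<^sup>2 v\<^sub>f\<close>. Regularity of the boundary gives continuity up to the boundary with boundary
  values \<open>f\<close>, and the maximum principle shows that \<open>v\<^sub>f\<close> is the only bounded solution. So for \<open>\<mu> > 0\<close>
  the panharmonic measure is the law of \<open>W \<tau>\<close> weighted by \<open>exp (- \<lambda> \<tau>)\<close>, and conditioning on
  \<open>W \<tau>\<close> yields the density \<open>Z\<close>. A null set for one pole is a zero of a nonnegative function \<open>v\<^sub>f\<close>;
  such zeros spread over the whole connected domain.
\<close>

section \<open>Gaussian averages\<close>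

text \<open>The order h^2 is dictated by the second derivative: two spatial derivatives of a
  Gaussian average over time t cost a factor 1/t, so a defect of size t^2 leaves t, which is
  summable along t = 2^-n; a defect of size t would leave nothing. That order comes from a fourth
  moment: leaving a ball of radius r before time h has probability at most a constant times h^2 /
  r^4. Working at fixed times h and comparing only paths that have not yet left D takes the place of
  the strong Markov property and of mean values over spheres. The measures \<open>P x\<close> are
  tied together only through laws, so increments are read at countably many dyadic times, where
  their joint law is the same for all poles, and exit time and exit point are recovered from this
  record by path continuity. The pole thereby becomes a parameter of an integral over one fixed
  measure. Zeros spread because a zero in D cannot lie on the boundary of a ball on which v is
  positive. Passing from one mu to another at a fixed pole rests on the weight exp (- lam tau) being
  positive wherever tau is finite.\<close>

lemma integral_lborel_affine:
  fixes F :: "'a::euclidean_space \<Rightarrow> real"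
  assumes [measurable]: "F \<in> borel_measurable borel" and c: "c \<noteq> 0"
  shows "(\<integral>z. F z \<partial>lborel) = \<bar>c\<bar> ^ DIM('a) * (\<integral>z. F (t + c *\<^sub>R z) \<partial>lborel)"
proof -
  have "(\<integral>z. F z \<partial>lborel) = (\<integral>z. F z \<partial>density (distr lborel borel (\<lambda>x. t + c *\<^sub>R x)) (\<lambda>_. \<bar>c\<bar> ^ DIM('a)))"
    by (rule arg_cong[where f="\<lambda>M. integral\<^sup>L M F"]) (rule lborel_affine[OF c])
  also have "\<dots> = (\<integral>z. \<bar>c\<bar> ^ DIM('a) *\<^sub>R F z \<partial>distr lborel borel (\<lambda>x. t + c *\<^sub>R x))"
    by (subst integral_density) auto
  also have "\<dots> = (\<integral>z. \<bar>c\<bar> ^ DIM('a) *\<^sub>R F (t + c *\<^sub>R z) \<partial>lborel)"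
    by (subst integral_distr) auto
  finally show ?thesis by simp
qed

text \<open>Dominated convergence for the difference quotients: the mean value inequality turns the
  bound \<open>B\<close> on \<open>f'\<close> into a bound on all of them. Dominated convergence
  speaks of sequences, hence the sequential form of the limit.\<close>

lemma integral_has_real_derivative:
  fixes f :: "real \<Rightarrow> 'a \<Rightarrow> real"
  assumes d: "0 < d"
    and int: "\<And>t. \<bar>t - t0\<bar> < d \<Longrightarrow> integrable M (f t)"
    and der: "\<And>t z. \<bar>t - t0\<bar> < d \<Longrightarrow> z \<in> space M \<Longrightarrow> ((\<lambda>t. f t z) has_real_derivative f' t z) (at t)"
    and bound: "\<And>t z. \<bar>t - t0\<bar> < d \<Longrightarrow> z \<in> space M \<Longrightarrow> \<bar>f' t z\<bar> \<le> B z"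
    and B: "integrable M B" and f': "f' t0 \<in> borel_measurable M"
  shows "((\<lambda>t. \<integral>z. f t z \<partial>M) has_real_derivative (\<integral>z. f' t0 z \<partial>M)) (at t0)"
  unfolding DERIV_def LIM_def[symmetric] tendsto_at_iff_sequentially
proof (intro allI impI)
  fix X :: "nat \<Rightarrow> real" assume X: "\<forall>i. X i \<in> UNIV - {0}" "X \<longlonglongrightarrow> 0"
  have ev: "\<forall>\<^sub>F n in sequentially. \<bar>X n\<bar> < d"
    using order_tendstoD(2)[OF tendsto_rabs[OF X(2)], of d] d by simp
  then obtain N where N: "\<And>n. n \<ge> N \<Longrightarrow> \<bar>X n\<bar> < d" by (auto simp: eventually_sequentially)
  \<comment> \<open>Dropping \<open>N\<close> terms puts every quotient, not merely almost every
    one, inside the neighbourhood where the bound holds.\<close>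
  define Y where "Y n = X (n + N)" for n
  have Y: "Y n \<noteq> 0" "\<bar>Y n\<bar> < d" for n using X N by (auto simp: Y_def)
  have Y0: "Y \<longlonglongrightarrow> 0" unfolding Y_def using X(2) by (rule LIMSEQ_ignore_initial_segment)
  have eq: "((\<integral>z. f (t0 + Y n) z \<partial>M) - (\<integral>z. f t0 z \<partial>M)) / Y n = (\<integral>z. (f (t0 + Y n) z - f t0 z) / Y n \<partial>M)" for n
    using int[of t0] int[of "t0 + Y n"] Y[of n] d by simp
  have "(\<lambda>n. \<integral>z. (f (t0 + Y n) z - f t0 z) / Y n \<partial>M) \<longlonglongrightarrow> (\<integral>z. f' t0 z \<partial>M)"
  proof (rule integral_dominated_convergence[where w=B])
    show "AE z in M. (\<lambda>n. (f (t0 + Y n) z - f t0 z) / Y n) \<longlonglongrightarrow> f' t0 z"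
    proof (rule AE_I2)
      fix z assume "z \<in> space M"
      then have "((\<lambda>h. (f (t0 + h) z - f t0 z) / h) \<longlongrightarrow> f' t0 z) (at 0)"
        using der[of t0 z] d by (simp add: DERIV_def)
      then show "(\<lambda>n. (f (t0 + Y n) z - f t0 z) / Y n) \<longlonglongrightarrow> f' t0 z"
        unfolding tendsto_at_iff_sequentially using Y Y0 by (auto simp: o_def)
    qed
    show "AE z in M. norm ((f (t0 + Y n) z - f t0 z) / Y n) \<le> B z" for n
    proof (rule AE_I2)
      fix z assume z: "z \<in> space M"
      have "norm (f (t0 + Y n) z - f t0 z) \<le> B z * norm (t0 + Y n - t0)"
      proof (rule field_differentiable_bound[where S="ball t0 d" and f'="\<lambda>t. f' t z"])
        show "((\<lambda>t. f t z) has_real_derivative f' t z) (at t within ball t0 d)" if "t \<in> ball t0 d" for t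
          using der[of t z] that z has_field_derivative_at_within by (auto simp: dist_real_def abs_minus_commute)
        show "norm (f' t z) \<le> B z" if "t \<in> ball t0 d" for t
          using bound[of t z] that z by (auto simp: dist_real_def abs_minus_commute)
      qed (use Y[of n] d in \<open>auto simp: dist_real_def\<close>)
      then show "norm ((f (t0 + Y n) z - f t0 z) / Y n) \<le> B z"
        using Y[of n] by (simp add: divide_le_eq)
    qed
    show "(\<lambda>z. (f (t0 + Y n) z - f t0 z) / Y n) \<in> borel_measurable M" for n
      using int[of t0] int[of "t0 + Y n"] Y[of n] d by (intro borel_measurable_divide borel_measurable_diff borel_measurable_integrable) auto
  qed (use B f' in auto)
  then have "(\<lambda>n. ((\<integral>z. f (t0 + Y n) z \<partial>M) - (\<integral>z. f t0 z \<partial>M)) / Y n) \<longlonglongrightarrow> (\<integral>z. f' t0 z \<partial>M)"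
    by (simp add: eq)
  then have "(\<lambda>n. ((\<integral>z. f (t0 + X n) z \<partial>M) - (\<integral>z. f t0 z \<partial>M)) / X n) \<longlonglongrightarrow> (\<integral>z. f' t0 z \<partial>M)"
    unfolding Y_def by (rule LIMSEQ_offset)
  then show "((\<lambda>h. ((\<integral>z. f (t0 + h) z \<partial>M) - (\<integral>z. f t0 z \<partial>M)) / h) \<circ> X) \<longlonglongrightarrow> (\<integral>z. f' t0 z \<partial>M)"
    by (simp add: o_def)
qed

section \<open>The heat kernel of half the Laplacian: variance h in each coordinate\<close>

definition heat :: "real \<Rightarrow> 'a::euclidean_space \<Rightarrow> real" where
  "heat h z = (1 / sqrt (2 * pi * h)) ^ DIM('a) * exp (- (norm z)\<^sup>2 / (2 * h))"

lemma prod_normal_density: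
  fixes z :: "'a::euclidean_space"
  assumes "0 < h"
  shows "(\<Prod>b\<in>Basis. normal_density 0 (sqrt h) (z \<bullet> b)) = heat h z"
proof -
  have n: "(norm z)\<^sup>2 = (\<Sum>b\<in>Basis. (z \<bullet> b)\<^sup>2)"
    unfolding power2_norm_eq_inner by (subst euclidean_inner) (simp add: power2_eq_square)
  have "(\<Prod>b\<in>Basis. normal_density 0 (sqrt h) (z \<bullet> b)) =
      (\<Prod>b\<in>(Basis::'a set). (1 / sqrt (2 * pi * h)) * exp (- (z \<bullet> b)\<^sup>2 / (2 * h)))"
    using assms by (intro prod.cong refl) (simp add: normal_density_def)
  also have "\<dots> = (1 / sqrt (2 * pi * h)) ^ DIM('a) * (\<Prod>b\<in>Basis. exp (- (z \<bullet> b)\<^sup>2 / (2 * h)))"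
    by (subst prod.distrib) (simp only: prod_constant)
  also have "(\<Prod>b\<in>Basis. exp (- (z \<bullet> b)\<^sup>2 / (2 * h))) = exp (\<Sum>b\<in>Basis. - (z \<bullet> b)\<^sup>2 / (2 * h))"
    by (subst exp_sum) auto
  also have "(\<Sum>b\<in>Basis. - (z \<bullet> b)\<^sup>2 / (2 * h)) = - (norm z)\<^sup>2 / (2 * h)"
    by (simp only: sum_divide_distrib[symmetric] sum_negf n)
  finally show ?thesis by (simp only: heat_def)
qed

lemma heat_pos: "0 < h \<Longrightarrow> 0 < heat h z"
  by (simp add: heat_def)

lemma continuous_on_heat [continuous_intros]: "continuous_on S (heat h)"
  unfolding heat_def divide_inverse by (intro continuous_intros)

lemma borel_measurable_heat [measurable]: "heat h \<in> borel_measurable borel"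
  by (intro borel_measurable_continuous_onI continuous_on_heat)

lemma nn_integral_heat:
  assumes "0 < h" shows "(\<integral>\<^sup>+z. ennreal (heat h (z::'a::euclidean_space)) \<partial>lborel) = 1"
proof -
  have "(\<integral>\<^sup>+z. ennreal (heat h (z::'a)) \<partial>lborel) = (\<integral>\<^sup>+z. (\<Prod>b\<in>Basis. ennreal (normal_density 0 (sqrt h) ((z::'a) \<bullet> b))) \<partial>lborel)"
    using assms by (simp add: prod_normal_density[symmetric] prod_ennreal)
  also have "\<dots> = (\<Prod>b\<in>(Basis::'a set). \<integral>\<^sup>+t. ennreal (normal_density 0 (sqrt h) t) \<partial>lborel)"
    by (rule nn_integral_lborel_prod) auto
  also have "(\<integral>\<^sup>+t. ennreal (normal_density 0 (sqrt h) t) \<partial>lborel) = 1"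
    using assms by (subst nn_integral_eq_integral) (auto simp: integral_normal_density integrable_normal_density)
  finally show ?thesis by simp
qed

lemma integrable_heat: "0 < h \<Longrightarrow> integrable lborel (heat h)"
  by (rule integrableI_nonneg) (auto simp: nn_integral_heat heat_pos less_imp_le)

lemma integral_heat: "0 < h \<Longrightarrow> (\<integral>z. heat h z \<partial>lborel) = 1"
  by (subst integral_eq_nn_integral) (auto simp: nn_integral_heat heat_pos less_imp_le)

lemma integrable_exp_norm:
  assumes "0 < a" shows "integrable lborel (\<lambda>z::'a::euclidean_space. exp (- (norm z)\<^sup>2 / a))"
proof -
  have "integrable lborel (\<lambda>z::'a. heat (a/2) z * (sqrt (pi * a)) ^ DIM('a))"
    using integrable_heat[of "a/2"] assms by simp
  moreover have "heat (a/2) z * (sqrt (pi * a)) ^ DIM('a) = exp (- (norm z)\<^sup>2 / a)" for z :: 'a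
    using assms by (simp add: heat_def power_one_over)
  ultimately show ?thesis by simp
qed

section \<open>Kernels with Gaussian decay and averages against them\<close>

lemma pow_exp_bound:
  assumes "0 \<le> (x::real)" shows "x ^ j * exp (- x\<^sup>2 / 4) \<le> fact j * exp 1"
proof -
  have 1: "x ^ j / fact j \<le> exp x"
  proof -
    have "(\<Sum>i\<in>{j}. x ^ i / fact i) \<le> (\<Sum>i. x ^ i / fact i)"
      using summable_exp[of x] assms by (intro sum_le_suminf) (auto simp: field_simps)
    then show ?thesis by (simp add: exp_def divide_inverse mult.commute)
  qed
  \<comment> \<open>This is (x/2 - 1)^2 \<ge> 0; together with x^j / j! \<le> exp x it produces the
    constant j! e.\<close>
  have "x \<le> x\<^sup>2/4 + 1" using zero_le_power2[of "x/2 - 1"] by (simp add: power2_eq_square field_simps)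
  then have "exp x \<le> exp (x\<^sup>2/4) * exp 1" by (simp add: exp_add[symmetric])
  with 1 have "x ^ j / fact j \<le> exp (x\<^sup>2/4) * exp 1" by linarith
  then have "x ^ j \<le> fact j * (exp (x\<^sup>2/4) * exp 1)"
    using fact_gt_zero[of j, where 'a=real] by (simp only: pos_divide_le_eq mult.commute)
  then have "x ^ j * exp (- x\<^sup>2 / 4) \<le> fact j * (exp (x\<^sup>2/4) * exp 1) * exp (- x\<^sup>2 / 4)"
    by (intro mult_right_mono) auto
  also have "\<dots> = fact j * exp 1" by (simp add: exp_minus divide_simps)
  finally show ?thesis .
qed

text \<open>The rate 1/4, half of that of \<open>heat 1\<close>, leaves room for polynomial factors.
  Demanding the bound after multiplication by every power of the norm makes the class closed under
  multiplication by linear forms, hence stable under the derivatives of the Gaussian formed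
  below.\<close>

definition gauss_dom :: "('a::euclidean_space \<Rightarrow> real) \<Rightarrow> bool" where
  "gauss_dom k \<longleftrightarrow> continuous_on UNIV k \<and>
     (\<forall>j::nat. \<exists>C. \<forall>z. norm z ^ j * \<bar>k z\<bar> \<le> C * exp (- (norm z)\<^sup>2 / 4))"

lemma gauss_dom_gauss: "gauss_dom (heat 1 :: 'a::euclidean_space \<Rightarrow> real)"
  unfolding gauss_dom_def
proof (intro conjI allI)
  fix j :: nat
  let ?c = "(1 / sqrt (2 * pi)) ^ DIM('a)"
  have "norm z ^ j * \<bar>heat 1 z\<bar> \<le> (?c * (fact j * exp 1)) * exp (- (norm z)\<^sup>2 / 4)" for z :: 'a
  proof -
    have "\<bar>heat 1 z\<bar> = ?c * (exp (- (norm z)\<^sup>2 / 4) * exp (- (norm z)\<^sup>2 / 4))"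
      by (simp add: heat_def mult_exp_exp)
    then have "norm z ^ j * \<bar>heat 1 z\<bar> = ?c * (norm z ^ j * exp (- (norm z)\<^sup>2 / 4)) * exp (- (norm z)\<^sup>2 / 4)"
      by (simp add: algebra_simps)
    also have "\<dots> \<le> ?c * (fact j * exp 1) * exp (- (norm z)\<^sup>2 / 4)"
      using pow_exp_bound[of "norm z" j] by (intro mult_right_mono mult_left_mono) auto
    finally show ?thesis .
  qed
  then show "\<exists>C. \<forall>z::'a. norm z ^ j * \<bar>heat 1 z\<bar> \<le> C * exp (- (norm z)\<^sup>2 / 4)" by blast
qed (rule continuous_on_heat)

lemma gauss_dom_inner:
  assumes "gauss_dom k" shows "gauss_dom (\<lambda>z. (z \<bullet> b) * k z)"
  unfolding gauss_dom_def
proof (intro conjI allI)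
  show "continuous_on UNIV (\<lambda>z. (z \<bullet> b) * k z)"
    using assms by (auto simp: gauss_dom_def intro!: continuous_intros)
  fix j :: nat
  obtain C where C: "\<And>z. norm z ^ Suc j * \<bar>k z\<bar> \<le> C * exp (- (norm z)\<^sup>2 / 4)"
    using assms unfolding gauss_dom_def by metis
  have "norm z ^ j * \<bar>(z \<bullet> b) * k z\<bar> \<le> (norm b * C) * exp (- (norm z)\<^sup>2 / 4)" for z
  proof -
    have "norm z ^ j * \<bar>(z \<bullet> b) * k z\<bar> \<le> norm z ^ j * ((norm z * norm b) * \<bar>k z\<bar>)"
      unfolding abs_mult by (intro mult_left_mono mult_right_mono Cauchy_Schwarz_ineq2) auto
    also have "\<dots> = norm b * (norm z ^ Suc j * \<bar>k z\<bar>)" by simp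
    also have "\<dots> \<le> norm b * (C * exp (- (norm z)\<^sup>2 / 4))" by (intro mult_left_mono C) auto
    finally show ?thesis by simp
  qed
  then show "\<exists>C. \<forall>z. norm z ^ j * \<bar>(z \<bullet> b) * k z\<bar> \<le> C * exp (- (norm z)\<^sup>2 / 4)" by blast
qed

lemma gauss_dom_diff:
  assumes "gauss_dom k" "gauss_dom l" shows "gauss_dom (\<lambda>z. k z - c * l z)"
  unfolding gauss_dom_def
proof (intro conjI allI)
  show "continuous_on UNIV (\<lambda>z. k z - c * l z)"
    using assms by (auto simp: gauss_dom_def intro!: continuous_intros)
  fix j :: nat
  obtain C where C: "\<And>z. norm z ^ j * \<bar>k z\<bar> \<le> C * exp (- (norm z)\<^sup>2 / 4)"
    using assms unfolding gauss_dom_def by metis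
  obtain D where D: "\<And>z. norm z ^ j * \<bar>l z\<bar> \<le> D * exp (- (norm z)\<^sup>2 / 4)"
    using assms unfolding gauss_dom_def by metis
  have "norm z ^ j * \<bar>k z - c * l z\<bar> \<le> (C + \<bar>c\<bar> * D) * exp (- (norm z)\<^sup>2 / 4)" for z
  proof -
    have "norm z ^ j * \<bar>k z - c * l z\<bar> \<le> norm z ^ j * (\<bar>k z\<bar> + \<bar>c\<bar> * \<bar>l z\<bar>)"
      using abs_triangle_ineq4[of "k z" "c * l z"] by (intro mult_left_mono) (auto simp: abs_mult)
    also have "\<dots> = norm z ^ j * \<bar>k z\<bar> + \<bar>c\<bar> * (norm z ^ j * \<bar>l z\<bar>)" by (simp add: algebra_simps)
    also have "\<dots> \<le> C * exp (- (norm z)\<^sup>2 / 4) + \<bar>c\<bar> * (D * exp (- (norm z)\<^sup>2 / 4))"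
      using C[of z] D[of z] by (intro add_mono mult_left_mono) auto
    finally show ?thesis by (simp add: algebra_simps)
  qed
  then show "\<exists>C. \<forall>z. norm z ^ j * \<bar>k z - c * l z\<bar> \<le> C * exp (- (norm z)\<^sup>2 / 4)" by blast
qed

lemma gauss_dom_measurable: "gauss_dom k \<Longrightarrow> k \<in> borel_measurable borel"
  by (auto simp: gauss_dom_def intro: borel_measurable_continuous_onI)

lemma gauss_dom_integrable_pow:
  assumes "gauss_dom k" shows "integrable lborel (\<lambda>z. norm z ^ j * \<bar>k z\<bar>)"
proof -
  obtain C where C: "\<And>z. norm z ^ j * \<bar>k z\<bar> \<le> C * exp (- (norm z)\<^sup>2 / 4)"
    using assms unfolding gauss_dom_def by metis
  have [measurable]: "k \<in> borel_measurable borel" by (rule gauss_dom_measurable[OF assms])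
  show ?thesis
  proof (rule Bochner_Integration.integrable_bound[where f="\<lambda>z. C * exp (- (norm z)\<^sup>2 / 4)"])
    show "AE z in lborel. norm (norm z ^ j * \<bar>k z\<bar>) \<le> norm (C * exp (- (norm z)\<^sup>2 / 4))"
    proof (rule AE_I2)
      fix z
      have "norm (norm z ^ j * \<bar>k z\<bar>) = norm z ^ j * \<bar>k z\<bar>" by simp
      also have "\<dots> \<le> norm (C * exp (- (norm z)\<^sup>2 / 4))"
        using C[of z] unfolding real_norm_def by linarith
      finally show "norm (norm z ^ j * \<bar>k z\<bar>) \<le> norm (C * exp (- (norm z)\<^sup>2 / 4))" .
    qed
    show "integrable lborel (\<lambda>z::'a. C * exp (- (norm z)\<^sup>2 / 4))"
      by (intro integrable_mult_right integrable_exp_norm) auto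
  qed auto
qed

lemma gauss_dom_integrable: "gauss_dom k \<Longrightarrow> integrable lborel k"
  using gauss_dom_integrable_pow[of k 0] gauss_dom_measurable[of k] by (simp add: integrable_abs_iff)

text \<open>One integrable majorant for all small shifts: |z|^2 \<le> 2 |z - y|^2 + 2 for |y| \<le>
  1 costs half of the rate 1/4 and a factor exp (1/4).\<close>

lemma gauss_dom_shift_bound:
  fixes k :: "'a::euclidean_space \<Rightarrow> real"
  assumes "gauss_dom k"
  obtains C where "\<And>z y. norm y \<le> 1 \<Longrightarrow> \<bar>k (z - y)\<bar> \<le> C * exp (- (norm z)\<^sup>2 / 8)"
proof -
  obtain C where C: "\<And>z. norm z ^ 0 * \<bar>k z\<bar> \<le> C * exp (- (norm z)\<^sup>2 / 4)"
    using assms unfolding gauss_dom_def by metis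
  have C0: "C \<ge> 0" using C[of 0] by simp
  have "\<bar>k (z - y)\<bar> \<le> (C * exp (1/4)) * exp (- (norm z)\<^sup>2 / 8)" if "norm y \<le> 1" for y z :: 'a
  proof -
    have "norm z \<le> norm (z - y) + 1" using norm_triangle_ineq2[of z y] that by linarith
    then have "(norm z)\<^sup>2 \<le> (norm (z - y) + 1)\<^sup>2" by (intro power_mono) auto
    also have "\<dots> \<le> 2 * (norm (z - y))\<^sup>2 + 2"
      using zero_le_power2[of "norm (z - y) - 1"] by (simp add: power2_eq_square algebra_simps)
    finally have "- (norm (z - y))\<^sup>2 / 4 \<le> 1/4 + - (norm z)\<^sup>2 / 8" by simp
    then have "exp (- (norm (z - y))\<^sup>2 / 4) \<le> exp (1/4) * exp (- (norm z)\<^sup>2 / 8)"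
      by (metis exp_le_cancel_iff exp_add)
    then have "C * exp (- (norm (z - y))\<^sup>2 / 4) \<le> C * (exp (1/4) * exp (- (norm z)\<^sup>2 / 8))"
      using C0 by (rule mult_left_mono)
    then show ?thesis using C[of "z - y"] by (simp add: mult.assoc)
  qed
  then show ?thesis using that by blast
qed

text \<open>For \<open>k = heat 1\<close> this is the mean of g at x plus a Brownian displacement
  over time h. The kernel is kept at unit scale: putting a derivative of it in its place yields the
  derivative of the average up to powers of sqrt h, with constants independent of h.\<close>

definition smooth_avg :: "('a::euclidean_space \<Rightarrow> real) \<Rightarrow> real \<Rightarrow> ('a \<Rightarrow> real) \<Rightarrow> 'a \<Rightarrow> real" where
  "smooth_avg k h g x = (\<integral>z. k z * g (x + sqrt h *\<^sub>R z) \<partial>lborel)"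

lemma integrable_mult_bounded:
  fixes k g :: "'b \<Rightarrow> real"
  assumes "integrable M k" and [measurable]: "g \<in> borel_measurable M" and g: "\<And>y. \<bar>g y\<bar> \<le> C"
  shows "integrable M (\<lambda>z. k z * g z)"
proof (rule Bochner_Integration.integrable_bound[where f="\<lambda>z. C * \<bar>k z\<bar>"])
  show "AE z in M. norm (k z * g z) \<le> norm (C * \<bar>k z\<bar>)"
  proof (rule AE_I2)
    fix z
    have "\<bar>k z\<bar> * \<bar>g z\<bar> \<le> \<bar>k z\<bar> * \<bar>C\<bar>" using g[of z] by (intro mult_left_mono) auto
    then show "norm (k z * g z) \<le> norm (C * \<bar>k z\<bar>)" by (simp add: abs_mult mult.commute)
  qed
qed (use assms in auto)

text \<open>Moves the translation from \<open>g\<close>, which is only measurable, to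
  \<open>k\<close>; regularity of the average in x then comes from that of the kernel.\<close>

lemma smooth_avg_shift:
  fixes k :: "'a::euclidean_space \<Rightarrow> real"
  assumes [measurable]: "k \<in> borel_measurable borel" "g \<in> borel_measurable borel" and "0 < h"
  shows "smooth_avg k h g (x + y) = (\<integral>z. k (z - (1 / sqrt h) *\<^sub>R y) * g (x + sqrt h *\<^sub>R z) \<partial>lborel)"
  unfolding smooth_avg_def using assms(3)
  by (subst integral_lborel_affine[where c=1 and t="- (1 / sqrt h) *\<^sub>R y"]) (auto simp: algebra_simps)

lemma continuous_smooth_avg:
  fixes k :: "'a::euclidean_space \<Rightarrow> real"
  assumes k: "gauss_dom k" and [measurable]: "g \<in> borel_measurable borel" and g: "\<And>y. \<bar>g y\<bar> \<le> C" and h: "0 < h"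
  shows "continuous_on S (smooth_avg k h g)"
proof (rule continuous_at_imp_continuous_on, rule ballI)
  fix x
  have [measurable]: "k \<in> borel_measurable borel" by (rule gauss_dom_measurable[OF k])
  obtain B where B: "\<And>z y. norm y \<le> 1 \<Longrightarrow> \<bar>k (z - y)\<bar> \<le> B * exp (- (norm z)\<^sup>2 / 8)"
    using gauss_dom_shift_bound[OF k] by blast
  show "isCont (smooth_avg k h g) x"
  proof (rule continuous_within_sequentiallyI)
    fix u :: "nat \<Rightarrow> 'a" assume u: "u \<longlonglongrightarrow> x"
    define y where "y n = (1 / sqrt h) *\<^sub>R (u n - x)" for n
    have y0: "y \<longlonglongrightarrow> 0"
      unfolding y_def using u by (auto intro!: tendsto_eq_intros)
    then have "\<forall>\<^sub>F n in sequentially. norm (y n) < 1"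
      by (metis norm_zero order_tendstoD(2) tendsto_norm zero_less_one)
    then obtain N where N: "\<And>n. n \<ge> N \<Longrightarrow> norm (y n) \<le> 1" unfolding eventually_sequentially by (meson less_imp_le)
    have eq: "smooth_avg k h g (u n) = (\<integral>z. k (z - y n) * g (x + sqrt h *\<^sub>R z) \<partial>lborel)" for n
      using smooth_avg_shift[of k g h x "u n - x"] h by (simp add: y_def)
    have "(\<lambda>n. \<integral>z. k (z - y (n + N)) * g (x + sqrt h *\<^sub>R z) \<partial>lborel) \<longlonglongrightarrow> (\<integral>z. k z * g (x + sqrt h *\<^sub>R z) \<partial>lborel)"
    proof (rule integral_dominated_convergence[where w="\<lambda>z. (B * exp (- (norm z)\<^sup>2 / 8)) * C"])
      show "AE z in lborel. (\<lambda>n. k (z - y (n + N)) * g (x + sqrt h *\<^sub>R z)) \<longlonglongrightarrow> k z * g (x + sqrt h *\<^sub>R z)"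
      proof (rule AE_I2)
        fix z
        have "(\<lambda>n. z - y (n + N)) \<longlonglongrightarrow> z"
          using LIMSEQ_ignore_initial_segment[OF y0, of N] by (auto intro!: tendsto_eq_intros)
        moreover have "isCont k z" using k by (auto simp: gauss_dom_def continuous_on_eq_continuous_at)
        ultimately show "(\<lambda>n. k (z - y (n + N)) * g (x + sqrt h *\<^sub>R z)) \<longlonglongrightarrow> k z * g (x + sqrt h *\<^sub>R z)"
          by (intro tendsto_mult tendsto_const isCont_tendsto_compose[of z k])
      qed
      show "AE z in lborel. norm (k (z - y (n + N)) * g (x + sqrt h *\<^sub>R z)) \<le> (B * exp (- (norm z)\<^sup>2 / 8)) * C" for n
      proof (rule AE_I2)
        fix z
        have "\<bar>k (z - y (n + N))\<bar> * \<bar>g (x + sqrt h *\<^sub>R z)\<bar> \<le> (B * exp (- (norm z)\<^sup>2 / 8)) * C"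
          using B[of "y (n+N)" z] N[of "n + N"] g[of "x + sqrt h *\<^sub>R z"]
          by (intro mult_mono) (auto intro: order_trans[OF abs_ge_zero[of "k (z - y (n+N))"]])
        then show "norm (k (z - y (n + N)) * g (x + sqrt h *\<^sub>R z)) \<le> (B * exp (- (norm z)\<^sup>2 / 8)) * C" by (simp add: abs_mult)
      qed
      show "integrable lborel (\<lambda>z::'a. B * exp (- (norm z)\<^sup>2 / 8) * C)"
        by (intro integrable_mult_left integrable_mult_right integrable_exp_norm) auto
    qed measurable
    then have "(\<lambda>n. smooth_avg k h g (u (n + N))) \<longlonglongrightarrow> smooth_avg k h g x"
      unfolding eq[symmetric] by (simp add: smooth_avg_def)
    then show "(\<lambda>n. smooth_avg k h g (u n)) \<longlonglongrightarrow> smooth_avg k h g x" by (rule LIMSEQ_offset)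
  qed
qed

text \<open>The minus sign in the hypothesis on \<open>k\<close> is that of
  \<open>smooth_avg_shift\<close>. The kernel is shifted by t / sqrt h, so the chain rule
  contributes 1 / sqrt h.\<close>

lemma has_real_derivative_smooth_avg:
  fixes k :: "'a::euclidean_space \<Rightarrow> real"
  assumes k: "gauss_dom k" and k': "gauss_dom k'"
    and der: "\<And>z. ((\<lambda>s. k (z - s *\<^sub>R b)) has_real_derivative k' z) (at 0)"
    and [measurable]: "g \<in> borel_measurable borel" and g: "\<And>y. \<bar>g y\<bar> \<le> C" and h: "0 < h" and b: "norm b = 1"
  shows "((\<lambda>t. smooth_avg k h g (x + t *\<^sub>R b)) has_real_derivative (1 / sqrt h * smooth_avg k' h g x)) (at 0)"
proof -
  have [measurable]: "k \<in> borel_measurable borel" "k' \<in> borel_measurable borel"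
    using k k' by (auto intro: gauss_dom_measurable)
  obtain B where B: "\<And>z y. norm y \<le> 1 \<Longrightarrow> \<bar>k' (z - y)\<bar> \<le> B * exp (- (norm z)\<^sup>2 / 8)"
    using gauss_dom_shift_bound[OF k'] by blast
  obtain B' where B': "\<And>z y. norm y \<le> 1 \<Longrightarrow> \<bar>k (z - y)\<bar> \<le> B' * exp (- (norm z)\<^sup>2 / 8)"
    using gauss_dom_shift_bound[OF k] by blast
  have der': "((\<lambda>s. k (z - s *\<^sub>R b)) has_real_derivative k' (z - t *\<^sub>R b)) (at t)" for z t
    using der[of "z - t *\<^sub>R b"] unfolding DERIV_def by (simp add: algebra_simps)
  have "((\<lambda>s. \<integral>z. k (z - s *\<^sub>R b) * g (x + sqrt h *\<^sub>R z) \<partial>lborel) has_real_derivative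
      (\<integral>z. k' (z - 0 *\<^sub>R b) * g (x + sqrt h *\<^sub>R z) \<partial>lborel)) (at 0)"
  proof (rule integral_has_real_derivative[where d=1 and B="\<lambda>z. (B * exp (- (norm z)\<^sup>2 / 8)) * C"])
    show "integrable lborel (\<lambda>z. k (z - t *\<^sub>R b) * g (x + sqrt h *\<^sub>R z))" if "\<bar>t - 0\<bar> < 1" for t
    proof (rule integrable_mult_bounded[where C=C])
      show "integrable lborel (\<lambda>z. k (z - t *\<^sub>R b))"
      proof (rule Bochner_Integration.integrable_bound[where f="\<lambda>z. B' * exp (- (norm z)\<^sup>2 / 8)"])
        show "AE z in lborel. norm (k (z - t *\<^sub>R b)) \<le> norm (B' * exp (- (norm z)\<^sup>2 / 8))"
        proof (rule AE_I2)
          fix z show "norm (k (z - t *\<^sub>R b)) \<le> norm (B' * exp (- (norm z)\<^sup>2 / 8))"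
            using B'[of "t *\<^sub>R b" z] that b unfolding real_norm_def by (simp add: less_imp_le)
        qed
        show "integrable lborel (\<lambda>z::'a. B' * exp (- (norm z)\<^sup>2 / 8))"
          by (intro integrable_mult_right integrable_exp_norm) auto
      qed auto
    qed (auto simp: g)
    show "((\<lambda>t. k (z - t *\<^sub>R b) * g (x + sqrt h *\<^sub>R z)) has_real_derivative k' (z - t *\<^sub>R b) * g (x + sqrt h *\<^sub>R z)) (at t)" for t z
      by (rule DERIV_cmult_right[OF der'])
    show "\<bar>k' (z - t *\<^sub>R b) * g (x + sqrt h *\<^sub>R z)\<bar> \<le> (B * exp (- (norm z)\<^sup>2 / 8)) * C" if "\<bar>t - 0\<bar> < 1" for t z
      unfolding abs_mult using B[of "t *\<^sub>R b" z] g[of "x + sqrt h *\<^sub>R z"] that b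
      by (intro mult_mono) (auto simp: less_imp_le intro: order_trans[OF abs_ge_zero[of "k' (z - t *\<^sub>R b)"]])
    show "integrable lborel (\<lambda>z::'a. B * exp (- (norm z)\<^sup>2 / 8) * C)"
      by (intro integrable_mult_left integrable_mult_right integrable_exp_norm) auto
  qed auto
  then have D: "((\<lambda>s. \<integral>z. k (z - s *\<^sub>R b) * g (x + sqrt h *\<^sub>R z) \<partial>lborel) has_real_derivative smooth_avg k' h g x) (at ((1/sqrt h) * 0))"
    by (simp add: smooth_avg_def)
  have "((\<lambda>t. \<integral>z. k (z - ((1/sqrt h) * t) *\<^sub>R b) * g (x + sqrt h *\<^sub>R z) \<partial>lborel) has_real_derivative smooth_avg k' h g x * (1 / sqrt h)) (at 0)"
    by (rule DERIV_chain2[where g="\<lambda>t. (1/sqrt h) * t", OF D]) (rule DERIV_cmult_Id)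
  moreover have "smooth_avg k h g (x + t *\<^sub>R b) = (\<integral>z. k (z - ((1/sqrt h) * t) *\<^sub>R b) * g (x + sqrt h *\<^sub>R z) \<partial>lborel)" for t
    unfolding smooth_avg_shift[OF \<open>k \<in> borel_measurable borel\<close> \<open>g \<in> borel_measurable borel\<close> h] scaleR_scaleR ..
  ultimately show ?thesis by (simp add: mult.commute)
qed

section \<open>Chapman-Kolmogorov: the averages form a semigroup\<close>

lemma heat_scaleR: "0 < h \<Longrightarrow> sqrt h ^ DIM('a) * heat h (sqrt h *\<^sub>R z) = heat 1 (z::'a::euclidean_space)"
  by (simp add: heat_def real_sqrt_mult power_mult_distrib power_one_over field_simps)

lemma smooth_avg_heat:
  fixes g :: "'a::euclidean_space \<Rightarrow> real"
  assumes [measurable]: "g \<in> borel_measurable borel" and h: "0 < h"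
  shows "smooth_avg (heat 1) h g x = (\<integral>z. heat h z * g (x + z) \<partial>lborel)"
proof -
  have "(\<integral>z. heat h z * g (x + z) \<partial>lborel) =
      \<bar>sqrt h\<bar> ^ DIM('a) * (\<integral>z. heat h (0 + sqrt h *\<^sub>R z) * g (x + (0 + sqrt h *\<^sub>R z)) \<partial>lborel)"
    by (rule integral_lborel_affine) (use h in auto)
  also have "\<dots> = (\<integral>z. (sqrt h ^ DIM('a) * heat h (sqrt h *\<^sub>R z)) * g (x + sqrt h *\<^sub>R z) \<partial>lborel)"
    using h by (simp add: mult.assoc)
  finally show ?thesis using h by (simp add: heat_scaleR smooth_avg_def)
qed

text \<open>Completing the square in u. The last factor is the density, at time s, of a Brownian
  bridge from 0 to y of length s + t, so integrating out u leaves
  \<open>heat (s + t) y\<close>.\<close>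

lemma heat_mult:
  fixes u y :: "'a::euclidean_space"
  assumes s: "0 < s" and t: "0 < t"
  shows "heat s u * heat t (y - u) = heat (s + t) y * heat (s * t / (s + t)) (u - (s / (s + t)) *\<^sub>R y)"
proof -
  have st: "s + t > 0" using s t by simp
  have e: "(norm u)\<^sup>2 / (2 * s) + (norm (y - u))\<^sup>2 / (2 * t) =
      (norm y)\<^sup>2 / (2 * (s + t)) + (norm (u - (s / (s + t)) *\<^sub>R y))\<^sup>2 / (2 * (s * t / (s + t)))"
  proof -
    \<comment> \<open>To be read with a = |u|^2, b = |y|^2 and c = u \<bullet> y.\<close>
    have id: "a / (2 * s) + (b - 2 * c + a) / (2 * t) =
        b / (2 * (s + t)) + (a - 2 * (s / (s + t)) * c + (s / (s + t))\<^sup>2 * b) / (2 * (s * t / (s + t)))" for a b c :: real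
    proof -
      define m where "m = s + t"
      have m: "m > 0" using st by (simp add: m_def)
      have 1: "(a - 2 * (s / m) * c + (s / m)\<^sup>2 * b) / (2 * (s * t / m)) = a * (m / (2 * s * t)) - c / t + b * (s / (2 * t * m))"
        using s t m by (simp add: field_simps power2_eq_square)
      have 2: "m / (2 * s * t) = 1 / (2 * s) + 1 / (2 * t)"
        unfolding m_def using s t by (simp add: field_simps)
      have 3: "s / (2 * t * m) = 1 / (2 * t) - 1 / (2 * m)"
        unfolding m_def using s t st by (simp add: divide_simps)
      have 4: "b / (2 * m) + (a * (1 / (2 * s) + 1 / (2 * t)) - c / t + b * (1 / (2 * t) - 1 / (2 * m))) = a / (2 * s) + (b - 2 * c + a) / (2 * t)"
        by (simp add: algebra_simps add_divide_distrib diff_divide_distrib)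
      show ?thesis by (simp only: m_def[symmetric] 1 2 3 4)
    qed
    have 1: "(norm (y - u))\<^sup>2 = (norm y)\<^sup>2 - 2 * (u \<bullet> y) + (norm u)\<^sup>2"
      by (simp add: power2_norm_eq_inner inner_diff inner_commute)
    have 2: "(norm (u - c *\<^sub>R y))\<^sup>2 = (norm u)\<^sup>2 - 2 * c * (u \<bullet> y) + c\<^sup>2 * (norm y)\<^sup>2" for c
      unfolding power2_norm_eq_inner by (simp add: inner_diff inner_commute power2_eq_square algebra_simps)
    show ?thesis unfolding 1 2 by (rule id)
  qed
  have c: "(1 / sqrt (2 * pi * s)) * (1 / sqrt (2 * pi * t)) = (1 / sqrt (2 * pi * (s + t))) * (1 / sqrt (2 * pi * (s * t / (s + t))))"
    using s t st by (simp add: real_sqrt_mult[symmetric] real_sqrt_divide[symmetric] field_simps)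
  have gen: "(a ^ n * exp (- p)) * (b ^ n * exp (- q)) = (a * b) ^ n * exp (- (p + q))" for a b p q :: real and n
    using exp_add[of "-p" "-q"] by (simp add: power_mult_distrib)
  show ?thesis
    unfolding heat_def minus_divide_left[symmetric] gen e c ..
qed

lemma integral_heat_shift: "0 < h \<Longrightarrow> (\<integral>u. heat h (u - a) \<partial>lborel) = 1"
  using integral_lborel_affine[of "heat h" 1 "-a"] by (simp add: integral_heat algebra_simps)

text \<open>A non-integrable function has Bochner integral 0 by convention, so the value 1 already
  proves integrability.\<close>

lemma integrable_heat_shift: "0 < h \<Longrightarrow> integrable lborel (\<lambda>u. heat h (u - a))"
  using integral_heat_shift[of h a] by (metis not_integrable_integral_eq zero_neq_one)

text \<open>Fubini for the joint density \<open>F\<close> of the displacements at times s and s + t;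
  by \<open>heat_mult\<close> the integral over the intermediate position is the total mass of a
  bridge density.\<close>

lemma smooth_avg_semigroup:
  fixes g :: "'a::euclidean_space \<Rightarrow> real"
  assumes [measurable]: "g \<in> borel_measurable borel" and g: "\<And>y. \<bar>g y\<bar> \<le> C" and s: "0 < s" and t: "0 < t"
  shows "smooth_avg (heat 1) (s + t) g x = smooth_avg (heat 1) s (smooth_avg (heat 1) t g) x"
proof -
  interpret L: pair_sigma_finite "lborel :: 'a measure" "lborel :: 'a measure" ..
  have st: "s + t > 0" "s * t / (s + t) > 0" using s t by auto
  define F where "F = (\<lambda>(u::'a, y::'a). heat s u * heat t (y - u))"
  have Fm [measurable]: "F \<in> borel_measurable (lborel \<Otimes>\<^sub>M lborel)"
    unfolding F_def by measurable
  have F0: "F (u, y) \<ge> 0" for u y using s t by (simp add: F_def heat_pos less_imp_le)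
  have intF: "integrable (lborel \<Otimes>\<^sub>M lborel) F"
  proof (rule lborel_pair.Fubini_integrable)
    show "integrable lborel (\<lambda>u. \<integral>y. norm (F (u, y)) \<partial>lborel)"
      using F0 integrable_heat[OF s] t by (simp add: F_def integral_heat_shift)
    show "AE u in lborel. integrable lborel (\<lambda>y. F (u, y))"
      using t by (auto simp: F_def intro!: integrable_mult_right integrable_heat_shift)
  qed measurable
  have intFg: "integrable (lborel \<Otimes>\<^sub>M lborel) (\<lambda>(u, y). F (u, y) * g (x + y))"
    using integrable_mult_bounded[OF intF, of "\<lambda>(u, y). g (x + y)" C] g by (auto simp: case_prod_beta')
  have mt [measurable]: "smooth_avg (heat 1) t g \<in> borel_measurable borel"
    by (rule borel_measurable_continuous_onI, rule continuous_smooth_avg[OF gauss_dom_gauss, of g C]) (use g t in auto)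
  have "smooth_avg (heat 1) s (smooth_avg (heat 1) t g) x =
      (\<integral>u. heat s u * (\<integral>y. heat t y * g (x + u + y) \<partial>lborel) \<partial>lborel)"
    by (simp add: smooth_avg_heat s t)
  also have "\<dots> = (\<integral>u. (\<integral>y. F (u, y) * g (x + y) \<partial>lborel) \<partial>lborel)"
  proof (rule Bochner_Integration.integral_cong[OF refl])
    fix u
    have "(\<integral>y. heat t y * g (x + u + y) \<partial>lborel) = (\<integral>y. heat t (y - u) * g (x + y) \<partial>lborel)"
      by (subst integral_lborel_affine[where c=1 and t="-u"]) (auto simp: algebra_simps)
    then show "heat s u * (\<integral>y. heat t y * g (x + u + y) \<partial>lborel) = (\<integral>y. F (u, y) * g (x + y) \<partial>lborel)"
      by (simp add: F_def mult.assoc)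
  qed
  also have "\<dots> = (\<integral>y. (\<integral>u. F (u, y) * g (x + y) \<partial>lborel) \<partial>lborel)"
    using lborel_pair.Fubini_integral[OF intFg] by simp
  also have "\<dots> = (\<integral>y. heat (s + t) y * g (x + y) \<partial>lborel)"
  proof (rule Bochner_Integration.integral_cong[OF refl])
    fix y
    have "(\<integral>u. F (u, y) * g (x + y) \<partial>lborel) = (heat (s + t) y * g (x + y)) * (\<integral>u. heat (s * t / (s + t)) (u - (s / (s + t)) *\<^sub>R y) \<partial>lborel)"
      unfolding F_def using s t by (simp add: heat_mult mult.commute mult.left_commute)
    then show "(\<integral>u. F (u, y) * g (x + y) \<partial>lborel) = heat (s + t) y * g (x + y)"
      by (simp only: integral_heat_shift[OF st(2)] mult_1_right)
  qed
  finally show ?thesis using st by (simp add: smooth_avg_heat)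
qed

text \<open>\<open>gauss1 b\<close> and \<open>gauss2 b c\<close> are Hermite polynomials of degree
  1 and 2 times the Gaussian: the derivative of \<open>heat 1\<close> in direction -b, then in
  direction -c. The sign matches the shift in \<open>smooth_avg_shift\<close>.\<close>

definition gauss1 :: "'a::euclidean_space \<Rightarrow> 'a \<Rightarrow> real" where
  "gauss1 b z = (z \<bullet> b) * heat 1 z"

definition gauss2 :: "'a::euclidean_space \<Rightarrow> 'a \<Rightarrow> 'a \<Rightarrow> real" where
  "gauss2 b c z = (z \<bullet> c) * gauss1 b z - (c \<bullet> b) * heat 1 z"

lemma gauss_dom_gauss1: "gauss_dom (gauss1 b)"
  unfolding gauss1_def by (intro gauss_dom_inner gauss_dom_gauss)

lemma gauss_dom_gauss2: "gauss_dom (gauss2 b c)"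
  unfolding gauss2_def by (intro gauss_dom_inner gauss_dom_gauss gauss_dom_gauss1 gauss_dom_diff)

lemma has_real_derivative_gauss:
  "((\<lambda>s. heat 1 (z - s *\<^sub>R c)) has_real_derivative gauss1 c z) (at 0)"
proof -
  have "(norm (z - s *\<^sub>R c))\<^sup>2 = z \<bullet> z - 2 * s * (z \<bullet> c) + s\<^sup>2 * (c \<bullet> c)" for s
    unfolding power2_norm_eq_inner by (simp add: inner_diff inner_commute power2_eq_square algebra_simps)
  then have "(\<lambda>s. heat 1 (z - s *\<^sub>R c)) = (\<lambda>s. (1 / sqrt (2 * pi)) ^ DIM('a) * exp (- (z \<bullet> z - 2 * s * (z \<bullet> c) + s\<^sup>2 * (c \<bullet> c)) / 2))"
    by (simp add: heat_def)
  moreover have "(\<dots> has_real_derivative gauss1 c z) (at 0)"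
    by (auto intro!: derivative_eq_intros simp: gauss1_def heat_def power2_norm_eq_inner)
  ultimately show ?thesis by simp
qed

lemma has_real_derivative_gauss1:
  "((\<lambda>s. gauss1 b (z - s *\<^sub>R c)) has_real_derivative gauss2 b c z) (at 0)"
  unfolding gauss1_def inner_diff_left inner_scaleR_left
  by (rule derivative_eq_intros has_real_derivative_gauss refl)+
     (simp add: gauss2_def gauss1_def algebra_simps)

text \<open>This trace is the Laplacian of \<open>heat 1\<close>; it is matched with the time
  derivative in \<open>smooth_avg_heat_equation\<close>.\<close>

lemma sum_gauss2: "(\<Sum>b\<in>Basis. gauss2 b b z) = ((norm z)\<^sup>2 - DIM('a)) * heat 1 (z::'a::euclidean_space)"
proof -
  have "(norm z)\<^sup>2 = (\<Sum>b\<in>Basis. (z \<bullet> b) * (z \<bullet> b))"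
    unfolding power2_norm_eq_inner by (subst euclidean_inner) simp
  then have "((norm z)\<^sup>2 - DIM('a)) * heat 1 z = (\<Sum>b\<in>Basis. (z \<bullet> b) * (z \<bullet> b) * heat 1 z) - DIM('a) * heat 1 z"
    by (simp add: left_diff_distrib sum_distrib_right)
  then show ?thesis by (simp add: gauss2_def gauss1_def sum_subtractf mult.assoc)
qed

section \<open>The heat equation for Gaussian averages\<close>

lemma has_real_derivative_heat_time:
  fixes z :: "'a::euclidean_space"
  assumes "0 < t"
  shows "((\<lambda>h. heat h z) has_real_derivative heat t z * ((norm z)\<^sup>2 / (2 * t\<^sup>2) - DIM('a) / (2 * t))) (at t)"
proof -
  have c: "((\<lambda>h. 1 / sqrt (2 * pi * h)) has_real_derivative - (1 / (2 * t)) * (1 / sqrt (2 * pi * t))) (at t)"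
    using assms by (auto intro!: derivative_eq_intros simp: real_sqrt_mult field_simps)
  have e: "((\<lambda>h. exp (- (norm z)\<^sup>2 / (2 * h))) has_real_derivative (norm z)\<^sup>2 / (2 * t\<^sup>2) * exp (- (norm z)\<^sup>2 / (2 * t))) (at t)"
    using assms by (auto intro!: derivative_eq_intros simp: power2_eq_square field_simps)
  have p: "c ^ DIM('a) = c * c ^ (DIM('a) - Suc 0)" for c :: real
    using DIM_positive[where 'a='a] by (metis One_nat_def power_eq_if neq0_conv)
  have alg: "n * (- (1 / (2 * T)) * c * q) * E + N * E * P = P * E * (N - n / (2 * T))" if "P = c * q" for n T c q E N P :: real
    unfolding that by (simp add: algebra_simps)
  show ?thesis
    unfolding heat_def
    by (rule DERIV_cong[OF DERIV_mult[OF DERIV_power[OF c, of "DIM('a)"] e]])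
       (rule alg[OF p])
qed

lemma sq_exp_bound:
  assumes "0 < (a::real)" shows "x\<^sup>2 * exp (- x\<^sup>2 / a) \<le> 2 * a * exp (- x\<^sup>2 / (2 * a))"
proof -
  have "x\<^sup>2 / (2 * a) \<le> exp (x\<^sup>2 / (2 * a))" using exp_ge_add_one_self[of "x\<^sup>2 / (2 * a)"] by linarith
  then have "x\<^sup>2 \<le> 2 * a * exp (x\<^sup>2 / (2 * a))" using assms by (simp add: field_simps)
  then have "x\<^sup>2 * exp (- x\<^sup>2 / a) \<le> 2 * a * exp (x\<^sup>2 / (2 * a)) * exp (- x\<^sup>2 / a)" by (rule mult_right_mono) simp
  also have "\<dots> = 2 * a * exp (- x\<^sup>2 / (2 * a))" by (simp add: mult_exp_exp)
  finally show ?thesis .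
qed

text \<open>A majorant uniform for t between h/2 and 3h/2: the prefactor is taken at h/2, the
  exponential at 3h/2, and the rate 1/(3h) is halved to 1/(6h) by \<open>sq_exp_bound\<close> to
  absorb the factor |z|^2.\<close>

lemma heat_time_derivative_bound:
  fixes z :: "'a::euclidean_space"
  assumes h: "0 < h" and t: "\<bar>t - h\<bar> < h / 2"
  shows "\<bar>heat t z * ((norm z)\<^sup>2 / (2 * t\<^sup>2) - DIM('a) / (2 * t))\<bar> \<le>
    (1 / sqrt (pi * h)) ^ DIM('a) * (12 / h * exp (- (norm z)\<^sup>2 / (6 * h)) + DIM('a) / h * exp (- (norm z)\<^sup>2 / (3 * h)))"
proof -
  have t1: "h / 2 < t" and t2: "t < 3 * h / 2" using t by linarith+
  have t0: "0 < t" using t1 h by simp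
  have "pi * h \<le> 2 * pi * t" using t1 by (simp add: field_simps)
  then have s: "1 / sqrt (2 * pi * t) \<le> 1 / sqrt (pi * h)" using h by (intro divide_left_mono) (auto simp: t0)
  have e: "exp (- (norm z)\<^sup>2 / (2 * t)) \<le> exp (- (norm z)\<^sup>2 / (3 * h))"
    using t2 t0 h by (auto intro!: divide_left_mono)
  have 1: "heat t z \<le> (1 / sqrt (pi * h)) ^ DIM('a) * exp (- (norm z)\<^sup>2 / (3 * h))"
    unfolding heat_def using s e t0 h by (intro mult_mono power_mono) auto
  have t2h: "h\<^sup>2 / 4 \<le> t\<^sup>2" using power_mono[of "h/2" t 2] t1 h by (simp add: power_divide)
  have q1: "(norm z)\<^sup>2 / (2 * t\<^sup>2) \<le> 2 / h\<^sup>2 * (norm z)\<^sup>2"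
  proof -
    have "(norm z)\<^sup>2 / (2 * t\<^sup>2) \<le> (norm z)\<^sup>2 / (2 * (h\<^sup>2 / 4))"
      using t2h h t0 by (intro divide_left_mono) auto
    then show ?thesis by simp
  qed
  have q2: "DIM('a) / (2 * t) \<le> DIM('a) / h"
    using t1 h t0 by (intro divide_left_mono) auto
  have 2: "\<bar>(norm z)\<^sup>2 / (2 * t\<^sup>2) - DIM('a) / (2 * t)\<bar> \<le> 2 / h\<^sup>2 * (norm z)\<^sup>2 + DIM('a) / h"
    using q1 q2 t0 abs_triangle_ineq4[of "(norm z)\<^sup>2 / (2 * t\<^sup>2)" "DIM('a) / (2 * t)"] by simp
  have 3: "(norm z)\<^sup>2 * exp (- (norm z)\<^sup>2 / (3 * h)) \<le> 6 * h * exp (- (norm z)\<^sup>2 / (6 * h))"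
    using sq_exp_bound[of "3 * h" "norm z"] h by simp
  have "\<bar>heat t z * ((norm z)\<^sup>2 / (2 * t\<^sup>2) - DIM('a) / (2 * t))\<bar> \<le>
      ((1 / sqrt (pi * h)) ^ DIM('a) * exp (- (norm z)\<^sup>2 / (3 * h))) * (2 / h\<^sup>2 * (norm z)\<^sup>2 + DIM('a) / h)"
    unfolding abs_mult using 1 2 heat_pos[OF t0, of z] h by (intro mult_mono) auto
  also have "\<dots> = (1 / sqrt (pi * h)) ^ DIM('a) * (2 / h\<^sup>2 * ((norm z)\<^sup>2 * exp (- (norm z)\<^sup>2 / (3 * h))) + DIM('a) / h * exp (- (norm z)\<^sup>2 / (3 * h)))"
    by (simp add: algebra_simps)
  also have "\<dots> \<le> (1 / sqrt (pi * h)) ^ DIM('a) * (2 / h\<^sup>2 * (6 * h * exp (- (norm z)\<^sup>2 / (6 * h))) + DIM('a) / h * exp (- (norm z)\<^sup>2 / (3 * h)))"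
    using 3 h by (intro mult_left_mono add_right_mono) auto
  also have "2 / h\<^sup>2 * (6 * h * exp (- (norm z)\<^sup>2 / (6 * h))) = 12 / h * exp (- (norm z)\<^sup>2 / (6 * h))"
    using h by (simp add: power2_eq_square)
  finally show ?thesis .
qed

text \<open>In \<open>smooth_avg\<close> the time h sits inside \<open>g\<close>, which need not be
  differentiable; so the derivative is taken with h in the kernel \<open>heat h\<close>, and the
  result is rescaled to unit scale. The factor 1/h is the price of two space derivatives.\<close>

lemma smooth_avg_heat_equation:
  fixes g :: "'a::euclidean_space \<Rightarrow> real"
  assumes [measurable]: "g \<in> borel_measurable borel" and g: "\<And>y. \<bar>g y\<bar> \<le> C" and h: "0 < h"
  shows "((\<lambda>h. smooth_avg (heat 1) h g x) has_real_derivative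
      (1 / (2 * h)) * (\<Sum>b\<in>Basis. smooth_avg (gauss2 b b) h g x)) (at h)"
proof -
  let ?q = "\<lambda>t z. heat t z * ((norm z)\<^sup>2 / (2 * t\<^sup>2) - DIM('a) / (2 * t))"
  let ?B = "\<lambda>z::'a. (1 / sqrt (pi * h)) ^ DIM('a) * (12 / h * exp (- (norm z)\<^sup>2 / (6 * h)) + DIM('a) / h * exp (- (norm z)\<^sup>2 / (3 * h)))"
  have D: "((\<lambda>t. \<integral>z. heat t z * g (x + z) \<partial>lborel) has_real_derivative (\<integral>z. ?q h z * g (x + z) \<partial>lborel)) (at h)"
  proof (rule integral_has_real_derivative[where d="h/2" and B="\<lambda>z. ?B z * C"])
    show "integrable lborel (\<lambda>z. heat t z * g (x + z))" if "\<bar>t - h\<bar> < h / 2" for t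
    proof -
      have "0 < t" using that h by linarith
      then show ?thesis by (intro integrable_mult_bounded[where C=C] integrable_heat) (auto simp: g)
    qed
    show "((\<lambda>t. heat t z * g (x + z)) has_real_derivative ?q t z * g (x + z)) (at t)" if "\<bar>t - h\<bar> < h / 2" for t z
    proof -
      have "0 < t" using that h by linarith
      then show ?thesis by (intro DERIV_cmult_right has_real_derivative_heat_time)
    qed
    show "\<bar>?q t z * g (x + z)\<bar> \<le> ?B z * C" if "\<bar>t - h\<bar> < h / 2" for t z
      using heat_time_derivative_bound[OF h that, of z] g[of "x + z"] unfolding abs_mult[of "?q t z"]
      by (intro mult_mono) (auto intro: order_trans[OF abs_ge_zero])
    show "integrable lborel (\<lambda>z::'a. ?B z * C)"
      by (intro integrable_mult_left integrable_mult_right integrable_exp_norm Bochner_Integration.integrable_add) (use h in auto)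
  qed (use h in auto)
  have "(\<integral>z. ?q h z * g (x + z) \<partial>lborel) = \<bar>sqrt h\<bar> ^ DIM('a) * (\<integral>z. ?q h (0 + sqrt h *\<^sub>R z) * g (x + (0 + sqrt h *\<^sub>R z)) \<partial>lborel)"
    by (rule integral_lborel_affine) (use h in auto)
  also have "\<dots> = (\<integral>z. sqrt h ^ DIM('a) * (?q h (sqrt h *\<^sub>R z) * g (x + sqrt h *\<^sub>R z)) \<partial>lborel)"
    using h by simp
  also have "\<dots> = (\<integral>z. (1 / (2 * h)) * (\<Sum>b\<in>Basis. gauss2 b b z * g (x + sqrt h *\<^sub>R z)) \<partial>lborel)"
  proof (rule Bochner_Integration.integral_cong[OF refl])
    fix z :: 'a
    have 1: "(norm (sqrt h *\<^sub>R z))\<^sup>2 / (2 * h\<^sup>2) - DIM('a) / (2 * h) = (1 / (2 * h)) * ((norm z)\<^sup>2 - DIM('a))"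
      using h by (simp add: power_mult_distrib power2_eq_square[of h] diff_divide_distrib)
    have "sqrt h ^ DIM('a) * (heat h (sqrt h *\<^sub>R z) * ((1 / (2 * h)) * ((norm z)\<^sup>2 - DIM('a))) * g (x + sqrt h *\<^sub>R z)) =
        (sqrt h ^ DIM('a) * heat h (sqrt h *\<^sub>R z)) * ((1 / (2 * h)) * ((norm z)\<^sup>2 - DIM('a)) * g (x + sqrt h *\<^sub>R z))"
      by (simp only: mult_ac)
    also have "\<dots> = (1 / (2 * h)) * ((((norm z)\<^sup>2 - DIM('a)) * heat 1 z) * g (x + sqrt h *\<^sub>R z))"
      unfolding heat_scaleR[OF h] by (simp only: mult_ac)
    also have "\<dots> = (1 / (2 * h)) * (\<Sum>b\<in>Basis. gauss2 b b z * g (x + sqrt h *\<^sub>R z))"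
      by (simp only: sum_gauss2[symmetric] sum_distrib_right)
    finally show "sqrt h ^ DIM('a) * (?q h (sqrt h *\<^sub>R z) * g (x + sqrt h *\<^sub>R z)) =
        (1 / (2 * h)) * (\<Sum>b\<in>Basis. gauss2 b b z * g (x + sqrt h *\<^sub>R z))"
      unfolding 1 .
  qed
  also have "\<dots> = (1 / (2 * h)) * (\<integral>z. (\<Sum>b\<in>Basis. gauss2 b b z * g (x + sqrt h *\<^sub>R z)) \<partial>lborel)"
    by (rule integral_mult_right_zero)
  also have "(\<integral>z. (\<Sum>b\<in>Basis. gauss2 b b z * g (x + sqrt h *\<^sub>R z)) \<partial>lborel) = (\<Sum>b\<in>Basis. smooth_avg (gauss2 b b) h g x)"
    unfolding smooth_avg_def
  proof (rule Bochner_Integration.integral_sum)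
    show "integrable lborel (\<lambda>z. gauss2 b b z * g (x + sqrt h *\<^sub>R z))" for b :: 'a
      by (rule integrable_mult_bounded[where C=C, OF gauss_dom_integrable[OF gauss_dom_gauss2] _ g]) measurable
  qed
  finally have "((\<lambda>t. \<integral>z. heat t z * g (x + z) \<partial>lborel) has_real_derivative
      (1 / (2 * h)) * (\<Sum>b\<in>Basis. smooth_avg (gauss2 b b) h g x)) (at h)" using D by simp
  moreover have "\<forall>\<^sub>F t in nhds h. smooth_avg (heat 1) t g x = (\<integral>z. heat t z * g (x + z) \<partial>lborel)"
    using eventually_nhds_in_open[of "{0<..}" h] h by (auto elim!: eventually_mono simp: smooth_avg_heat)
  ultimately show ?thesis by (subst DERIV_cong_ev[OF refl _ refl]) auto
qed

section \<open>Almost heat-invariant functions are smooth\<close>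

lemma smooth_avg_bound:
  assumes "gauss_dom k" and [measurable]: "g \<in> borel_measurable borel" and g: "\<And>y. \<bar>g y\<bar> \<le> C"
  shows "\<bar>smooth_avg k h g x\<bar> \<le> C * (\<integral>z. \<bar>k z\<bar> \<partial>lborel)"
proof -
  have k: "integrable lborel k" by (rule gauss_dom_integrable[OF assms(1)])
  then have [measurable]: "k \<in> borel_measurable borel" by auto
  have i: "integrable lborel (\<lambda>z. k z * g (x + sqrt h *\<^sub>R z))"
    by (rule integrable_mult_bounded[OF k _ g]) measurable
  have "\<bar>smooth_avg k h g x\<bar> \<le> (\<integral>z. \<bar>k z * g (x + sqrt h *\<^sub>R z)\<bar> \<partial>lborel)"
    unfolding smooth_avg_def by (rule integral_abs_bound)
  also have "\<dots> \<le> (\<integral>z. C * \<bar>k z\<bar> \<partial>lborel)"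
  proof (rule integral_mono)
    show "\<bar>k z * g (x + sqrt h *\<^sub>R z)\<bar> \<le> C * \<bar>k z\<bar>" for z
      unfolding abs_mult using mult_right_mono[OF g abs_ge_zero] by (simp add: mult.commute)
  qed (use i k in auto)
  finally show ?thesis by simp
qed

text \<open>Split at sqrt h |z| = r. Beyond that, 1 \<le> (sqrt h |z| / r)^4 = h^2 |z|^4 / r^4, so
  the global bound \<open>C\<close> enters only at order h^2, the order of the local defect to which
  this is applied.\<close>

lemma smooth_avg_local_bound:
  fixes k :: "'a::euclidean_space \<Rightarrow> real"
  assumes k: "gauss_dom k" and [measurable]: "g \<in> borel_measurable borel" and g: "\<And>y. \<bar>g y\<bar> \<le> C"
    and loc: "\<And>y. dist x y < r \<Longrightarrow> \<bar>g y\<bar> \<le> a" and r: "0 < r" and h: "0 < h" and a: "0 \<le> a"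
  shows "\<bar>smooth_avg k h g x\<bar> \<le> a * (\<integral>z. \<bar>k z\<bar> \<partial>lborel) + h\<^sup>2 * (C / r ^ 4 * (\<integral>z. norm z ^ 4 * \<bar>k z\<bar> \<partial>lborel))"
proof -
  have ki: "integrable lborel k" by (rule gauss_dom_integrable[OF k])
  then have [measurable]: "k \<in> borel_measurable borel" by auto
  have k4: "integrable lborel (\<lambda>z. norm z ^ 4 * \<bar>k z\<bar>)" by (rule gauss_dom_integrable_pow[OF k])
  have C0: "0 \<le> C" using g[of 0] by simp
  have i: "integrable lborel (\<lambda>z. k z * g (x + sqrt h *\<^sub>R z))"
    by (rule integrable_mult_bounded[OF ki _ g]) measurable
  have "\<bar>smooth_avg k h g x\<bar> \<le> (\<integral>z. \<bar>k z * g (x + sqrt h *\<^sub>R z)\<bar> \<partial>lborel)"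
    unfolding smooth_avg_def by (rule integral_abs_bound)
  also have "\<dots> \<le> (\<integral>z. a * \<bar>k z\<bar> + (h\<^sup>2 * (C / r ^ 4)) * (norm z ^ 4 * \<bar>k z\<bar>) \<partial>lborel)"
  proof (rule integral_mono)
    fix z
    show "\<bar>k z * g (x + sqrt h *\<^sub>R z)\<bar> \<le> a * \<bar>k z\<bar> + (h\<^sup>2 * (C / r ^ 4)) * (norm z ^ 4 * \<bar>k z\<bar>)"
    proof (cases "sqrt h * norm z < r")
      case True
      then have "\<bar>g (x + sqrt h *\<^sub>R z)\<bar> \<le> a" using h by (intro loc) (simp add: dist_norm)
      then have "\<bar>k z\<bar> * \<bar>g (x + sqrt h *\<^sub>R z)\<bar> \<le> \<bar>k z\<bar> * a" by (rule mult_left_mono) simp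
      moreover have "0 \<le> (h\<^sup>2 * (C / r ^ 4)) * (norm z ^ 4 * \<bar>k z\<bar>)" using C0 r by simp
      ultimately show ?thesis by (simp add: abs_mult mult.commute)
    next
      case False
      then have "r ^ 4 \<le> (sqrt h * norm z) ^ 4" using r by (intro power_mono) auto
      also have "\<dots> = h\<^sup>2 * norm z ^ 4" using h by (simp add: power_mult_distrib power4_eq_xxxx power2_eq_square mult.assoc[symmetric])
      finally have "1 \<le> h\<^sup>2 * norm z ^ 4 / r ^ 4" using r by simp
      then have "C * 1 \<le> C * (h\<^sup>2 * norm z ^ 4 / r ^ 4)" using C0 by (rule mult_left_mono)
      then have "\<bar>g (x + sqrt h *\<^sub>R z)\<bar> \<le> C * (h\<^sup>2 * norm z ^ 4 / r ^ 4)" using g[of "x + sqrt h *\<^sub>R z"] by linarith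
      then have "\<bar>k z\<bar> * \<bar>g (x + sqrt h *\<^sub>R z)\<bar> \<le> \<bar>k z\<bar> * (C * (h\<^sup>2 * norm z ^ 4 / r ^ 4))" by (rule mult_left_mono) simp
      moreover have "0 \<le> a * \<bar>k z\<bar>" using a by simp
      ultimately show ?thesis by (simp add: abs_mult mult_ac)
    qed
  qed (use i ki k4 in auto)
  also have "\<dots> = a * (\<integral>z. \<bar>k z\<bar> \<partial>lborel) + h\<^sup>2 * (C / r ^ 4 * (\<integral>z. norm z ^ 4 * \<bar>k z\<bar> \<partial>lborel))"
    using ki k4 by (subst Bochner_Integration.integral_add) (auto simp: mult.assoc)
  finally show ?thesis .
qed

lemma geometric_increments:
  fixes a :: "nat \<Rightarrow> real"
  assumes inc: "\<And>n. \<bar>a (Suc n) - a n\<bar> \<le> K * (1/2) ^ n"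
  shows "convergent a" and "\<bar>a n - lim a\<bar> \<le> 2 * K * (1/2) ^ n"
proof -
  have K0: "0 \<le> K" using inc[of 0] by (simp add: order_trans[OF abs_ge_zero])
  \<comment> \<open>2 - 2 (1/2)^m is the exact sum of the first m geometric weights; with this sharp
    form the induction closes.\<close>
  have tele: "\<bar>a (n + m) - a n\<bar> \<le> K * (1/2) ^ n * (2 - 2 * (1/2) ^ m)" for n m
  proof (induction m)
    case (Suc m)
    have "\<bar>a (n + Suc m) - a n\<bar> \<le> \<bar>a (Suc (n + m)) - a (n + m)\<bar> + \<bar>a (n + m) - a n\<bar>" by simp
    also have "\<dots> \<le> K * (1/2) ^ (n + m) + K * (1/2) ^ n * (2 - 2 * (1/2) ^ m)"
      using inc[of "n + m"] Suc.IH by (rule add_mono)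
    also have "\<dots> = K * (1/2) ^ n * (2 - 2 * (1/2) ^ Suc m)" by (simp add: power_add algebra_simps)
    finally show ?case .
  qed simp
  have tele': "\<bar>a (n + m) - a n\<bar> \<le> 2 * K * (1/2) ^ n" for n m
  proof -
    have "K * (1/2) ^ n * (2 - 2 * (1/2) ^ m) \<le> K * (1/2) ^ n * 2" using K0 by (intro mult_left_mono) auto
    then show ?thesis using tele[of n m] by (simp add: mult_ac)
  qed
  have lim0: "(\<lambda>n. 2 * K * (1/2) ^ n) \<longlonglongrightarrow> 0"
    by (rule tendsto_mult_right_zero, rule LIMSEQ_realpow_zero) auto
  have "Cauchy a"
  proof (rule CauchyI')
    fix e :: real assume "e > 0"
    then obtain N where N: "2 * K * (1/2) ^ N < e" "\<And>n. n \<ge> N \<Longrightarrow> 2 * K * (1/2) ^ n < e"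
      using order_tendstoD(2)[OF lim0, of e] by (auto simp: eventually_sequentially)
    have "dist (a m) (a n) < e" if "m \<ge> N" "n > m" for m n
      using tele'[of m "n - m"] N(2)[OF that(1)] that by (simp add: dist_real_def abs_minus_commute)
    then show "\<exists>M. \<forall>m\<ge>M. \<forall>n>m. dist (a m) (a n) < e" by blast
  qed
  then show c: "convergent a" by (simp add: Cauchy_convergent_iff)
  have "(\<lambda>m. \<bar>a (n + m) - a n\<bar>) \<longlonglongrightarrow> \<bar>lim a - a n\<bar>"
    using LIMSEQ_ignore_initial_segment[OF c[unfolded convergent_LIMSEQ_iff], of n]
    by (intro tendsto_intros) (simp add: add.commute)
  then have "\<bar>lim a - a n\<bar> \<le> 2 * K * (1/2) ^ n"
    by (rule LIMSEQ_le_const2) (use tele' in auto)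
  then show "\<bar>a n - lim a\<bar> \<le> 2 * K * (1/2) ^ n" by (simp add: abs_minus_commute)
qed

lemma dyadic_scale:
  assumes "0 < (x::real)" "x \<le> 1"
  obtains n where "(1/2) ^ n \<le> x" "x \<le> 2 * (1/2) ^ n"
proof -
  obtain m where "(1/2) ^ m < x" using real_arch_pow_inv[OF assms(1), of "1/2"] by auto
  then have ex: "\<exists>m. (1/2) ^ m \<le> x" by (auto intro: less_imp_le)
  define n where "n = (LEAST m. (1/2) ^ m \<le> x)"
  have n: "(1/2) ^ n \<le> x" unfolding n_def using ex by (rule LeastI_ex)
  moreover have "x \<le> 2 * (1/2) ^ n"
  proof (cases n)
    case (Suc m)
    then have "\<not> (1/2) ^ m \<le> x" using not_less_Least[of m "\<lambda>m. (1/2) ^ m \<le> x"] by (simp add: n_def)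
    then show ?thesis using Suc by simp
  qed (use assms in simp)
  ultimately show ?thesis using that by blast
qed

text \<open>Isolates the analytic part: \<open>approx\<close> alone must produce derivatives of a
  function assumed only bounded and measurable. The estimate is uniform on a ball because averaging
  the defect over time t also sees the neighbours of x; radius and constant may degenerate towards
  the boundary of \<open>U\<close>.\<close>

locale almost_heat_invariant =
  fixes v :: "'a::euclidean_space \<Rightarrow> real" and C lam :: real and U :: "'a set"
  assumes v_meas [measurable]: "v \<in> borel_measurable borel"
    and v_bound: "\<And>y. \<bar>v y\<bar> \<le> C"
    and lam: "0 \<le> lam"
    and U: "open U"
    and approx: "\<And>x0. x0 \<in> U \<Longrightarrow> \<exists>r>0. \<exists>K. \<forall>x\<in>ball x0 r. \<forall>h. 0 < h \<and> h \<le> 1 \<longrightarrow>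
        \<bar>exp (- lam * h) * smooth_avg (heat 1) h v x - v x\<bar> \<le> K * h\<^sup>2"
begin

definition avg :: "('a \<Rightarrow> real) \<Rightarrow> nat \<Rightarrow> real \<Rightarrow> 'a \<Rightarrow> real" where
  "avg k e h x = exp (- lam * h) * (1 / sqrt h) ^ e * smooth_avg k h v x"

text \<open>The limit is shown to exist only at points of \<open>U\<close>, for admissible
  \<open>k\<close> and \<open>e \<le> 2\<close>; elsewhere the value of \<open>lim\<close> may be
  meaningless. Powers of 1/2 fit the comparison of t with 2 t.\<close>

definition lim_avg :: "('a \<Rightarrow> real) \<Rightarrow> nat \<Rightarrow> 'a \<Rightarrow> real" where
  "lim_avg k e x = lim (\<lambda>n. avg k e ((1/2) ^ n) x)"

lemma approxE:
  assumes "x0 \<in> U"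
  obtains r K where "0 < r"
    "\<And>x h. x \<in> ball x0 r \<Longrightarrow> 0 < h \<Longrightarrow> h \<le> 1 \<Longrightarrow> \<bar>avg (heat 1) 0 h x - v x\<bar> \<le> K * h\<^sup>2"
proof -
  have "avg (heat 1) 0 h x = exp (- lam * h) * smooth_avg (heat 1) h v x" for h x by (simp add: avg_def)
  then show ?thesis using approx[OF assms] that by metis
qed

lemma C_nonneg: "0 \<le> C" using v_bound[of 0] by simp

lemma continuous_avg: "gauss_dom k \<Longrightarrow> 0 < h \<Longrightarrow> continuous_on S (avg k e h)"
  unfolding avg_def by (intro continuous_intros continuous_smooth_avg[where C=C]) (auto simp: v_bound)

lemma avg0_measurable [measurable]: "0 < h \<Longrightarrow> avg (heat 1) 0 h \<in> borel_measurable borel"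
  by (intro borel_measurable_continuous_onI continuous_avg gauss_dom_gauss)

lemma avg0_bound: assumes "0 < h" shows "\<bar>avg (heat 1) 0 h x\<bar> \<le> C"
proof -
  have "\<bar>smooth_avg (heat 1) h v x\<bar> \<le> C * (\<integral>z. \<bar>heat 1 z\<bar> \<partial>(lborel::'a measure))"
    by (rule smooth_avg_bound[OF gauss_dom_gauss v_meas v_bound])
  also have "(\<integral>z. \<bar>heat 1 z\<bar> \<partial>(lborel::'a measure)) = 1"
    using integral_heat[of 1, where 'a='a] by (simp add: heat_pos less_imp_le)
  finally have 1: "\<bar>smooth_avg (heat 1) h v x\<bar> \<le> C" by simp
  have "exp (- lam * h) \<le> 1" using lam assms by simp
  then have "exp (- lam * h) * \<bar>smooth_avg (heat 1) h v x\<bar> \<le> 1 * C" using 1 by (intro mult_mono) auto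
  then show ?thesis by (simp add: avg_def abs_mult)
qed

definition defect :: "real \<Rightarrow> 'a \<Rightarrow> real" where "defect s y = avg (heat 1) 0 s y - v y"

lemma defect_measurable [measurable]: "0 < s \<Longrightarrow> defect s \<in> borel_measurable borel"
  unfolding defect_def by measurable

lemma defect_bound: "0 < s \<Longrightarrow> \<bar>defect s y\<bar> \<le> 2 * C"
  using avg0_bound[of s y] v_bound[of y] by (simp add: defect_def abs_le_iff)

text \<open>
  The exponent \<open>e\<close> of \<open>avg k e\<close> counts derivatives: differentiating under the average replaces \<open>k\<close> by
  its derivative and costs a factor \<open>1 / sqrt h\<close>. Admissibility is the semigroup property
  differentiated \<open>e\<close> times; since the defect is locally \<open>O(s\<^sup>2)\<close>, derivatives of order at most two
  of \<open>avg\<close> change only by \<open>O(t)\<close> between \<open>t\<close> and \<open>2 t\<close> and hence converge as \<open>t\<close> tends to \<open>0\<close>.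
\<close>

definition admissible :: "('a \<Rightarrow> real) \<Rightarrow> nat \<Rightarrow> bool" where
  "admissible k e \<longleftrightarrow> gauss_dom k \<and> (\<forall>s t x. 0 < s \<longrightarrow> 0 < t \<longrightarrow>
     avg k e (t + s) x - avg k e t x = exp (- lam * t) * (1 / sqrt t) ^ e * smooth_avg k t (defect s) x)"

text \<open>Averages the defect at time s over a further time t: the semigroup property combines
  with exp (- lam (t + s)) = exp (- lam t) exp (- lam s).\<close>

lemma admissible_heat: "admissible (heat 1) 0"
  unfolding admissible_def
proof (intro conjI allI impI gauss_dom_gauss)
  fix s t :: real and x :: 'a assume s: "0 < s" and t: "0 < t"
  have h: "integrable lborel (heat 1 :: 'a \<Rightarrow> real)" by (simp add: integrable_heat)
  have m [measurable]: "smooth_avg (heat 1) s v \<in> borel_measurable borel"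
    by (rule borel_measurable_continuous_onI, rule continuous_smooth_avg[OF gauss_dom_gauss v_meas v_bound s])
  have b: "\<bar>smooth_avg (heat 1) s v y\<bar> \<le> C * (\<integral>z. \<bar>heat 1 z\<bar> \<partial>(lborel::'a measure))" for y
    by (rule smooth_avg_bound[OF gauss_dom_gauss v_meas v_bound])
  have i1: "integrable lborel (\<lambda>z. heat 1 z * smooth_avg (heat 1) s v (x + sqrt t *\<^sub>R z))"
    by (rule integrable_mult_bounded[OF h _ b]) measurable
  have i2: "integrable lborel (\<lambda>z. heat 1 z * v (x + sqrt t *\<^sub>R z))"
    by (rule integrable_mult_bounded[OF h _ v_bound]) measurable
  have "smooth_avg (heat 1) t (defect s) x =
      (\<integral>z. exp (- lam * s) * (heat 1 z * smooth_avg (heat 1) s v (x + sqrt t *\<^sub>R z)) - heat 1 z * v (x + sqrt t *\<^sub>R z) \<partial>lborel)"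
    unfolding smooth_avg_def[of _ t] defect_def avg_def by (simp add: algebra_simps)
  also have "\<dots> = exp (- lam * s) * smooth_avg (heat 1) t (smooth_avg (heat 1) s v) x - smooth_avg (heat 1) t v x"
    using i1 i2 by (subst Bochner_Integration.integral_diff) (auto simp: smooth_avg_def[of _ t])
  also have "smooth_avg (heat 1) t (smooth_avg (heat 1) s v) x = smooth_avg (heat 1) (t + s) v x"
    by (rule smooth_avg_semigroup[OF v_meas v_bound t s, symmetric])
  finally have 1: "smooth_avg (heat 1) t (defect s) x = exp (- lam * s) * smooth_avg (heat 1) (t + s) v x - smooth_avg (heat 1) t v x" .
  have 2: "exp (- lam * (t + s)) = exp (- lam * t) * exp (- lam * s)"
    by (simp add: exp_add[symmetric] algebra_simps)
  show "avg (heat 1) 0 (t + s) x - avg (heat 1) 0 t x =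
      exp (- lam * t) * (1 / sqrt t) ^ 0 * smooth_avg (heat 1) t (defect s) x"
    unfolding avg_def 1 2 by (simp add: right_diff_distrib)
qed

lemma has_real_derivative_avg:
  assumes "gauss_dom k" "gauss_dom k'" "\<And>z. ((\<lambda>s. k (z - s *\<^sub>R b)) has_real_derivative k' z) (at 0)"
    and "norm b = 1" "0 < h"
  shows "((\<lambda>t. avg k e h (x + t *\<^sub>R b)) has_real_derivative avg k' (Suc e) h x) (at 0)"
  unfolding avg_def
  by (rule DERIV_cong[OF DERIV_cmult[OF has_real_derivative_smooth_avg[OF assms(1-3) v_meas v_bound assms(5,4)]]]) simp

text \<open>Differentiate both sides of the identity for \<open>k\<close> along b. The defect stands
  under an average, so its own lack of smoothness does no harm.\<close>

lemma admissible_step: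
  assumes k: "admissible k e" and k': "gauss_dom k'"
    and der: "\<And>z. ((\<lambda>s. k (z - s *\<^sub>R b)) has_real_derivative k' z) (at 0)" and b: "norm b = 1"
  shows "admissible k' (Suc e)"
  unfolding admissible_def
proof (intro conjI allI impI k')
  fix s t :: real and x :: 'a assume s: "0 < s" and t: "0 < t"
  have kd: "gauss_dom k" using k by (simp add: admissible_def)
  let ?c = "exp (- lam * t) * (1 / sqrt t) ^ e"
  have 1: "((\<lambda>u. avg k e (t + s) (x + u *\<^sub>R b) - avg k e t (x + u *\<^sub>R b)) has_real_derivative
      avg k' (Suc e) (t + s) x - avg k' (Suc e) t x) (at 0)"
    using s t by (intro DERIV_diff has_real_derivative_avg kd k' der b) auto
  have 2: "((\<lambda>u. ?c * smooth_avg k t (defect s) (x + u *\<^sub>R b)) has_real_derivative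
      ?c * (1 / sqrt t * smooth_avg k' t (defect s) x)) (at 0)"
    by (intro DERIV_cmult has_real_derivative_smooth_avg[OF kd k' der _ defect_bound[OF s] t b]) (use s in measurable)
  have 3: "(\<lambda>u. avg k e (t + s) (x + u *\<^sub>R b) - avg k e t (x + u *\<^sub>R b)) = (\<lambda>u. ?c * smooth_avg k t (defect s) (x + u *\<^sub>R b))"
    using k s t unfolding admissible_def by blast
  show "avg k' (Suc e) (t + s) x - avg k' (Suc e) t x = exp (- lam * t) * (1 / sqrt t) ^ Suc e * smooth_avg k' t (defect s) x"
    using DERIV_unique[OF 1[unfolded 3] 2] by simp
qed

lemma admissible_gauss1: "b \<in> Basis \<Longrightarrow> admissible (gauss1 b) 1"
  using admissible_step[OF admissible_heat gauss_dom_gauss1 has_real_derivative_gauss] by simp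

lemma admissible_gauss2: "b \<in> Basis \<Longrightarrow> c \<in> Basis \<Longrightarrow> admissible (gauss2 b c) 2"
  using admissible_step[OF admissible_gauss1 gauss_dom_gauss2 has_real_derivative_gauss1] by (simp add: numeral_2_eq_2)

lemma lim_avg_approx:
  assumes k: "admissible k e" and e: "e \<le> 2" and x0: "x0 \<in> U"
  shows "\<exists>r>0. \<exists>K. \<forall>x\<in>ball x0 r. (\<forall>t. 0 < t \<longrightarrow> t \<le> 1 \<longrightarrow> \<bar>avg k e t x - lim_avg k e x\<bar> \<le> K * t) \<and>
    (\<lambda>n. avg k e ((1/2) ^ n) x) \<longlonglongrightarrow> lim_avg k e x"
proof -
  have kd: "gauss_dom k" using k by (simp add: admissible_def)
  obtain r K where r: "0 < r" and K: "\<And>x h. x \<in> ball x0 r \<Longrightarrow> 0 < h \<Longrightarrow> h \<le> 1 \<Longrightarrow> \<bar>defect h x\<bar> \<le> K * h\<^sup>2"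
    using approxE[OF x0] unfolding defect_def by blast
  have K0: "0 \<le> K" using K[of x0 1] r by (simp add: order_trans[OF abs_ge_zero])
  \<comment> \<open>The constant of \<open>smooth_avg_local_bound\<close> for the local bound K t^2
    and the global bound 2 C on the defect; radius r/2 keeps the ball around x inside
    \<open>ball x0 r\<close>.\<close>
  define M where "M = K * (\<integral>z. \<bar>k z\<bar> \<partial>lborel) + 2 * C / (r/2) ^ 4 * (\<integral>z. norm z ^ 4 * \<bar>k z\<bar> \<partial>lborel)"
  have M0: "0 \<le> M" unfolding M_def using K0 C_nonneg r by (intro add_nonneg_nonneg mult_nonneg_nonneg integral_nonneg) auto
  have inc: "\<bar>avg k e (t + s) x - avg k e t x\<bar> \<le> M * t" if x: "x \<in> ball x0 (r/2)" and s: "0 < s" and st: "s \<le> t" and t: "t \<le> 1" for x s t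
  proof -
    have t0: "0 < t" using s st by simp
    have "\<bar>smooth_avg k t (defect s) x\<bar> \<le> (K * t\<^sup>2) * (\<integral>z. \<bar>k z\<bar> \<partial>lborel) + t\<^sup>2 * (2 * C / (r/2) ^ 4 * (\<integral>z. norm z ^ 4 * \<bar>k z\<bar> \<partial>lborel))"
    proof (rule smooth_avg_local_bound[OF kd _ defect_bound[OF s]])
      fix y assume y: "dist x y < r / 2"
      then have "y \<in> ball x0 r" using x dist_triangle[of x0 y x] by simp
      then have "\<bar>defect s y\<bar> \<le> K * s\<^sup>2" using s st t by (intro K) auto
      also have "\<dots> \<le> K * t\<^sup>2" using K0 s st by (intro mult_left_mono power_mono) auto
      finally show "\<bar>defect s y\<bar> \<le> K * t\<^sup>2" .
    qed (use r t0 s K0 in auto)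
    also have "\<dots> = t\<^sup>2 * M" by (simp add: M_def algebra_simps)
    finally have 1: "\<bar>smooth_avg k t (defect s) x\<bar> \<le> t\<^sup>2 * M" .
    \<comment> \<open>Here \<open>e \<le> 2\<close> enters: the derivatives cost at most 1/t, and
      the t^2 of the defect pays for this with a factor t to spare.\<close>
    have "(1 / sqrt t) ^ e \<le> (1 / sqrt t) ^ 2" using e t t0 by (intro power_increasing) auto
    also have "\<dots> = 1 / t" using t0 by (simp add: power_divide)
    finally have 2: "(1 / sqrt t) ^ e \<le> 1 / t" .
    have 3: "exp (- lam * t) \<le> 1" using lam t0 by simp
    have "exp (- lam * t) * (1 / sqrt t) ^ e \<le> 1 * (1 / t)"
      using 2 3 t0 by (intro mult_mono) auto
    then have "(exp (- lam * t) * (1 / sqrt t) ^ e) * \<bar>smooth_avg k t (defect s) x\<bar> \<le> (1 * (1 / t)) * (t\<^sup>2 * M)"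
      using 1 t0 by (rule_tac mult_mono) auto
    also have "\<dots> = M * t" using t0 by (simp add: power2_eq_square)
    finally show ?thesis using k s t0 by (simp add: admissible_def abs_mult)
  qed
  have dy: "\<bar>avg k e ((1/2) ^ Suc n) x - avg k e ((1/2) ^ n) x\<bar> \<le> (M / 2) * (1/2) ^ n" if x: "x \<in> ball x0 (r/2)" for n x
  proof -
    have "(1/2::real) ^ n \<le> 1" by (rule power_le_one) auto
    then show ?thesis using inc[OF x, of "(1/2) ^ Suc n" "(1/2) ^ Suc n"] by (simp add: abs_minus_commute)
  qed
  have T: "(\<lambda>n. avg k e ((1/2) ^ n) x) \<longlonglongrightarrow> lim_avg k e x" if "x \<in> ball x0 (r/2)" for x
    unfolding lim_avg_def using geometric_increments(1)[OF dy[OF that]] by (simp add: convergent_LIMSEQ_iff)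
  have B: "\<bar>avg k e t x - lim_avg k e x\<bar> \<le> (2 * M) * t" if x: "x \<in> ball x0 (r/2)" and t: "0 < t" "t \<le> 1" for x t
    proof -
      \<comment> \<open>A general t exceeds some 2^-n by at most a factor 2, so one increment of
        length t - 2^-n \<le> 2^-n links it to the dyadic scale.\<close>
      obtain n where n: "(1/2) ^ n \<le> t" "t \<le> 2 * (1/2) ^ n" using dyadic_scale[OF t] by blast
      have "\<bar>avg k e ((1/2) ^ n) x - lim_avg k e x\<bar> \<le> 2 * (M / 2) * (1/2) ^ n"
        unfolding lim_avg_def by (rule geometric_increments(2)[OF dy[OF x]])
      moreover have "\<bar>avg k e t x - avg k e ((1/2) ^ n) x\<bar> \<le> M * (1/2) ^ n"
      proof (cases "t = (1/2) ^ n")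
        case False
        then show ?thesis using inc[OF x, of "t - (1/2) ^ n" "(1/2) ^ n"] n t by (simp add: power_le_one)
      qed (use M0 in simp)
      moreover have "M * (1/2) ^ n \<le> M * t" using n M0 by (intro mult_left_mono) auto
      ultimately show ?thesis by simp
    qed
  have "0 < r / 2" using r by simp
  with B T show ?thesis by blast
qed

lemma lim_avg_heat: assumes "x \<in> U" shows "lim_avg (heat 1) 0 x = v x"
proof -
  obtain r K where r: "0 < r" and K: "\<And>y h. y \<in> ball x r \<Longrightarrow> 0 < h \<Longrightarrow> h \<le> 1 \<Longrightarrow> \<bar>avg (heat 1) 0 h y - v y\<bar> \<le> K * h\<^sup>2"
    using approxE[OF assms] by blast
  have "(\<lambda>n. avg (heat 1) 0 ((1/2) ^ n) x - v x) \<longlonglongrightarrow> 0"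
  proof (rule Lim_null_comparison)
    show "\<forall>\<^sub>F n in sequentially. norm (avg (heat 1) 0 ((1/2) ^ n) x - v x) \<le> K * ((1/2) ^ n)\<^sup>2"
      using K[of x] r by (intro always_eventually) (auto simp: power_le_one)
    have "(\<lambda>n. (1/2::real) ^ n) \<longlonglongrightarrow> 0" by (rule LIMSEQ_realpow_zero) auto
    then show "(\<lambda>n. K * ((1/2) ^ n)\<^sup>2) \<longlonglongrightarrow> 0" by (auto intro!: tendsto_eq_intros)
  qed
  then have "(\<lambda>n. avg (heat 1) 0 ((1/2) ^ n) x) \<longlonglongrightarrow> v x" by (simp add: LIM_zero_iff)
  then show ?thesis unfolding lim_avg_def by (rule limI)
qed

section \<open>Back from the averages to \<open>v\<close>: two continuous derivatives and the
  equation\<close>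

lemma continuous_lim_avg:
  assumes k: "admissible k e" and e: "e \<le> 2" shows "continuous_on U (lim_avg k e)"
proof (rule continuous_at_imp_continuous_on, rule ballI)
  fix x0 assume x0: "x0 \<in> U"
  obtain r K where r: "0 < r" and K: "\<And>x t. x \<in> ball x0 r \<Longrightarrow> 0 < t \<Longrightarrow> t \<le> 1 \<Longrightarrow> \<bar>avg k e t x - lim_avg k e x\<bar> \<le> K * t"
    using lim_avg_approx[OF k e x0] by metis
  have "continuous_on (ball x0 r) (lim_avg k e)"
  proof (rule uniform_limit_theorem[where F=sequentially and f="\<lambda>n. avg k e ((1/2) ^ n)"])
    show "\<forall>\<^sub>F n in sequentially. continuous_on (ball x0 r) (avg k e ((1/2) ^ n))"
      using k by (intro always_eventually allI continuous_avg) (auto simp: admissible_def)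
    show "uniform_limit (ball x0 r) (\<lambda>n. avg k e ((1/2) ^ n)) (lim_avg k e) sequentially"
    proof (rule uniform_limitI)
      fix \<epsilon> :: real assume \<epsilon>: "0 < \<epsilon>"
      have "(\<lambda>n. (1/2::real) ^ n) \<longlonglongrightarrow> 0" by (rule LIMSEQ_realpow_zero) auto
      then have "(\<lambda>n. K * (1/2) ^ n) \<longlonglongrightarrow> 0" by (auto intro!: tendsto_eq_intros)
      then have "\<forall>\<^sub>F n in sequentially. K * (1/2) ^ n < \<epsilon>" using \<epsilon> by (rule order_tendstoD)
      then show "\<forall>\<^sub>F n in sequentially. \<forall>x\<in>ball x0 r. dist (avg k e ((1/2) ^ n) x) (lim_avg k e x) < \<epsilon>"
      proof eventually_elim
        case (elim n)
        show ?case
        proof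
          fix x assume x: "x \<in> ball x0 r"
          have "\<bar>avg k e ((1/2) ^ n) x - lim_avg k e x\<bar> \<le> K * (1/2) ^ n" by (rule K[OF x]) (auto simp: power_le_one)
          with elim show "dist (avg k e ((1/2) ^ n) x) (lim_avg k e x) < \<epsilon>" by (simp add: dist_real_def)
        qed
      qed
    qed
  qed simp
  then show "isCont (lim_avg k e) x0" using r by (simp add: continuous_on_eq_continuous_at)
qed

text \<open>Termwise differentiation: on a segment through \<open>x0\<close> the averages converge
  pointwise and, by \<open>lim_avg_approx\<close> for \<open>k'\<close>, their derivatives converge
  uniformly at rate K 2^-n.\<close>

lemma has_real_derivative_lim_avg:
  assumes k: "admissible k e" and k': "admissible k' (Suc e)" and e: "Suc e \<le> 2"
    and der: "\<And>z. ((\<lambda>s. k (z - s *\<^sub>R b)) has_real_derivative k' z) (at 0)" and b: "norm b = 1" and x0: "x0 \<in> U"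
  shows "((\<lambda>t. lim_avg k e (x0 + t *\<^sub>R b)) has_real_derivative lim_avg k' (Suc e) x0) (at 0)"
proof -
  have e': "e \<le> 2" using e by simp
  obtain r1 where r1: "0 < r1" and c1: "\<And>x. x \<in> ball x0 r1 \<Longrightarrow> (\<lambda>n. avg k e ((1/2) ^ n) x) \<longlonglongrightarrow> lim_avg k e x"
    using lim_avg_approx[OF k e' x0] by metis
  obtain r2 K where r2: "0 < r2" and K: "\<And>x t. x \<in> ball x0 r2 \<Longrightarrow> 0 < t \<Longrightarrow> t \<le> 1 \<Longrightarrow> \<bar>avg k' (Suc e) t x - lim_avg k' (Suc e) x\<bar> \<le> K * t"
    using lim_avg_approx[OF k' e x0] by metis
  define S where "S = ball (0::real) (min r1 r2)"
  have S: "x0 + t *\<^sub>R b \<in> ball x0 r1" "x0 + t *\<^sub>R b \<in> ball x0 r2" if "t \<in> S" for t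
    using that b by (auto simp: S_def dist_norm)
  have D: "((\<lambda>t. avg k e h (x0 + t *\<^sub>R b)) has_real_derivative avg k' (Suc e) h (x0 + t *\<^sub>R b)) (at t)" if "0 < h" for h t
    using has_real_derivative_avg[OF _ _ der b that, of e "x0 + t *\<^sub>R b"] k k' unfolding admissible_def DERIV_def
    by (simp add: algebra_simps)
  have "\<exists>g. \<forall>t\<in>S. (\<lambda>n. avg k e ((1/2) ^ n) (x0 + t *\<^sub>R b)) \<longlonglongrightarrow> g t \<and>
      (g has_derivative (\<lambda>h. lim_avg k' (Suc e) (x0 + t *\<^sub>R b) * h)) (at t within S)"
  proof (rule has_derivative_sequence[where f'="\<lambda>n t h. avg k' (Suc e) ((1/2) ^ n) (x0 + t *\<^sub>R b) * h" and ?x0.0=0])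
    show "convex S" by (simp add: S_def)
    show "((\<lambda>t. avg k e ((1/2) ^ n) (x0 + t *\<^sub>R b)) has_derivative (*) (avg k' (Suc e) ((1/2) ^ n) (x0 + t *\<^sub>R b))) (at t within S)" for n t
      using has_field_derivative_at_within[OF D[of "(1/2) ^ n" t]] by (simp add: has_field_derivative_def)
    show "0 \<in> S" using r1 r2 by (simp add: S_def)
    then show "(\<lambda>n. avg k e ((1/2) ^ n) (x0 + 0 *\<^sub>R b)) \<longlonglongrightarrow> lim_avg k e (x0 + 0 *\<^sub>R b)" by (intro c1 S)
    fix \<epsilon> :: real assume \<epsilon>: "0 < \<epsilon>"
    have "(\<lambda>n. (1/2::real) ^ n) \<longlonglongrightarrow> 0" by (rule LIMSEQ_realpow_zero) auto
    then have "(\<lambda>n. K * (1/2) ^ n) \<longlonglongrightarrow> 0" by (auto intro!: tendsto_eq_intros)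
    then have "\<forall>\<^sub>F n in sequentially. K * (1/2) ^ n < \<epsilon>" using \<epsilon> by (rule order_tendstoD)
    then show "\<forall>\<^sub>F n in sequentially. \<forall>t\<in>S. \<forall>h. norm (avg k' (Suc e) ((1/2) ^ n) (x0 + t *\<^sub>R b) * h - lim_avg k' (Suc e) (x0 + t *\<^sub>R b) * h) \<le> \<epsilon> * norm h"
    proof eventually_elim
      case (elim n)
      show ?case
      proof (intro ballI allI)
        fix t h assume t: "t \<in> S"
        have "\<bar>avg k' (Suc e) ((1/2) ^ n) (x0 + t *\<^sub>R b) - lim_avg k' (Suc e) (x0 + t *\<^sub>R b)\<bar> \<le> \<epsilon>"
          using K[OF S(2)[OF t], of "(1/2) ^ n"] elim by (simp add: power_le_one)
        then show "norm (avg k' (Suc e) ((1/2) ^ n) (x0 + t *\<^sub>R b) * h - lim_avg k' (Suc e) (x0 + t *\<^sub>R b) * h) \<le> \<epsilon> * norm h"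
          by (simp add: left_diff_distrib[symmetric] abs_mult mult_right_mono)
      qed
    qed
  qed
  then obtain g where g: "\<And>t. t \<in> S \<Longrightarrow> (\<lambda>n. avg k e ((1/2) ^ n) (x0 + t *\<^sub>R b)) \<longlonglongrightarrow> g t"
    "\<And>t. t \<in> S \<Longrightarrow> (g has_derivative (\<lambda>h. lim_avg k' (Suc e) (x0 + t *\<^sub>R b) * h)) (at t within S)" by blast
  have S0: "0 \<in> S" "open S" using r1 r2 by (auto simp: S_def)
  have "(g has_real_derivative lim_avg k' (Suc e) x0) (at 0)"
    using g(2)[OF S0(1)] unfolding at_within_open[OF S0] by (simp add: has_field_derivative_def)
  moreover have "g t = lim_avg k e (x0 + t *\<^sub>R b)" if "t \<in> S" for t
    using LIMSEQ_unique[OF g(1)[OF that] c1[OF S(1)[OF that]]] .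
  ultimately show ?thesis
    using has_field_derivative_transform_within_open[of g _ 0 S] S0 by auto
qed

lemma has_partial_lim_avg:
  assumes k: "admissible k e" and k': "admissible k' (Suc e)" and e: "Suc e \<le> 2"
    and der: "\<And>z. ((\<lambda>s. k (z - s *\<^sub>R b)) has_real_derivative k' z) (at 0)" and b: "b \<in> Basis" and x0: "x0 \<in> U"
    and u: "\<And>x. x \<in> U \<Longrightarrow> u x = lim_avg k e x"
  shows "(\<lambda>t. u (x0 + t *\<^sub>R b)) differentiable (at 0)" "partial b u x0 = lim_avg k' (Suc e) x0"
proof -
  have S: "open ((\<lambda>t. x0 + t *\<^sub>R b) -` U)" using U by (intro open_vimage continuous_intros)
  have "((\<lambda>t. u (x0 + t *\<^sub>R b)) has_real_derivative lim_avg k' (Suc e) x0) (at 0)"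
    by (rule has_field_derivative_transform_within_open[OF has_real_derivative_lim_avg[OF k k' e der _ x0] S]) (use x0 b u in auto)
  then show "(\<lambda>t. u (x0 + t *\<^sub>R b)) differentiable (at 0)" "partial b u x0 = lim_avg k' (Suc e) x0"
    by (auto simp: partial_def real_differentiable_def intro: DERIV_imp_deriv)
qed

lemma partial_v:
  assumes "b \<in> Basis" "x \<in> U"
  shows "(\<lambda>t. v (x + t *\<^sub>R b)) differentiable (at 0)" "partial b v x = lim_avg (gauss1 b) 1 x"
  using has_partial_lim_avg[OF admissible_heat _ _ has_real_derivative_gauss assms, of v] admissible_gauss1[OF assms(1)]
  by (auto simp: lim_avg_heat)

lemma partial_partial_v:
  assumes "b \<in> Basis" "c \<in> Basis" "x \<in> U"
  shows "(\<lambda>t. partial b v (x + t *\<^sub>R c)) differentiable (at 0)" "partial c (partial b v) x = lim_avg (gauss2 b c) 2 x"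
  using has_partial_lim_avg[OF admissible_gauss1[OF assms(1)] _ _ has_real_derivative_gauss1 assms(2,3), of "partial b v"]
    admissible_gauss2[OF assms(1,2)] partial_v(2)[OF assms(1)]
  by (auto simp: numeral_2_eq_2)

lemma C2_on_v: "C2_on U v"
proof -
  have 0: "continuous_on U v"
    using continuous_lim_avg[OF admissible_heat] by (rule continuous_on_cong[THEN iffD1, rotated 2]) (auto simp: lim_avg_heat)
  have 1: "continuous_on U (partial b v)" if "b \<in> Basis" for b
    using continuous_lim_avg[OF admissible_gauss1[OF that]] by (rule continuous_on_cong[THEN iffD1, rotated 2]) (auto simp: partial_v that)
  have 2: "continuous_on U (partial c (partial b v))" if "b \<in> Basis" "c \<in> Basis" for b c
    using continuous_lim_avg[OF admissible_gauss2[OF that]] by (rule continuous_on_cong[THEN iffD1, rotated 2]) (auto simp: partial_partial_v that)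
  show ?thesis
    unfolding C2_on_def C1_on_def using 0 1 2 partial_v(1) partial_partial_v(1) by blast
qed

lemma avg_heat_equation:
  assumes "0 < h"
  shows "((\<lambda>h. avg (heat 1) 0 h x) has_real_derivative
     (1/2) * (\<Sum>b\<in>Basis. avg (gauss2 b b) 2 h x) - lam * avg (heat 1) 0 h x) (at h)"
proof -
  have e: "((\<lambda>h. exp (- lam * h)) has_real_derivative - lam * exp (- lam * h)) (at h)"
    by (auto intro!: derivative_eq_intros)
  have s: "(1 / sqrt h)\<^sup>2 = 1 / h" using assms by (simp add: power_divide)
  have "((\<lambda>h. exp (- lam * h) * smooth_avg (heat 1) h v x) has_real_derivative
     (1/2) * (\<Sum>b\<in>Basis. avg (gauss2 b b) 2 h x) - lam * avg (heat 1) 0 h x) (at h)"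
    by (rule DERIV_cong[OF DERIV_mult[OF e smooth_avg_heat_equation[OF v_meas v_bound assms]]])
       (simp add: avg_def s sum_distrib_left algebra_simps)
  then show ?thesis by (simp add: avg_def)
qed

text \<open>The discounted average satisfies a heat equation in h with right-hand side G. By the
  mean value theorem its increment from \<open>v x\<close>, divided by h, is G(s) for some s in (0,
  h). The quotient is O(h), whereas G(s) tends to half the Laplacian minus lam times
  \<open>v x\<close>.\<close>

lemma laplacian_v: assumes x: "x \<in> U" shows "laplacian v x = 2 * lam * v x"
proof -
  obtain r K where r: "0 < r" and K: "\<And>y h. y \<in> ball x r \<Longrightarrow> 0 < h \<Longrightarrow> h \<le> 1 \<Longrightarrow> \<bar>avg (heat 1) 0 h y - v y\<bar> \<le> K * h\<^sup>2"
    using approxE[OF x] by blast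
  have xK: "\<bar>avg (heat 1) 0 h x - v x\<bar> \<le> K * h\<^sup>2" if "0 < h" "h \<le> 1" for h using K[of x h] r that by simp
  let ?G = "\<lambda>h. (1/2) * (\<Sum>b\<in>Basis. avg (gauss2 b b) 2 h x) - lam * avg (heat 1) 0 h x"
  \<comment> \<open>The average is extended to h = 0 by \<open>v x\<close>; the O(h^2) bound makes
    this extension continuous, as the mean value theorem requires.\<close>
  define F where "F h = (if h = 0 then v x else avg (heat 1) 0 h x)" for h
  have "\<exists>s. 0 < s \<and> s < h \<and> avg (heat 1) 0 h x - v x = h * ?G s" if h: "0 < h" "h \<le> 1" for h
  proof -
    have dF: "(F has_real_derivative ?G s) (at s)" if "0 < s" for s
      by (rule has_field_derivative_transform_within_open[OF avg_heat_equation[OF that], of "{0<..}"]) (use that in \<open>auto simp: F_def\<close>)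
    have "continuous_on {0..h} F"
    proof (rule continuous_on_eq_continuous_within[THEN iffD2])
      show "\<forall>s\<in>{0..h}. continuous (at s within {0..h}) F"
      proof
        fix s assume s: "s \<in> {0..h}"
        show "continuous (at s within {0..h}) F"
        proof (cases "s = 0")
          case True
          have "((\<lambda>t. F t - v x) \<longlongrightarrow> 0) (at 0 within {0..h})"
          proof (rule Lim_null_comparison)
            show "\<forall>\<^sub>F t in at 0 within {0..h}. norm (F t - v x) \<le> K * t\<^sup>2"
              using xK h by (auto simp: eventually_at_filter F_def intro!: always_eventually)
            show "((\<lambda>t. K * t\<^sup>2) \<longlongrightarrow> 0) (at 0 within {0..h})" by (auto intro!: tendsto_eq_intros)
          qed
          then have "(F \<longlongrightarrow> v x) (at 0 within {0..h})" by (simp add: LIM_zero_iff)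
          then show ?thesis using True by (simp add: continuous_within F_def)
        next
          case False
          then have "isCont F s" using dF[of s] s by (auto intro: DERIV_isCont)
          then show ?thesis by (rule continuous_at_imp_continuous_at_within)
        qed
      qed
    qed
    then obtain l s where s: "0 < s" "s < h" "(F has_real_derivative l) (at s)" "F h - F 0 = (h - 0) * l"
      using MVT[of 0 h F] dF h by (meson real_differentiable_def)
    then have "l = ?G s" using DERIV_unique dF by blast
    then show ?thesis using s h by (auto simp: F_def)
  qed
  then have "\<exists>s. 0 < s \<and> s < (1/2::real) ^ n \<and> avg (heat 1) 0 ((1/2) ^ n) x - v x = (1/2) ^ n * ?G s" for n
    by (simp add: power_le_one)
  then have "\<forall>n. \<exists>s. 0 < s \<and> s < (1/2::real) ^ n \<and> avg (heat 1) 0 ((1/2) ^ n) x - v x = (1/2) ^ n * ?G s" by (rule allI)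
  from choice[OF this] obtain s where s': "\<forall>n. 0 < s n \<and> s n < (1/2::real) ^ n \<and> avg (heat 1) 0 ((1/2) ^ n) x - v x = (1/2) ^ n * ?G (s n)" ..
  then have s: "0 < s n" "s n < (1/2) ^ n" "avg (heat 1) 0 ((1/2) ^ n) x - v x = (1/2) ^ n * ?G (s n)" for n
    using spec[OF s', of n] by safe
  have h0: "(\<lambda>n. (1/2::real) ^ n) \<longlonglongrightarrow> 0" by (rule LIMSEQ_realpow_zero) auto
  have s0: "s \<longlonglongrightarrow> 0" by (rule tendsto_sandwich[OF _ _ tendsto_const h0]) (use s in \<open>auto intro!: always_eventually less_imp_le\<close>)
  have s1: "s n \<le> 1" for n using s(2)[of n] power_le_one[of "1/2::real" n] by simp
  have lim: "(\<lambda>n. avg k e (s n) x) \<longlonglongrightarrow> lim_avg k e x" if k: "admissible k e" "e \<le> 2" for k e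
  proof -
    obtain r K where "0 < r" "\<And>y t. y \<in> ball x r \<Longrightarrow> 0 < t \<Longrightarrow> t \<le> 1 \<Longrightarrow> \<bar>avg k e t y - lim_avg k e y\<bar> \<le> K * t"
      using lim_avg_approx[OF k x] by metis
    then have "\<bar>avg k e (s n) x - lim_avg k e x\<bar> \<le> K * s n" for n using s(1) s1 by simp
    then have b: "\<forall>\<^sub>F n in sequentially. norm (avg k e (s n) x - lim_avg k e x) \<le> K * s n"
      unfolding real_norm_def by (rule eventuallyI)
    have "(\<lambda>n. K * s n) \<longlonglongrightarrow> 0" using tendsto_mult_right_zero[OF s0] .
    with b have "(\<lambda>n. avg k e (s n) x - lim_avg k e x) \<longlonglongrightarrow> 0" by (rule Lim_null_comparison)
    then show ?thesis by (simp add: LIM_zero_iff)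
  qed
  have "(\<lambda>n. ?G (s n)) \<longlonglongrightarrow> (1/2) * (\<Sum>b\<in>Basis. lim_avg (gauss2 b b) 2 x) - lam * lim_avg (heat 1) 0 x"
    by (intro tendsto_intros lim admissible_gauss2 admissible_heat) auto
  moreover have "(\<lambda>n. ?G (s n)) \<longlonglongrightarrow> 0"
  proof (rule Lim_null_comparison)
    show "\<forall>\<^sub>F n in sequentially. norm (?G (s n)) \<le> K * (1/2) ^ n"
    proof (intro always_eventually allI)
      fix n
      have "(1/2) ^ n * \<bar>?G (s n)\<bar> \<le> K * ((1/2) ^ n)\<^sup>2"
        using xK[of "(1/2) ^ n"] unfolding s(3) by (simp add: abs_mult power_le_one)
      also have "\<dots> = (1/2) ^ n * (K * (1/2) ^ n)" by (simp add: power2_eq_square)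
      finally show "norm (?G (s n)) \<le> K * (1/2) ^ n" by simp
    qed
    show "(\<lambda>n. K * (1/2) ^ n) \<longlonglongrightarrow> 0" using h0 by (auto intro!: tendsto_eq_intros)
  qed
  ultimately have "(1/2) * (\<Sum>b\<in>Basis. lim_avg (gauss2 b b) 2 x) - lam * lim_avg (heat 1) 0 x = 0"
    by (rule LIMSEQ_unique)
  then show ?thesis using x by (simp add: laplacian_def partial_partial_v lim_avg_heat)
qed

end

section \<open>Increments of Brownian motion at dyadic times\<close>

text \<open>Countable, dense in the nonnegative reals, and such that any finitely many elements lie
  on a common grid i / 2^m, where the independent increments of \<open>brownian_motion\<close> apply
  directly.\<close>

definition dyadic_times :: "real set" where "dyadic_times = (\<Union>m. range (\<lambda>i. real i / 2 ^ m))"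

lemma countable_dyadic_times: "countable dyadic_times"
  unfolding dyadic_times_def by auto

lemma dyadic_times_nonneg: "q \<in> dyadic_times \<Longrightarrow> 0 \<le> q"
  by (auto simp: dyadic_times_def)

lemma dyadic_timesI: "real i / 2 ^ m \<in> dyadic_times"
  by (auto simp: dyadic_times_def)

lemma zero_dyadic_times: "0 \<in> dyadic_times" and one_dyadic_times: "1 \<in> dyadic_times"
  using dyadic_timesI[of 0 0] dyadic_timesI[of 1 0] by auto

lemma finite_dyadic_times_level:
  assumes "finite J" "J \<subseteq> dyadic_times"
  shows "\<exists>m. \<forall>q\<in>J. \<forall>n\<ge>m. \<exists>i. q = real i / 2 ^ n"
  using assms
proof (induction rule: finite_induct)
  case (insert q J)
  then obtain m where m: "\<forall>q\<in>J. \<forall>n\<ge>m. \<exists>i. q = real i / 2 ^ n" by auto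
  obtain i k where q: "q = real i / 2 ^ k" using insert.prems by (auto simp: dyadic_times_def)
  have "\<exists>i. q = real i / 2 ^ n" if "n \<ge> k" for n
  proof -
    define d where "d = n - k"
    have n: "n = k + d" using that by (simp add: d_def)
    have "real i / 2 ^ k = real (i * 2 ^ d) / 2 ^ (k + d)" by (simp add: power_add)
    then show ?thesis unfolding n q by (rule exI)
  qed
  then have "\<forall>q\<in>insert q J. \<forall>n\<ge>max k m. \<exists>i. q = real i / 2 ^ n" using m by auto
  then show ?case by blast
qed auto

lemma dyadic_approx:
  assumes "a < b" "0 \<le> a" shows "\<exists>q\<in>dyadic_times. a < q \<and> q < b"
proof -
  obtain m where m: "(1/2) ^ m < b - a" using real_arch_pow_inv[of "b - a" "1/2"] assms by auto
  define i where "i = nat (\<lfloor>a * 2 ^ m\<rfloor> + 1)"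
  have i: "real i = of_int \<lfloor>a * 2 ^ m\<rfloor> + 1" using assms by (simp add: i_def)
  have "a * 2 ^ m < real i" "real i \<le> a * 2 ^ m + 1" unfolding i by linarith+
  then have "a < real i / 2 ^ m" "real i / 2 ^ m \<le> a + (1/2) ^ m"
    by (auto simp: field_simps power_one_over)
  then show ?thesis using m dyadic_timesI[of i m] by (intro bexI[of _ "real i / 2 ^ m"]) auto
qed

text \<open>For a fixed event of \<open>Y\<close>, the law of \<open>X\<close> on that event and the
  law of \<open>X\<close> scaled by its probability are finite measures that agree on cylinders,
  hence everywhere.\<close>

lemma (in prob_space) indep_var_PiM_I:
  assumes X: "X \<in> M \<rightarrow>\<^sub>M PiM I K" and Y: "Y \<in> M \<rightarrow>\<^sub>M N"
    and ind: "\<And>J. finite J \<Longrightarrow> J \<subseteq> I \<Longrightarrow> indep_var (PiM J K) (\<lambda>\<omega>. restrict (X \<omega>) J) N Y"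
  shows "indep_var (PiM I K) X N Y"
proof -
  note [measurable] = X Y
  interpret X: prob_space "distr M (PiM I K) X" by (rule prob_space_distr) fact
  interpret Y: prob_space "distr M N Y" by (rule prob_space_distr) fact
  have rect: "emeasure M (X -` A \<inter> space M) * emeasure M (Y -` B \<inter> space M) = emeasure M ((X -` A \<inter> space M) \<inter> (Y -` B \<inter> space M))"
    if A: "A \<in> sets (PiM I K)" and B: "B \<in> sets N" for A B
  proof -
    have YB [measurable]: "Y -` B \<inter> space M \<in> sets M" using B by measurable
    let ?P = "scale_measure (emeasure M (Y -` B \<inter> space M)) (distr M (PiM I K) X)"
    let ?Q = "distr (density M (indicator (Y -` B \<inter> space M))) (PiM I K) X"
    have Q: "emeasure ?Q C = emeasure M ((X -` C \<inter> space M) \<inter> (Y -` B \<inter> space M))" if "C \<in> sets (PiM I K)" for C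
    proof -
      have XC: "X -` C \<inter> space M \<in> sets M" using that by measurable
      have "emeasure ?Q C = (\<integral>\<^sup>+\<omega>. indicator (Y -` B \<inter> space M) \<omega> * indicator (X -` C \<inter> space M) \<omega> \<partial>M)"
        using that XC by (simp add: emeasure_distr emeasure_density)
      also have "\<dots> = (\<integral>\<^sup>+\<omega>. indicator ((X -` C \<inter> space M) \<inter> (Y -` B \<inter> space M)) \<omega> \<partial>M)"
        by (intro nn_integral_cong) (auto split: split_indicator)
      finally show ?thesis using XC YB by (simp only: nn_integral_indicator sets.Int)
    qed
    have "?P = ?Q"
    proof (rule measure_eqI_PiM_infinite)
      show "finite_measure ?P" 
        by (rule finite_measureI, unfold space_scale_measure emeasure_scale_measure X.emeasure_space_1) (simp add: emeasure_eq_measure)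
      fix A J assume J: "finite J" "J \<subseteq> I" and A: "\<And>i. i \<in> J \<Longrightarrow> A i \<in> sets (K i)"
      have PJ: "Pi\<^sub>E J A \<in> sets (PiM J K)" using J A by (intro sets_PiM_I_finite) auto
      have E: "prod_emb I K J (Pi\<^sub>E J A) \<in> sets (PiM I K)" using J A by (intro sets_PiM_I) auto
      have pre: "X -` prod_emb I K J (Pi\<^sub>E J A) \<inter> space M = (\<lambda>\<omega>. restrict (X \<omega>) J) -` Pi\<^sub>E J A \<inter> space M"
        using measurable_space[OF X] by (auto simp: prod_emb_def space_PiM)
      have "prob ((\<lambda>\<omega>. (restrict (X \<omega>) J, Y \<omega>)) -` (Pi\<^sub>E J A \<times> B) \<inter> space M) =
          prob ((\<lambda>\<omega>. restrict (X \<omega>) J) -` Pi\<^sub>E J A \<inter> space M) * prob (Y -` B \<inter> space M)"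
        by (rule indep_varD[OF ind[OF J] PJ B])
      also have "(\<lambda>\<omega>. (restrict (X \<omega>) J, Y \<omega>)) -` (Pi\<^sub>E J A \<times> B) \<inter> space M =
          (X -` prod_emb I K J (Pi\<^sub>E J A) \<inter> space M) \<inter> (Y -` B \<inter> space M)" using pre by auto
      finally have "prob ((X -` prod_emb I K J (Pi\<^sub>E J A) \<inter> space M) \<inter> (Y -` B \<inter> space M)) =
          prob (X -` prod_emb I K J (Pi\<^sub>E J A) \<inter> space M) * prob (Y -` B \<inter> space M)"
        by (simp only: pre)
      then show "emeasure ?P (prod_emb I K J (Pi\<^sub>E J A)) = emeasure ?Q (prod_emb I K J (Pi\<^sub>E J A))"
        unfolding Q[OF E] emeasure_scale_measure emeasure_distr[OF X E] emeasure_eq_measure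
        by (simp only: ennreal_mult' measure_nonneg mult.commute)
    qed auto
    then have "emeasure ?P A = emeasure ?Q A" by simp
    then show ?thesis unfolding Q[OF A] using A by (simp add: emeasure_distr mult.commute)
  qed
  have "distr M (PiM I K) X \<Otimes>\<^sub>M distr M N Y = distr M (PiM I K \<Otimes>\<^sub>M N) (\<lambda>\<omega>. (X \<omega>, Y \<omega>))"
  proof (rule pair_measure_eqI)
    fix A B assume "A \<in> sets (distr M (PiM I K) X)" "B \<in> sets (distr M N Y)"
    then have A [measurable]: "A \<in> sets (PiM I K)" and B [measurable]: "B \<in> sets N" by auto
    have "(\<lambda>\<omega>. (X \<omega>, Y \<omega>)) -` (A \<times> B) \<inter> space M = (X -` A \<inter> space M) \<inter> (Y -` B \<inter> space M)" by auto
    then show "emeasure (distr M (PiM I K) X) A * emeasure (distr M N Y) B =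
        emeasure (distr M (PiM I K \<Otimes>\<^sub>M N) (\<lambda>\<omega>. (X \<omega>, Y \<omega>))) (A \<times> B)"
      using rect[OF A B] by (simp add: emeasure_distr)
  qed (auto intro: X.sigma_finite_measure_axioms Y.sigma_finite_measure_axioms intro!: sets_pair_measure_cong)
  then show ?thesis using X Y by (simp add: indep_var_distribution_eq)
qed

lemma (in prob_space) indep_var_swap:
  assumes "indep_var S X T Y" shows "indep_var T Y S X"
proof -
  have "indep_set B A" if "indep_set A B" for A B
  proof -
    have AB: "A \<subseteq> events" "B \<subseteq> events" "\<forall>a\<in>A. \<forall>b\<in>B. prob (a \<inter> b) = prob a * prob b"
      using that unfolding indep_sets2_eq by auto
    have "prob (b \<inter> a) = prob b * prob a" if "a \<in> A" "b \<in> B" for a b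
      using AB(3) that by (subst Int_commute, subst mult.commute) blast
    then show ?thesis unfolding indep_sets2_eq using AB(1,2) by blast
  qed
  then show ?thesis using assms unfolding indep_var_eq by blast
qed

section \<open>Law and independence of the dyadic increments\<close>

lemma brownian_motionD:
  assumes "brownian_motion M W x"
  shows "prob_space M" "0 \<le> t \<Longrightarrow> W t \<in> borel_measurable M"
    "\<omega> \<in> space M \<Longrightarrow> continuous_on {0..} (\<lambda>t. W t \<omega>)" "AE \<omega> in M. W 0 \<omega> = x"
    "0 \<le> s \<Longrightarrow> s < t \<Longrightarrow> distributed M lborel (\<lambda>\<omega>. W t \<omega> - W s \<omega>) (\<lambda>z. ennreal (heat (t - s) z))"
    "0 \<le> T 0 \<Longrightarrow> strict_mono (T :: nat \<Rightarrow> real) \<Longrightarrow> prob_space.indep_vars M (\<lambda>_. borel) (\<lambda>i \<omega>. W (T (Suc i)) \<omega> - W (T i) \<omega>) UNIV"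
proof -
  note B = assms[unfolded brownian_motion_def]
  show "prob_space M" "0 \<le> t \<Longrightarrow> W t \<in> borel_measurable M"
    "\<omega> \<in> space M \<Longrightarrow> continuous_on {0..} (\<lambda>t. W t \<omega>)" "AE \<omega> in M. W 0 \<omega> = x"
    "0 \<le> T 0 \<Longrightarrow> strict_mono (T :: nat \<Rightarrow> real) \<Longrightarrow> prob_space.indep_vars M (\<lambda>_. borel) (\<lambda>i \<omega>. W (T (Suc i)) \<omega> - W (T i) \<omega>) UNIV"
    using B by blast+
  assume st: "0 \<le> s" "s < t"
  then have "distributed M lborel (\<lambda>\<omega>. W t \<omega> - W s \<omega>)
      (\<lambda>z. ennreal (\<Prod>b\<in>Basis. normal_density 0 (sqrt (t - s)) (z \<bullet> b)))" using B by blast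
  moreover have "0 < t - s" using st by simp
  ultimately show "distributed M lborel (\<lambda>\<omega>. W t \<omega> - W s \<omega>) (\<lambda>z. ennreal (heat (t - s) z))"
    by (simp only: prod_normal_density)
qed

text \<open>
  The past is recorded at the dyadic fractions of \<open>h\<close> and the future at dyadic times after \<open>h\<close>, so
  that \<open>h\<close> may be an arbitrary positive real.
\<close>

definition increments :: "(real \<Rightarrow> 'w \<Rightarrow> 'a::euclidean_space) \<Rightarrow> real \<Rightarrow> 'w \<Rightarrow> real \<Rightarrow> 'a" where
  "increments W a \<omega> = (\<lambda>q\<in>dyadic_times. W (a + q) \<omega> - W a \<omega>)"

definition past_increments :: "(real \<Rightarrow> 'w \<Rightarrow> 'a::euclidean_space) \<Rightarrow> real \<Rightarrow> 'w \<Rightarrow> real \<Rightarrow> 'a" where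
  "past_increments W h \<omega> = (\<lambda>q\<in>dyadic_times \<inter> {..1}. W (h * q) \<omega> - W 0 \<omega>)"

lemma increments_measurable [measurable]:
  assumes "brownian_motion M W x" "0 \<le> a"
  shows "increments W a \<in> M \<rightarrow>\<^sub>M PiM dyadic_times (\<lambda>_. borel)"
  unfolding increments_def
  by (intro measurable_restrict borel_measurable_diff brownian_motionD(2)[OF assms(1)])
     (use assms dyadic_times_nonneg in auto)

lemma past_increments_measurable [measurable]:
  assumes "brownian_motion M W x" "0 \<le> h"
  shows "past_increments W h \<in> M \<rightarrow>\<^sub>M PiM (dyadic_times \<inter> {..1}) (\<lambda>_. borel)"
  unfolding past_increments_def
  by (intro measurable_restrict borel_measurable_diff brownian_motionD(2)[OF assms(1)])
     (use assms dyadic_times_nonneg in auto)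

lemma sum_increments: "(\<Sum>j=a..<a+n. f (Suc j) - f j) = f (a + n) - (f a :: 'a::ab_group_add)"
  by (induction n) auto

text \<open>The right-hand side, a walk with independent Gaussian steps, mentions none of
  \<open>M\<close>, \<open>W\<close>, \<open>x\<close>, \<open>a\<close>; this is what makes
  different Brownian motions comparable.\<close>

lemma level_increments_distr:
  fixes W :: "real \<Rightarrow> 'w \<Rightarrow> 'a::euclidean_space"
  assumes B: "brownian_motion M W x" and a: "0 \<le> a"
  shows "distr M (PiM UNIV (\<lambda>_. borel)) (\<lambda>\<omega> i::nat. W (a + i / 2 ^ m) \<omega> - W a \<omega>) =
    distr (PiM UNIV (\<lambda>_. density lborel (\<lambda>z. ennreal (heat (1 / 2 ^ m) z)))) (PiM UNIV (\<lambda>_. borel)) (\<lambda>\<xi> i. \<Sum>j<i. \<xi> j)"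
proof -
  interpret prob_space M by (rule brownian_motionD[OF B])
  define T where "T i = a + real i / 2 ^ m" for i
  have T: "0 \<le> T i" "strict_mono T" "T (Suc i) - T i = 1 / 2 ^ m" for i
    using a by (auto simp: T_def strict_mono_def divide_strict_right_mono add_divide_distrib)
  have meas [measurable]: "W (T i) \<in> borel_measurable M" for i using brownian_motionD(2)[OF B T(1)] .
  let ?N = "density lborel (\<lambda>z::'a. ennreal (heat (1 / 2 ^ m) z))"
  let ?inc = "\<lambda>\<omega> i. W (T (Suc i)) \<omega> - W (T i) \<omega>"
  have N: "distr M borel (\<lambda>\<omega>. ?inc \<omega> i) = ?N" for i
  proof -
    have "distributed M lborel (\<lambda>\<omega>. ?inc \<omega> i) (\<lambda>z. ennreal (heat (1 / 2 ^ m) z))"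
      using brownian_motionD(5)[OF B T(1) strict_monoD[OF T(2) lessI], of i] by (simp add: T(3))
    then have "distr M lborel (\<lambda>\<omega>. ?inc \<omega> i) = ?N" by (rule distributed_distr_eq_density)
    moreover have "distr M lborel (\<lambda>\<omega>. ?inc \<omega> i) = distr M borel (\<lambda>\<omega>. ?inc \<omega> i)" by (rule distr_cong) auto
    ultimately show ?thesis by simp
  qed
  have ind: "indep_vars (\<lambda>_. borel) (\<lambda>i \<omega>. ?inc \<omega> i) UNIV"
    using brownian_motionD(6)[OF B T(1,2)] .
  have "distr M (PiM UNIV (\<lambda>_. borel)) (\<lambda>\<omega>. \<lambda>i\<in>UNIV. ?inc \<omega> i) = PiM UNIV (\<lambda>i. distr M borel (\<lambda>\<omega>. ?inc \<omega> i))"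
    by (rule indep_vars_iff_distr_eq_PiM[THEN iffD1, OF _ _ ind]) auto
  then have D: "distr M (PiM UNIV (\<lambda>_. borel)) ?inc = PiM UNIV (\<lambda>_. ?N)"
    unfolding N by (simp add: restrict_def)
  have [measurable]: "?inc \<in> M \<rightarrow>\<^sub>M PiM UNIV (\<lambda>_. borel)"
    by (rule measurable_PiM_single') auto
  have [measurable]: "(\<lambda>\<xi> i. \<Sum>j<i. \<xi> j :: 'a) \<in> PiM (UNIV :: nat set) (\<lambda>_. borel) \<rightarrow>\<^sub>M PiM UNIV (\<lambda>_. borel)"
    by (rule measurable_PiM_single') auto
  have "distr (distr M (PiM UNIV (\<lambda>_. borel)) ?inc) (PiM UNIV (\<lambda>_. borel)) (\<lambda>\<xi> i. \<Sum>j<i. \<xi> j) =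
      distr M (PiM UNIV (\<lambda>_. borel)) ((\<lambda>\<xi> i. \<Sum>j<i. \<xi> j) \<circ> ?inc)"
    by (rule distr_distr) auto
  also have "(\<lambda>\<xi> i. \<Sum>j<i. \<xi> j) \<circ> ?inc = (\<lambda>\<omega> i::nat. W (a + i / 2 ^ m) \<omega> - W a \<omega>)"
  proof (intro ext)
    fix \<omega> i
    show "((\<lambda>\<xi> i. \<Sum>j<i. \<xi> j) \<circ> ?inc) \<omega> i = W (a + i / 2 ^ m) \<omega> - W a \<omega>"
      using sum_increments[of "\<lambda>j. W (T j) \<omega>" 0 i] by (simp add: T_def atLeast0LessThan)
  qed
  finally show ?thesis unfolding D by simp
qed

text \<open>A cylinder over finitely many dyadic times is an event on a single grid, and there
  \<open>level_increments_distr\<close> gives both sides the same law.\<close>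

lemma increments_distr_eq:
  fixes W :: "real \<Rightarrow> 'w \<Rightarrow> 'a::euclidean_space" and W' :: "real \<Rightarrow> 'v \<Rightarrow> 'a"
  assumes B: "brownian_motion M W x" and B': "brownian_motion M' W' x'" and a: "0 \<le> a" and a': "0 \<le> a'"
  shows "distr M (PiM dyadic_times (\<lambda>_. borel)) (increments W a) = distr M' (PiM dyadic_times (\<lambda>_. borel)) (increments W' a')"
proof (rule measure_eqI_PiM_infinite)
  interpret M: prob_space M by (rule brownian_motionD[OF B])
  note [measurable] = increments_measurable[OF B a] increments_measurable[OF B' a']
  interpret D: prob_space "distr M (PiM dyadic_times (\<lambda>_. borel)) (increments W a)" by (rule M.prob_space_distr) measurable
  show "finite_measure (distr M (PiM dyadic_times (\<lambda>_. borel)) (increments W a))" by unfold_locales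
  fix A :: "real \<Rightarrow> 'a set" and J assume J: "finite J" "J \<subseteq> dyadic_times" and A: "\<And>i. i \<in> J \<Longrightarrow> A i \<in> sets borel"
  obtain m where "\<forall>q\<in>J. \<exists>i. q = real i / 2 ^ m" using finite_dyadic_times_level[OF J] by auto
  then obtain idx where idx: "\<And>q. q \<in> J \<Longrightarrow> q = real (idx q) / 2 ^ m" by metis
  define S where "S = {\<xi> :: nat \<Rightarrow> 'a. \<forall>q\<in>J. \<xi> (idx q) \<in> A q}"
  have S: "S \<in> sets (PiM UNIV (\<lambda>_. borel))"
  proof -
    have "{\<xi> \<in> space (PiM UNIV (\<lambda>_. borel)). \<forall>q\<in>J. \<xi> (idx q) \<in> A q} \<in> sets (PiM UNIV (\<lambda>_. borel))"
      using J(1) A by (intro sets.sets_Collect_finite_All pred_sets1 measurable_component_singleton) auto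
    then show ?thesis by (simp add: S_def space_PiM)
  qed
  have E: "prod_emb dyadic_times (\<lambda>_. borel) J (Pi\<^sub>E J A) \<in> sets (PiM dyadic_times (\<lambda>_. borel))" using J A by (intro sets_PiM_I) auto
  have key: "emeasure (distr M (PiM dyadic_times (\<lambda>_. borel)) (increments W a)) (prod_emb dyadic_times (\<lambda>_. borel) J (Pi\<^sub>E J A)) =
      emeasure (distr M (PiM UNIV (\<lambda>_. borel)) (\<lambda>\<omega> i::nat. W (a + i / 2 ^ m) \<omega> - W a \<omega>)) S"
    if B: "brownian_motion M W x" and a: "0 \<le> a" for M :: "'c measure" and W :: "real \<Rightarrow> 'c \<Rightarrow> 'a" and x a
  proof -
    have [measurable]: "(\<lambda>\<omega> i::nat. W (a + i / 2 ^ m) \<omega> - W a \<omega>) \<in> M \<rightarrow>\<^sub>M PiM UNIV (\<lambda>_. borel)"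
      using a by (intro measurable_PiM_single' borel_measurable_diff brownian_motionD(2)[OF B]) auto
    have *: "increments W a \<omega> \<in> prod_emb dyadic_times (\<lambda>_. borel) J (Pi\<^sub>E J A) \<longleftrightarrow> (\<lambda>i::nat. W (a + i / 2 ^ m) \<omega> - W a \<omega>) \<in> S" for \<omega>
    proof -
      have "increments W a \<omega> q = W (a + real (idx q) / 2 ^ m) \<omega> - W a \<omega>" if "q \<in> J" for q
        using idx[OF that] that J(2) by (auto simp: increments_def)
      moreover have "increments W a \<omega> \<in> extensional dyadic_times" by (simp add: increments_def)
      ultimately show ?thesis using J(2) by (auto simp: prod_emb_def S_def PiE_iff)
    qed
    have "increments W a -` prod_emb dyadic_times (\<lambda>_. borel) J (Pi\<^sub>E J A) \<inter> space M = (\<lambda>\<omega> i::nat. W (a + i / 2 ^ m) \<omega> - W a \<omega>) -` S \<inter> space M"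
      using * by auto
    then show ?thesis using E S increments_measurable[OF B a] by (simp add: emeasure_distr)
  qed
  show "emeasure (distr M (PiM dyadic_times (\<lambda>_. borel)) (increments W a)) (prod_emb dyadic_times (\<lambda>_. borel) J (Pi\<^sub>E J A)) =
      emeasure (distr M' (PiM dyadic_times (\<lambda>_. borel)) (increments W' a')) (prod_emb dyadic_times (\<lambda>_. borel) J (Pi\<^sub>E J A))"
    unfolding key[OF B a] key[OF B' a'] level_increments_distr[OF B a] level_increments_distr[OF B' a'] ..
qed auto

text \<open>Finite parts of past and future are functions of disjoint blocks of increments along one
  sequence of times. The passage to the infinite families is made one side at a time, with a swap in
  between.\<close>

lemma indep_past_future:
  fixes W :: "real \<Rightarrow> 'w \<Rightarrow> 'a::euclidean_space"
  assumes B: "brownian_motion M W x" and h: "0 < h"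
  shows "prob_space.indep_var M (PiM (dyadic_times \<inter> {..1}) (\<lambda>_. borel)) (past_increments W h)
      (PiM dyadic_times (\<lambda>_. borel)) (increments W h)"
proof -
  interpret prob_space M by (rule brownian_motionD[OF B])
  have h0: "0 \<le> h" using h by simp
  note X = past_increments_measurable[OF B h0] and Y = increments_measurable[OF B h0]
  have fin: "indep_var (PiM J (\<lambda>_. borel)) (\<lambda>\<omega>. restrict (past_increments W h \<omega>) J) (PiM J' (\<lambda>_. borel)) (\<lambda>\<omega>. restrict (increments W h \<omega>) J')"
    if J: "finite J" "J \<subseteq> dyadic_times \<inter> {..1}" and J': "finite J'" "J' \<subseteq> dyadic_times" for J J'
  proof -
    obtain m where "\<forall>q\<in>J \<union> J'. \<exists>i. q = real i / 2 ^ m" using finite_dyadic_times_level[of "J \<union> J'"] J J' by (metis finite_UnI le_inf_iff order_refl sup.bounded_iff)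
    then obtain idx where idx: "\<And>q. q \<in> J \<union> J' \<Longrightarrow> q = real (idx q) / 2 ^ m" by metis
    \<comment> \<open>2^m steps of length h / 2^m reach h exactly at index 2^m; from there on the
      steps have length 1 / 2^m. Thus past and future use different grids inside one increasing
      sequence.\<close>
    define T where "T i = (if i \<le> 2 ^ m then h * (real i / 2 ^ m) else h + (real i - 2 ^ m) / 2 ^ m)" for i
    have T0: "T 0 = 0" by (simp add: T_def)
    have TS: "T i < T (Suc i)" for i
    proof -
      consider "Suc i \<le> 2 ^ m" | "i = 2 ^ m" | "i > 2 ^ m" by linarith
      then show ?thesis
      proof cases
        case 1 then show ?thesis using h by (simp add: T_def divide_strict_right_mono)
      next
        case 2 then show ?thesis using h by (simp add: T_def)
      next
        case 3 then show ?thesis by (simp add: T_def divide_strict_right_mono)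
      qed
    qed
    have T: "strict_mono T" using TS by (rule strict_monoI_Suc)
    let ?inc = "\<lambda>i \<omega>. W (T (Suc i)) \<omega> - W (T i) \<omega>"
    have ind: "indep_vars (\<lambda>_. borel) ?inc UNIV" by (rule brownian_motionD(6)[OF B _ T]) (simp add: T0)
    have ind2: "indep_var (PiM {..<2^m} (\<lambda>_. borel)) (\<lambda>\<omega>. restrict (\<lambda>i. ?inc i \<omega>) {..<2^m})
        (PiM {2^m..} (\<lambda>_. borel)) (\<lambda>\<omega>. restrict (\<lambda>i. ?inc i \<omega>) {2^m..})"
      by (rule indep_var_restrict[OF ind]) auto
    have idx1: "idx q \<le> 2 ^ m" if "q \<in> J" for q
    proof -
      have "real (idx q) / 2 ^ m \<le> 1" using idx[of q] J(2) that by auto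
      then have "real (idx q) \<le> real (2 ^ m)" by simp
      then show ?thesis by (simp only: of_nat_le_iff)
    qed
    let ?Y1 = "\<lambda>\<xi>. \<lambda>q\<in>J. \<Sum>j=0..<0+idx q. \<xi> j :: 'a"
    let ?Y2 = "\<lambda>\<xi>. \<lambda>q\<in>J'. \<Sum>j=2^m..<2^m+idx q. \<xi> j :: 'a"
    have Y1: "?Y1 \<in> PiM {..<2^m} (\<lambda>_. borel) \<rightarrow>\<^sub>M PiM J (\<lambda>_. borel)"
      using idx1 by (intro measurable_restrict borel_measurable_sum measurable_component_singleton) fastforce
    have Y2: "?Y2 \<in> PiM {2^m..} (\<lambda>_. borel) \<rightarrow>\<^sub>M PiM J' (\<lambda>_. borel)"
      by (intro measurable_restrict borel_measurable_sum measurable_component_singleton) auto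
    have 1: "?Y1 \<circ> (\<lambda>\<omega>. restrict (\<lambda>i. ?inc i \<omega>) {..<2^m}) = (\<lambda>\<omega>. restrict (past_increments W h \<omega>) J)"
    proof (rule ext, rule ext)
      fix \<omega> q
      show "(?Y1 \<circ> (\<lambda>\<omega>. restrict (\<lambda>i. ?inc i \<omega>) {..<2^m})) \<omega> q = restrict (past_increments W h \<omega>) J q"
      proof (cases "q \<in> J")
        case True
        have "(\<Sum>j=0..<0+idx q. restrict (\<lambda>i. ?inc i \<omega>) {..<2^m} j) = (\<Sum>j=0..<0+idx q. ?inc j \<omega>)"
          using idx1[OF True] by (intro sum.cong) auto
        also have "\<dots> = W (T (idx q)) \<omega> - W (T 0) \<omega>" using sum_increments[of "\<lambda>j. W (T j) \<omega>" 0] by simp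
        also have "T (idx q) = h * q" using idx[of q] idx1[OF True] True by (simp add: T_def)
        finally show ?thesis using True J(2) by (auto simp: T0 past_increments_def)
      qed auto
    qed
    have 2: "?Y2 \<circ> (\<lambda>\<omega>. restrict (\<lambda>i. ?inc i \<omega>) {2^m..}) = (\<lambda>\<omega>. restrict (increments W h \<omega>) J')"
    proof (rule ext, rule ext)
      fix \<omega> q
      show "(?Y2 \<circ> (\<lambda>\<omega>. restrict (\<lambda>i. ?inc i \<omega>) {2^m..})) \<omega> q = restrict (increments W h \<omega>) J' q"
      proof (cases "q \<in> J'")
        case True
        have "(\<Sum>j=2^m..<2^m+idx q. restrict (\<lambda>i. ?inc i \<omega>) {2^m..} j) = (\<Sum>j=2^m..<2^m+idx q. ?inc j \<omega>)"
          by (intro sum.cong) auto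
        also have "\<dots> = W (T (2^m + idx q)) \<omega> - W (T (2^m)) \<omega>" by (rule sum_increments[of "\<lambda>j. W (T j) \<omega>"])
        also have "T (2^m + idx q) = h + q" using idx[of q] True by (cases "idx q = 0") (auto simp: T_def)
        also have "T (2^m) = h" by (simp add: T_def)
        finally show ?thesis using True J'(2) by (auto simp: increments_def)
      qed auto
    qed
    show ?thesis using indep_var_compose[OF ind2 Y1 Y2] unfolding 1 2 .
  qed
  have Yr: "(\<lambda>\<omega>. restrict (increments W h \<omega>) J') \<in> M \<rightarrow>\<^sub>M PiM J' (\<lambda>_. borel)" if "J' \<subseteq> dyadic_times" for J'
    by (rule measurable_compose[OF Y measurable_restrict_subset]) (rule that)
  have "indep_var (PiM J' (\<lambda>_. borel)) (\<lambda>\<omega>. restrict (increments W h \<omega>) J') (PiM (dyadic_times \<inter> {..1}) (\<lambda>_. borel)) (past_increments W h)"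
    if J': "finite J'" "J' \<subseteq> dyadic_times" for J'
    by (rule indep_var_swap, rule indep_var_PiM_I[OF X Yr[OF J'(2)]], rule fin) (use J' in auto)
  then show ?thesis
    by (intro indep_var_swap[OF indep_var_PiM_I[OF Y X]])
qed

section \<open>Exit time and exit point as functionals of the dyadic path\<close>

abbreviation path_space :: "(real \<Rightarrow> 'a::euclidean_space) measure" where
  "path_space \<equiv> PiM dyadic_times (\<lambda>_. borel)"

text \<open>\<open>infdist\<close> to the empty set is \<open>0\<close>, whence the separate case \<open>D = UNIV\<close>.\<close>

definition wall_dist :: "'a::euclidean_space set \<Rightarrow> 'a \<Rightarrow> real" where
  "wall_dist D z = (if D = UNIV then 1 else infdist z (- D))"

lemma wall_dist_nonneg: "0 \<le> wall_dist D z"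
  by (simp add: wall_dist_def infdist_nonneg)

lemma continuous_on_wall_dist: "continuous_on S (wall_dist D)"
  unfolding wall_dist_def by (cases "D = UNIV") (auto intro!: continuous_intros)

lemma wall_dist_eq_0_iff: "open D \<Longrightarrow> wall_dist D z = 0 \<longleftrightarrow> z \<notin> D"
  using in_closed_iff_infdist_zero[of "- D" z] by (auto simp: wall_dist_def closed_Compl)

lemma borel_measurable_wall_dist [measurable]: "wall_dist D \<in> borel_measurable borel"
  by (intro borel_measurable_continuous_onI continuous_on_wall_dist)

text \<open>Records, through dyadic times only, that the path is outside \<open>D\<close> somewhere
  in [a, b]. This may happen at non-dyadic times only, so arbitrarily small distances to the
  complement are asked for; compactness then yields a genuine point outside.\<close>

definition visits :: "'a::euclidean_space set \<Rightarrow> (real \<Rightarrow> 'a) \<Rightarrow> real \<Rightarrow> real \<Rightarrow> bool" where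
  "visits D \<xi> a b \<longleftrightarrow> (\<forall>j::nat. \<exists>q\<in>dyadic_times. a \<le> q \<and> q \<le> b \<and> wall_dist D (\<xi> q) < 1 / real (Suc j))"

lemma visits_iff:
  assumes D: "open D" and w: "continuous_on {0..} w" and ab: "a \<in> dyadic_times" "b \<in> dyadic_times" "a \<le> b"
  shows "visits D (restrict w dyadic_times) a b \<longleftrightarrow> (\<exists>t\<in>{a..b}. w t \<notin> D)"
proof
  have a0: "0 \<le> a" using ab dyadic_times_nonneg by blast
  have c: "continuous_on {a..b} (\<lambda>t. wall_dist D (w t))"
    by (rule continuous_on_compose2[OF continuous_on_wall_dist continuous_on_subset[OF w]]) (use a0 in auto)
  show "\<exists>t\<in>{a..b}. w t \<notin> D" if v: "visits D (restrict w dyadic_times) a b"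
  proof -
    obtain t where t: "t \<in> {a..b}" "\<And>s. s \<in> {a..b} \<Longrightarrow> wall_dist D (w t) \<le> wall_dist D (w s)"
      using continuous_attains_inf[OF _ _ c] ab by auto
    have "wall_dist D (w t) = 0"
    proof (rule ccontr)
      assume "wall_dist D (w t) \<noteq> 0"
      then have "0 < wall_dist D (w t)" using wall_dist_nonneg[of D "w t"] by simp
      then obtain j where j: "1 / real (Suc j) < wall_dist D (w t)" using nat_approx_posE by blast
      obtain q where "q \<in> dyadic_times" "a \<le> q" "q \<le> b" "wall_dist D (w q) < 1 / real (Suc j)"
        using v unfolding visits_def by force
      then show False using t(2)[of q] j by auto
    qed
    then show ?thesis using t(1) wall_dist_eq_0_iff[OF D] by blast
  qed
  show "visits D (restrict w dyadic_times) a b" if "\<exists>t\<in>{a..b}. w t \<notin> D"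
  proof -
    from that obtain t where t: "t \<in> {a..b}" "w t \<notin> D" by blast
    then have t0: "wall_dist D (w t) = 0" using wall_dist_eq_0_iff[OF D] by blast
    show ?thesis unfolding visits_def
    proof
      fix j :: nat
      obtain d where d: "0 < d" "\<And>s. s \<in> {a..b} \<Longrightarrow> dist s t < d \<Longrightarrow> dist (wall_dist D (w s)) (wall_dist D (w t)) < 1 / real (Suc j)"
        using c t(1) unfolding continuous_on_iff by (metis zero_less_divide_1_iff of_nat_0_less_iff zero_less_Suc)
      have "\<exists>q\<in>dyadic_times. q \<in> {a..b} \<and> dist q t < d"
      proof (cases "a = b")
        case True then show ?thesis using t ab d by auto
      next
        case False
        then have "max a (t - d) < min b (t + d)" using ab t d by auto
        then obtain q where "q \<in> dyadic_times" "max a (t - d) < q" "q < min b (t + d)"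
          using dyadic_approx[of "max a (t - d)" "min b (t + d)"] a0 by (metis max.coboundedI1)
        then show ?thesis by (intro bexI[of _ q]) (auto simp: dist_real_def)
      qed
      then obtain q where q: "q \<in> dyadic_times" "q \<in> {a..b}" "dist q t < d" by blast
      have "wall_dist D (w q) < 1 / real (Suc j)" using d(2)[OF q(2,3)] t0 by (auto simp: dist_real_def)
      then show "\<exists>q\<in>dyadic_times. a \<le> q \<and> q \<le> b \<and> wall_dist D (restrict w dyadic_times q) < 1 / real (Suc j)"
        using q by (intro bexI[of _ q]) auto
    qed
  qed
qed

lemma visits_measurable [measurable]: "Measurable.pred path_space (\<lambda>\<xi>. visits D \<xi> a b)"
proof -
  have "{\<xi> \<in> space path_space. \<forall>j::nat. \<exists>q\<in>dyadic_times. a \<le> q \<and> q \<le> b \<and> wall_dist D (\<xi> q) < 1 / real (Suc j)} \<in> sets path_space"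
  proof (intro sets.sets_Collect_countable_All sets.sets_Collect_countable_Ex' countable_dyadic_times)
    fix j :: nat and q assume q: "q \<in> dyadic_times"
    have [measurable]: "(\<lambda>\<xi>. \<xi> q) \<in> borel_measurable path_space"
      using q by (rule measurable_component_singleton)
    show "{\<xi> \<in> space path_space. a \<le> q \<and> q \<le> b \<and> wall_dist D (\<xi> q) < 1 / real (Suc j)} \<in> sets path_space"
      by measurable
  qed
  then show ?thesis unfolding visits_def pred_def .
qed

text \<open>Infimum of the right ends of dyadic intervals in which the path is outside
  \<open>D\<close>. A positive left end mirrors the exclusion of time 0 in \<open>exit_time\<close>,
  which matters for paths started on the boundary.\<close>

definition first_exit :: "'a::euclidean_space set \<Rightarrow> (real \<Rightarrow> 'a) \<Rightarrow> ereal" where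
  "first_exit D \<xi> = (INF p\<in>dyadic_times \<times> dyadic_times.
     if 0 < fst p \<and> fst p \<le> snd p \<and> visits D \<xi> (fst p) (snd p) then ereal (snd p) else \<infinity>)"

lemma first_exit_measurable [measurable]: "first_exit D \<in> borel_measurable path_space"
  unfolding first_exit_def
  by (intro borel_measurable_INF countable_SIGMA countable_dyadic_times measurable_If measurable_const) measurable

lemma first_exit_eq:
  assumes D: "open D" and w: "continuous_on {0..} w"
  shows "first_exit D (restrict w dyadic_times) = Inf (ereal ` {t. 0 < t \<and> w t \<in> - D})"
proof (rule antisym)
  show "first_exit D (restrict w dyadic_times) \<le> Inf (ereal ` {t. 0 < t \<and> w t \<in> - D})"
  proof (rule Inf_greatest)
    fix e assume "e \<in> ereal ` {t. 0 < t \<and> w t \<in> - D}"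
    then obtain t where t: "0 < t" "w t \<notin> D" "e = ereal t" by auto
    show "first_exit D (restrict w dyadic_times) \<le> e"
    proof (rule ereal_le_epsilon2[rule_format])
      fix d :: real assume d: "0 < d"
      obtain a where a: "a \<in> dyadic_times" "0 < a" "a < t" using dyadic_approx[of 0 t] t by auto
      obtain b where b: "b \<in> dyadic_times" "t < b" "b < t + d" using dyadic_approx[of t "t + d"] t d by auto
      have "visits D (restrict w dyadic_times) a b"
        by (subst visits_iff[OF D w]) (use a b t in auto)
      then have "first_exit D (restrict w dyadic_times) \<le> ereal b"
        unfolding first_exit_def by (intro INF_lower2[of "(a, b)"]) (use a b in auto)
      also have "\<dots> \<le> e + ereal d" using b t by simp
      finally show "first_exit D (restrict w dyadic_times) \<le> e + ereal d" .
    qed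
  qed
  show "Inf (ereal ` {t. 0 < t \<and> w t \<in> - D}) \<le> first_exit D (restrict w dyadic_times)"
    unfolding first_exit_def
  proof (rule INF_greatest)
    fix p assume p: "p \<in> dyadic_times \<times> dyadic_times"
    show "Inf (ereal ` {t. 0 < t \<and> w t \<in> - D}) \<le>
        (if 0 < fst p \<and> fst p \<le> snd p \<and> visits D (restrict w dyadic_times) (fst p) (snd p) then ereal (snd p) else \<infinity>)"
    proof (cases "0 < fst p \<and> fst p \<le> snd p \<and> visits D (restrict w dyadic_times) (fst p) (snd p)")
      case True
      then obtain t where "t \<in> {fst p..snd p}" "w t \<notin> D" using visits_iff[OF D w, of "fst p" "snd p"] p by auto
      then have "Inf (ereal ` {t. 0 < t \<and> w t \<in> - D}) \<le> ereal (snd p)"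
        using True by (intro Inf_lower2[of "ereal t"]) auto
      then show ?thesis unfolding if_P[OF True] .
    next
      case False
      then show ?thesis unfolding if_not_P[OF False] by simp
    qed
  qed
qed

text \<open>The exit time is approached by dyadic times rounded up from it, and continuity gives the
  limit. An infinite exit time is read as 0, as it is in \<open>exit_point\<close>.\<close>

definition exit_pos :: "'a::euclidean_space set \<Rightarrow> (real \<Rightarrow> 'a) \<Rightarrow> 'a" where
  "exit_pos D \<xi> = lim (\<lambda>n. \<xi> (real (nat \<lceil>2 ^ n * real_of_ereal (first_exit D \<xi>)\<rceil>) / 2 ^ n))"

lemma exit_pos_measurable [measurable]: "exit_pos D \<in> borel_measurable path_space"
  unfolding exit_pos_def
proof (rule borel_measurable_lim_metric)
  fix n
  show "(\<lambda>\<xi>. \<xi> (real (nat \<lceil>2 ^ n * real_of_ereal (first_exit D \<xi>)\<rceil>) / 2 ^ n)) \<in> borel_measurable path_space"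
  proof (rule measurable_compose_countable[where f="\<lambda>i \<xi>. \<xi> (real i / 2 ^ n)"])
    show "(\<lambda>\<xi>. \<xi> (real i / 2 ^ n)) \<in> borel_measurable path_space" for i
      by (rule measurable_component_singleton) (rule dyadic_timesI)
    show "(\<lambda>\<xi>. nat \<lceil>2 ^ n * real_of_ereal (first_exit D \<xi>)\<rceil>) \<in> path_space \<rightarrow>\<^sub>M count_space UNIV"
      by measurable
  qed
qed

lemma Inf_exit_nonneg: "0 \<le> Inf (ereal ` {t. 0 < t \<and> w t \<in> - D})"
  by (rule Inf_greatest) auto

lemma exit_pos_eq:
  assumes D: "open D" and w: "continuous_on {0..} w"
  shows "exit_pos D (restrict w dyadic_times) = w (real_of_ereal (Inf (ereal ` {t. 0 < t \<and> w t \<in> - D})))"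
proof -
  define T where "T = real_of_ereal (Inf (ereal ` {t. 0 < t \<and> w t \<in> - D}))"
  have T0: "0 \<le> T" unfolding T_def by (intro real_of_ereal_pos Inf_exit_nonneg)
  define s where "s n = real (nat \<lceil>2 ^ n * T\<rceil>) / 2 ^ n" for n :: nat
  have "2 ^ n * T \<le> real (nat \<lceil>2 ^ n * T\<rceil>)" "real (nat \<lceil>2 ^ n * T\<rceil>) \<le> 2 ^ n * T + 1" for n :: nat
    using T0 by (auto simp: of_nat_nat)
  then have s: "T \<le> s n" "s n \<le> T + (1/2) ^ n" for n
    by (auto simp: s_def field_simps power_one_over)
  have "(\<lambda>n. T + (1/2) ^ n) \<longlonglongrightarrow> T + 0" by (intro tendsto_intros LIMSEQ_realpow_zero) auto
  then have sT: "s \<longlonglongrightarrow> T" using s by (intro tendsto_sandwich[of "\<lambda>_. T" s _ "\<lambda>n. T + (1/2) ^ n"]) auto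
  have "(\<lambda>n. w (s n)) \<longlonglongrightarrow> w T"
    by (rule continuous_on_tendsto_compose[OF w sT]) (use T0 order_trans[OF T0 s(1)] in auto)
  moreover have "restrict w dyadic_times (s n) = w (s n)" for n
    unfolding s_def by (simp add: dyadic_timesI)
  ultimately have "(\<lambda>n. restrict w dyadic_times (s n)) \<longlonglongrightarrow> w T" by simp
  then have "lim (\<lambda>n. restrict w dyadic_times (s n)) = w T" by (rule limI)
  then show ?thesis unfolding exit_pos_def first_exit_eq[OF D w] s_def T_def .
qed

section \<open>Wiener measure on dyadic paths and the Markov property\<close>

definition path_from :: "'a::euclidean_space \<Rightarrow> (real \<Rightarrow> 'a) \<Rightarrow> real \<Rightarrow> 'a" where
  "path_from x \<xi> = (\<lambda>q\<in>dyadic_times. x + \<xi> q)"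

lemma path_from_measurable [measurable]:
  "(\<lambda>p. path_from (fst p) (snd p)) \<in> borel \<Otimes>\<^sub>M path_space \<rightarrow>\<^sub>M path_space"
  unfolding path_from_def
proof (rule measurable_restrict)
  fix q assume q: "q \<in> dyadic_times"
  have [measurable]: "(\<lambda>\<xi>. \<xi> q) \<in> borel_measurable path_space" using q by (rule measurable_component_singleton)
  show "(\<lambda>p. fst p + snd p q) \<in> borel_measurable (borel \<Otimes>\<^sub>M path_space)" by measurable
qed

lemma path_from_measurable' [measurable]: "path_from x \<in> path_space \<rightarrow>\<^sub>M path_space"
  using measurable_compose[OF measurable_Pair1'[of x borel path_space] path_from_measurable] by simp

lemma path_from_increments: "path_from (W a \<omega>) (increments W a \<omega>) = restrict (\<lambda>q. W (a + q) \<omega>) dyadic_times"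
  by (auto simp: path_from_def increments_def restrict_def fun_eq_iff)

definition exit_value :: "real \<Rightarrow> ('a::euclidean_space \<Rightarrow> real) \<Rightarrow> ereal \<Rightarrow> 'a \<Rightarrow> real" where
  "exit_value lam f e z = (if e < \<infinity> then exp (- lam * real_of_ereal e) * f z else 0)"

lemma exit_value_bound:
  assumes "0 \<le> lam" "0 \<le> e" "\<And>y. \<bar>f y\<bar> \<le> C" shows "\<bar>exit_value lam f e z\<bar> \<le> C"
proof -
  have C: "0 \<le> C" using assms(3)[of 0] by simp
  have "0 \<le> real_of_ereal e" using assms(2) by (rule real_of_ereal_pos)
  then have "exp (- lam * real_of_ereal e) \<le> 1" using assms(1) by simp
  then have "exp (- lam * real_of_ereal e) * \<bar>f z\<bar> \<le> 1 * C" using assms(3) by (intro mult_mono) auto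
  then show ?thesis using C by (simp add: exit_value_def abs_mult)
qed

lemma exit_time_eq: "exit_time W D \<omega> = Inf (ereal ` {t. 0 < t \<and> W t \<omega> \<in> - D})"
  by (simp add: exit_time_def)

lemma exit_time_nonneg: "0 \<le> exit_time W D \<omega>"
  unfolding exit_time_eq by (rule Inf_exit_nonneg)

text \<open>The pole 0 is an arbitrary choice: by \<open>increments_distr_eq\<close> every pole and
  every starting time gives the same law.\<close>

definition wiener_law :: "('a::euclidean_space \<Rightarrow> 'w measure) \<Rightarrow> (real \<Rightarrow> 'w \<Rightarrow> 'a) \<Rightarrow> (real \<Rightarrow> 'a) measure" where
  "wiener_law P W = distr (P 0) path_space (increments W 0)"

text \<open>The mean of F for a motion from x, over a measure that does not depend on x;
  measurability in x becomes a matter of Fubini.\<close>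

definition path_mean :: "('a::euclidean_space \<Rightarrow> 'w measure) \<Rightarrow> (real \<Rightarrow> 'w \<Rightarrow> 'a) \<Rightarrow> ((real \<Rightarrow> 'a) \<Rightarrow> real) \<Rightarrow> 'a \<Rightarrow> real" where
  "path_mean P W F x = (\<integral>\<xi>. F (path_from x \<xi>) \<partial>wiener_law P W)"

locale brownian_domain =
  fixes P :: "'a::euclidean_space \<Rightarrow> 'w measure" and W :: "real \<Rightarrow> 'w \<Rightarrow> 'a" and D :: "'a set"
  assumes family: "brownian_family P W" and open_D: "open D"
begin

lemma BM: "brownian_motion (P x) W x"
  using family by (simp add: brownian_family_def)

sublocale prob_space "P x" for x
  by (rule brownian_motionD(1)[OF BM])

lemma W_measurable [measurable]: "0 \<le> t \<Longrightarrow> W t \<in> borel_measurable (P x)"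
  by (rule brownian_motionD(2)[OF BM])

lemma W_continuous: "\<omega> \<in> space (P x) \<Longrightarrow> continuous_on {0..} (\<lambda>t. W t \<omega>)"
  by (rule brownian_motionD(3)[OF BM])

lemma W_start: "AE \<omega> in P x. W 0 \<omega> = x"
  by (rule brownian_motionD(4)[OF BM])

lemma W_continuous_shift: "\<omega> \<in> space (P x) \<Longrightarrow> 0 \<le> h \<Longrightarrow> continuous_on {0..} (\<lambda>t. W (h + t) \<omega>)"
  by (rule continuous_on_compose2[OF W_continuous]) (auto intro!: continuous_intros)

lemma wiener: "0 \<le> a \<Longrightarrow> distr (P x) path_space (increments W a) = wiener_law P W"
  unfolding wiener_law_def by (rule increments_distr_eq[OF BM BM]) auto

lemma increments_measurable [measurable]: "0 \<le> a \<Longrightarrow> increments W a \<in> P x \<rightarrow>\<^sub>M path_space"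
  by (rule increments_measurable[OF BM])

lemma past_measurable [measurable]: "0 \<le> a \<Longrightarrow> past_increments W a \<in> P x \<rightarrow>\<^sub>M PiM (dyadic_times \<inter> {..1}) (\<lambda>_. borel)"
  by (rule past_increments_measurable[OF BM])

lemma sets_wiener [measurable_cong]: "sets (wiener_law P W) = sets path_space"
  by (simp add: wiener_law_def)

lemma prob_space_wiener: "prob_space (wiener_law P W)"
  unfolding wiener_law_def by (rule prob_space_distr) measurable

text \<open>Independence makes the joint law a product, and integrating the future first amounts to
  conditioning on the past. The whole past stays in the integrand because the propagation of zeros
  restricts to paths that have oscillated little.\<close>

lemma past_future_integral:
  fixes F :: "(real \<Rightarrow> 'a) \<times> (real \<Rightarrow> 'a) \<Rightarrow> real"
  assumes [measurable]: "F \<in> borel_measurable (PiM (dyadic_times \<inter> {..1}) (\<lambda>_. borel) \<Otimes>\<^sub>M path_space)"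
    and bound: "\<And>p. \<bar>F p\<bar> \<le> C" and h: "0 < h"
  shows "(\<integral>\<omega>. F (past_increments W h \<omega>, increments W h \<omega>) \<partial>P x) =
    (\<integral>\<omega>. (\<integral>\<eta>. F (past_increments W h \<omega>, \<eta>) \<partial>wiener_law P W) \<partial>P x)"
proof -
  have h0: "0 \<le> h" using h by simp
  let ?N = "PiM (dyadic_times \<inter> {..1}) (\<lambda>_. borel) :: (real \<Rightarrow> 'a) measure"
  interpret wl: prob_space "wiener_law P W" by (rule prob_space_wiener)
  interpret pl: prob_space "distr (P x) ?N (past_increments W h)" by (rule prob_space_distr) (rule past_measurable[OF h0])
  interpret pp: pair_prob_space "distr (P x) ?N (past_increments W h)" "wiener_law P W" ..
  note [measurable] = increments_measurable[OF h0] past_measurable[OF h0]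
  have D: "distr (P x) ?N (past_increments W h) \<Otimes>\<^sub>M wiener_law P W =
      distr (P x) (?N \<Otimes>\<^sub>M path_space) (\<lambda>\<omega>. (past_increments W h \<omega>, increments W h \<omega>))"
    using indep_past_future[OF BM[of x] h] unfolding indep_var_distribution_eq by (simp add: wiener h0)
  have "(\<integral>\<omega>. F (past_increments W h \<omega>, increments W h \<omega>) \<partial>P x) =
      (\<integral>p. F p \<partial>distr (P x) (?N \<Otimes>\<^sub>M path_space) (\<lambda>\<omega>. (past_increments W h \<omega>, increments W h \<omega>)))"
    by (subst integral_distr) auto
  also have "\<dots> = (\<integral>p. F p \<partial>(distr (P x) ?N (past_increments W h) \<Otimes>\<^sub>M wiener_law P W))"
    by (simp only: D)
  also have "\<dots> = (\<integral>p. (\<integral>\<eta>. F (p, \<eta>) \<partial>wiener_law P W) \<partial>distr (P x) ?N (past_increments W h))"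
    by (rule pp.integral_fst'[symmetric], rule pp.P.integrable_const_bound[where B=C]) (auto simp: bound)
  also have "\<dots> = (\<integral>\<omega>. (\<integral>\<eta>. F (past_increments W h \<omega>, \<eta>) \<partial>wiener_law P W) \<partial>P x)"
    by (subst integral_distr) (auto intro!: wl.borel_measurable_lebesgue_integral)
  finally show ?thesis .
qed

lemma path_mean_measurable [measurable]:
  assumes [measurable]: "F \<in> borel_measurable path_space"
  shows "path_mean P W F \<in> borel_measurable borel"
proof -
  interpret wl: prob_space "wiener_law P W" by (rule prob_space_wiener)
  have "(\<lambda>(x, \<xi>). F (path_from x \<xi>)) \<in> borel_measurable (borel \<Otimes>\<^sub>M wiener_law P W)"
    using measurable_compose[OF path_from_measurable assms] by (simp add: case_prod_beta' cong: measurable_cong_sets)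
  then show ?thesis unfolding path_mean_def by (rule wl.borel_measurable_lebesgue_integral)
qed

lemma path_mean_bound:
  assumes [measurable]: "F \<in> borel_measurable path_space" and "\<And>\<xi>. \<bar>F \<xi>\<bar> \<le> C"
  shows "\<bar>path_mean P W F x\<bar> \<le> C"
proof -
  interpret wl: prob_space "wiener_law P W" by (rule prob_space_wiener)
  have i: "integrable (wiener_law P W) (\<lambda>\<xi>. F (path_from x \<xi>))"
    by (rule wl.integrable_const_bound[where B=C]) (use assms(2) in auto)
  have "\<bar>path_mean P W F x\<bar> \<le> (\<integral>\<xi>. \<bar>F (path_from x \<xi>)\<bar> \<partial>wiener_law P W)"
    unfolding path_mean_def by (rule integral_abs_bound)
  also have "\<dots> \<le> (\<integral>\<xi>. C \<partial>wiener_law P W)" using i assms(2) by (intro integral_mono) auto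
  finally show ?thesis by (simp add: wl.prob_space)
qed

lemma path_mean_eq:
  assumes [measurable]: "F \<in> borel_measurable path_space"
  shows "path_mean P W F x = (\<integral>\<omega>. F (restrict (\<lambda>q. W q \<omega>) dyadic_times) \<partial>P x)"
proof -
  have "path_mean P W F x = (\<integral>\<omega>. F (path_from x (increments W 0 \<omega>)) \<partial>P x)"
    unfolding path_mean_def wiener[OF order_refl, of x, symmetric] by (subst integral_distr) auto
  also have "\<dots> = (\<integral>\<omega>. F (restrict (\<lambda>q. W q \<omega>) dyadic_times) \<partial>P x)"
  proof (rule integral_cong_AE)
    show "(\<lambda>\<omega>. F (path_from x (increments W 0 \<omega>))) \<in> borel_measurable (P x)" by measurable
    show "(\<lambda>\<omega>. F (restrict (\<lambda>q. W q \<omega>) dyadic_times)) \<in> borel_measurable (P x)"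
      by (rule measurable_compose[OF measurable_restrict assms]) (auto intro: W_measurable dyadic_times_nonneg)
    show "AE \<omega> in P x. F (path_from x (increments W 0 \<omega>)) = F (restrict (\<lambda>q. W q \<omega>) dyadic_times)"
      using W_start[of x]
    proof eventually_elim
      case (elim \<omega>)
      then show ?case using path_from_increments[of W 0 \<omega>] by simp
    qed
  qed
  finally show ?thesis .
qed

lemma integral_increment:
  assumes [measurable]: "g \<in> borel_measurable borel" and h: "0 < h"
  shows "(\<integral>\<omega>. g (x + (W h \<omega> - W 0 \<omega>)) \<partial>P x) = smooth_avg (heat 1) h g x"
proof -
  have "distributed (P x) lborel (\<lambda>\<omega>. W h \<omega> - W 0 \<omega>) (\<lambda>z. ennreal (heat (h - 0) z))"
    by (rule brownian_motionD(5)[OF BM]) (use h in auto)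
  then have D: "distributed (P x) lborel (\<lambda>\<omega>. W h \<omega> - W 0 \<omega>) (\<lambda>z. ennreal (heat h z))" by simp
  have "(\<integral>z. heat h z * g (x + z) \<partial>lborel) = (\<integral>\<omega>. g (x + (W h \<omega> - W 0 \<omega>)) \<partial>P x)"
    by (rule distributed_integral[OF D]) (auto simp: less_imp_le heat_pos h)
  then show ?thesis using h by (simp add: smooth_avg_heat)
qed

text \<open>The past enters only through its coordinate 1, the displacement W h - W 0; its Gaussian
  law turns the outer integral into \<open>smooth_avg\<close>.\<close>

lemma markov:
  assumes F [measurable]: "F \<in> borel_measurable path_space" and bound: "\<And>\<xi>. \<bar>F \<xi>\<bar> \<le> C" and h: "0 < h"
  shows "(\<integral>\<omega>. F (restrict (\<lambda>q. W (h + q) \<omega>) dyadic_times) \<partial>P x) = smooth_avg (heat 1) h (path_mean P W F) x"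
proof -
  have h0: "0 \<le> h" using h by simp
  note [measurable] = increments_measurable[OF h0] past_measurable[OF h0]
  have one: "1 \<in> dyadic_times \<inter> {..1}" using one_dyadic_times by simp
  have [measurable]: "(\<lambda>\<xi>. \<xi> 1) \<in> borel_measurable (PiM (dyadic_times \<inter> {..1}) (\<lambda>_. borel))"
    using one by (rule measurable_component_singleton)
  have p1: "past_increments W h \<omega> 1 = W h \<omega> - W 0 \<omega>" for \<omega> using one by (simp add: past_increments_def)
  have G [measurable]: "(\<lambda>p. F (path_from (x + fst p 1) (snd p))) \<in> borel_measurable (PiM (dyadic_times \<inter> {..1}) (\<lambda>_. borel) \<Otimes>\<^sub>M path_space)"
  proof -
    have "(\<lambda>p. (x + fst p 1, snd p)) \<in> PiM (dyadic_times \<inter> {..1}) (\<lambda>_. borel) \<Otimes>\<^sub>M path_space \<rightarrow>\<^sub>M borel \<Otimes>\<^sub>M path_space"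
      by measurable
    from measurable_compose[OF measurable_compose[OF this path_from_measurable] F] show ?thesis by simp
  qed
  have "(\<integral>\<omega>. F (restrict (\<lambda>q. W (h + q) \<omega>) dyadic_times) \<partial>P x) =
      (\<integral>\<omega>. F (path_from (x + past_increments W h \<omega> 1) (increments W h \<omega>)) \<partial>P x)"
  proof (rule integral_cong_AE)
    show "(\<lambda>\<omega>. F (restrict (\<lambda>q. W (h + q) \<omega>) dyadic_times)) \<in> borel_measurable (P x)"
    proof (rule measurable_compose[OF measurable_restrict F])
      show "W (h + q) \<in> borel_measurable (P x)" if "q \<in> dyadic_times" for q
        using dyadic_times_nonneg[OF that] h0 by (intro W_measurable) simp
    qed
    show "(\<lambda>\<omega>. F (path_from (x + past_increments W h \<omega> 1) (increments W h \<omega>))) \<in> borel_measurable (P x)"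
      using measurable_compose[OF _ G, of "\<lambda>\<omega>. (past_increments W h \<omega>, increments W h \<omega>)"] by simp
    show "AE \<omega> in P x. F (restrict (\<lambda>q. W (h + q) \<omega>) dyadic_times) = F (path_from (x + past_increments W h \<omega> 1) (increments W h \<omega>))"
      using W_start[of x]
    proof eventually_elim
      case (elim \<omega>)
      then show ?case using path_from_increments[of W h \<omega>] by (simp add: p1)
    qed
  qed
  also have "\<dots> = (\<integral>\<omega>. (\<integral>\<eta>. F (path_from (x + past_increments W h \<omega> 1) \<eta>) \<partial>wiener_law P W) \<partial>P x)"
    using past_future_integral[OF G _ h, of C x] bound by simp
  also have "\<dots> = (\<integral>\<omega>. path_mean P W F (x + (W h \<omega> - W 0 \<omega>)) \<partial>P x)" by (simp add: path_mean_def p1)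
  also have "\<dots> = smooth_avg (heat 1) h (path_mean P W F) x" by (rule integral_increment[OF _ h]) measurable
  finally show ?thesis .
qed

end

section \<open>Oscillation of Brownian paths and interior regularity\<close>

text \<open>r (1 - (9/10)^(k+1)) is the sum of the thresholds of levels 0 to k. An odd grid point of
  level k + 1 is one step away from an even one, which already belongs to level k.\<close>

lemma chaining_bound:
  fixes w :: "real \<Rightarrow> 'a::real_normed_vector"
  assumes step: "\<And>k i. i < 2 ^ k \<Longrightarrow> norm (w (h * (real (Suc i) / 2 ^ k)) - w (h * (real i / 2 ^ k))) \<le> (1/10) * (9/10) ^ k * r"
    and r: "0 \<le> r" and i: "i \<le> 2 ^ k"
  shows "norm (w (h * (real i / 2 ^ k)) - w 0) \<le> r * (1 - (9/10) ^ Suc k)"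
  using i
proof (induction k arbitrary: i)
  case 0
  then consider "i = 0" | "i = 1" by fastforce
  then show ?case using step[of 0 0] r by cases auto
next
  case (Suc k)
  have mono: "r * (1 - (9/10) ^ Suc k) \<le> r * (1 - (9/10) ^ Suc (Suc k))"
    using r power_decreasing[of "Suc k" "Suc (Suc k)" "9/10::real"] by (intro mult_left_mono) auto
  show ?case
  proof (cases "even i")
    case True
    then obtain l where l: "i = 2 * l" by blast
    then have "norm (w (h * (real l / 2 ^ k)) - w 0) \<le> r * (1 - (9/10) ^ Suc k)" using Suc by auto
    moreover have "real i / 2 ^ Suc k = real l / 2 ^ k" by (simp add: l)
    ultimately show ?thesis using mono by simp
  next
    case False
    then obtain l where l: "i = 2 * l + 1" by (auto elim: oddE)
    then have l2: "2 * l < 2 ^ Suc k" "l \<le> 2 ^ k" using Suc.prems by auto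
    have "real (2 * l) / 2 ^ Suc k = real l / 2 ^ k" by simp
    then have "norm (w (h * (real (2 * l) / 2 ^ Suc k)) - w 0) \<le> r * (1 - (9/10) ^ Suc k)" using Suc.IH[OF l2(2)] by simp
    moreover have "norm (w (h * (real (Suc (2 * l)) / 2 ^ Suc k)) - w (h * (real (2 * l) / 2 ^ Suc k))) \<le> (1/10) * (9/10) ^ Suc k * r"
      by (rule step[OF l2(1)])
    ultimately have "norm (w (h * (real (Suc (2 * l)) / 2 ^ Suc k)) - w 0) \<le> (1/10) * (9/10) ^ Suc k * r + r * (1 - (9/10) ^ Suc k)"
      using norm_triangle_ineq[of "w (h * (real (Suc (2 * l)) / 2 ^ Suc k)) - w (h * (real (2 * l) / 2 ^ Suc k))"
          "w (h * (real (2 * l) / 2 ^ Suc k)) - w 0"] by simp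
    also have "\<dots> = r * (1 - (9/10) ^ Suc (Suc k))" by (simp add: algebra_simps)
    finally show ?thesis by (simp add: l)
  qed
qed

lemma Inf_exit_shift:
  fixes w :: "real \<Rightarrow> 'a"
  assumes stay: "\<And>t. 0 < t \<Longrightarrow> t \<le> h \<Longrightarrow> w t \<in> D" and h: "0 \<le> h"
  shows "Inf (ereal ` {t. 0 < t \<and> w t \<in> - D}) = Inf (ereal ` {t. 0 < t \<and> w (h + t) \<in> - D}) + ereal h"
proof -
  let ?A = "{t. 0 < t \<and> w t \<in> - D}" and ?B = "{t. 0 < t \<and> w (h + t) \<in> - D}"
  have "?A = (\<lambda>t. t + h) ` ?B"
  proof (intro equalityI subsetI)
    fix t assume t: "t \<in> ?A"
    then have "h < t" using stay[of t] by force
    then show "t \<in> (\<lambda>t. t + h) ` ?B" using t by (intro image_eqI[of _ _ "t - h"]) auto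
  qed (use h in \<open>auto simp: add.commute\<close>)
  then have *: "Inf (ereal ` ?A) = (INF t\<in>?B. ereal t + ereal h)" by (simp add: image_image)
  show ?thesis
  proof (cases "?B = {}")
    case True then show ?thesis unfolding * by (simp only: True) (simp add: top_ereal_def)
  next
    case False
    then show ?thesis unfolding * by (intro INF_ereal_add_left) auto
  qed
qed

lemma exit_value_shift:
  assumes "0 \<le> e" shows "exit_value lam f (e + ereal h) z = exp (- lam * h) * exit_value lam f e z"
  using assms by (cases e) (auto simp: exit_value_def exp_add[symmetric] algebra_simps)

lemma integrable_lborel_affine:
  fixes F :: "'a::euclidean_space \<Rightarrow> real"
  assumes [measurable]: "F \<in> borel_measurable borel" and c: "c \<noteq> 0"
    and i: "integrable lborel (\<lambda>z. F (t + c *\<^sub>R z))"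
  shows "integrable lborel F"
proof -
  have "integrable (density (distr lborel borel (\<lambda>x. t + c *\<^sub>R x)) (\<lambda>_. ennreal (\<bar>c\<bar> ^ DIM('a)))) F"
    by (subst integrable_density) (use i in \<open>auto simp: integrable_distr_eq\<close>)
  moreover have "density (distr lborel borel (\<lambda>x. t + c *\<^sub>R x)) (\<lambda>_. ennreal (\<bar>c\<bar> ^ DIM('a))) = (lborel :: 'a measure)"
    using lborel_affine[OF c, of t] by (rule sym)
  ultimately show ?thesis by (simp only:)
qed

definition gauss_moment4 :: "'a::euclidean_space itself \<Rightarrow> real" where
  "gauss_moment4 _ = (\<integral>z. norm z ^ 4 * \<bar>heat 1 (z::'a)\<bar> \<partial>lborel)"

text \<open>Level k has 2^k increments over time h / 2^k. With the fourth-moment bound at threshold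
  (1/10) (9/10)^k r their union costs the moment times 10^4 h^2 / r^4 times ((10/9)^4 / 2)^k. The
  constant is the sum of this geometric series, convergent because (10/9)^4 < 2.\<close>

definition osc_const :: "'a::euclidean_space itself \<Rightarrow> real" where
  "osc_const T = gauss_moment4 T * 10 ^ 4 / (1 - (10/9) ^ 4 / 2)"

lemma almost_heat_invariant_regular: "almost_heat_invariant v C lam U \<Longrightarrow> C2_on U v \<and> (\<forall>x\<in>U. laplacian v x = 2 * lam * v x)"
  using almost_heat_invariant.C2_on_v almost_heat_invariant.laplacian_v by blast

section \<open>The maximal inequality for the oscillation up to time h\<close>

context brownian_domain
begin

text \<open>Markov's inequality for the fourth power, whose mean scales like (t - s)^2; a second
  moment would give only t - s.\<close>

lemma increment_tail:
  assumes s: "0 \<le> s" and t: "s < t" and a: "0 < a"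
  shows "prob x {\<omega>\<in>space (P x). a < norm (W t \<omega> - W s \<omega>)} \<le> gauss_moment4 TYPE('a) * (t - s)\<^sup>2 / a ^ 4"
proof -
  have h: "0 < t - s" using t by simp
  have [measurable]: "W t \<in> borel_measurable (P x)" "W s \<in> borel_measurable (P x)" using s t by (auto intro: W_measurable)
  have D: "distributed (P x) lborel (\<lambda>\<omega>. W t \<omega> - W s \<omega>) (\<lambda>z. ennreal (heat (t - s) z))"
    by (rule brownian_motionD(5)[OF BM s t])
  have q: "sqrt (t - s) ^ 4 = (t - s)\<^sup>2"
    using h by (simp add: power4_eq_xxxx power2_eq_square mult.assoc[symmetric])
  have scale: "sqrt (t - s) ^ DIM('a) * (heat (t - s) (sqrt (t - s) *\<^sub>R z) * norm (sqrt (t - s) *\<^sub>R z) ^ 4) =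
      (t - s)\<^sup>2 * (norm z ^ 4 * \<bar>heat 1 z\<bar>)" for z :: 'a
  proof -
    have "sqrt (t - s) ^ DIM('a) * (heat (t - s) (sqrt (t - s) *\<^sub>R z) * norm (sqrt (t - s) *\<^sub>R z) ^ 4) =
        (sqrt (t - s) ^ DIM('a) * heat (t - s) (sqrt (t - s) *\<^sub>R z)) * ((t - s)\<^sup>2 * norm z ^ 4)"
      using h by (simp add: power_mult_distrib q)
    then show ?thesis unfolding heat_scaleR[OF h] using heat_pos[of 1 z] by simp
  qed
  have "(\<integral>z. heat (t - s) z * norm (z::'a) ^ 4 \<partial>lborel) =
      \<bar>sqrt (t - s)\<bar> ^ DIM('a) * (\<integral>z. heat (t - s) (0 + sqrt (t - s) *\<^sub>R z) * norm (0 + sqrt (t - s) *\<^sub>R (z::'a)) ^ 4 \<partial>lborel)"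
    by (rule integral_lborel_affine) (use h in auto)
  also have "\<dots> = (\<integral>z. sqrt (t - s) ^ DIM('a) * (heat (t - s) (sqrt (t - s) *\<^sub>R z) * norm (sqrt (t - s) *\<^sub>R (z::'a)) ^ 4) \<partial>lborel)"
    using h by simp
  also have "\<dots> = (t - s)\<^sup>2 * gauss_moment4 TYPE('a)" unfolding scale gauss_moment4_def by simp
  finally have mom: "(\<integral>z. heat (t - s) z * norm (z::'a) ^ 4 \<partial>lborel) = (t - s)\<^sup>2 * gauss_moment4 TYPE('a)" .
  have pos: "0 \<le> heat (t - s) z" for z :: 'a using heat_pos[OF h, of z] by simp
  have E: "expectation x (\<lambda>\<omega>. norm (W t \<omega> - W s \<omega>) ^ 4) = (t - s)\<^sup>2 * gauss_moment4 TYPE('a)"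
    using distributed_integral[OF D, of "\<lambda>z. norm z ^ 4"] mom pos by simp
  have "integrable lborel (\<lambda>z. heat (t - s) z * norm (z::'a) ^ 4)"
  proof (rule integrable_lborel_affine[where t=0 and c="sqrt (t - s)"])
    have "integrable lborel (\<lambda>z. (t - s)\<^sup>2 * (norm z ^ 4 * \<bar>heat 1 (z::'a)\<bar>))"
      by (intro integrable_mult_right gauss_dom_integrable_pow gauss_dom_gauss)
    then have "integrable lborel (\<lambda>z. (1 / sqrt (t - s) ^ DIM('a)) * (sqrt (t - s) ^ DIM('a) * (heat (t - s) (sqrt (t - s) *\<^sub>R z) * norm (sqrt (t - s) *\<^sub>R (z::'a)) ^ 4)))"
      unfolding scale[symmetric] by (rule integrable_mult_right)
    then show "integrable lborel (\<lambda>z. heat (t - s) (0 + sqrt (t - s) *\<^sub>R z) * norm (0 + sqrt (t - s) *\<^sub>R (z::'a)) ^ 4)"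
      using h by simp
  qed (use h in auto)
  then have I: "integrable (P x) (\<lambda>\<omega>. norm (W t \<omega> - W s \<omega>) ^ 4)"
    using distributed_integrable[OF D, of "\<lambda>z. norm z ^ 4"] pos by simp
  have "prob x {\<omega>\<in>space (P x). a < norm (W t \<omega> - W s \<omega>)} = expectation x (indicator {\<omega>\<in>space (P x). a < norm (W t \<omega> - W s \<omega>)})"
    by simp
  also have "\<dots> \<le> expectation x (\<lambda>\<omega>. norm (W t \<omega> - W s \<omega>) ^ 4 / a ^ 4)"
  proof (rule integral_mono)
    show "indicator {\<omega>\<in>space (P x). a < norm (W t \<omega> - W s \<omega>)} \<omega> \<le> norm (W t \<omega> - W s \<omega>) ^ 4 / a ^ 4" for \<omega>
      using power_mono[of a "norm (W t \<omega> - W s \<omega>)" 4] a by (auto simp: indicator_def)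
  qed (use I in \<open>auto simp: integrable_indicator_iff emeasure_eq_measure\<close>)
  also have "\<dots> = gauss_moment4 TYPE('a) * (t - s)\<^sup>2 / a ^ 4" using E by (simp add: mult.commute)
  finally show ?thesis .
qed

text \<open>Phrased through \<open>past_increments\<close>, so that independence can separate it
  from the future; by \<open>not_large_osc\<close> it contains every path that travels further than
  r before time h.\<close>

definition large_osc :: "'a \<Rightarrow> real \<Rightarrow> real \<Rightarrow> 'w set" where
  "large_osc x h r = {\<omega>\<in>space (P x). \<exists>q\<in>dyadic_times \<inter> {..1}. r < norm (past_increments W h \<omega> q)}"

lemma large_osc_measurable [measurable]: "0 \<le> h \<Longrightarrow> large_osc x h r \<in> sets (P x)"
  unfolding large_osc_def
proof (rule sets.sets_Collect_countable_Ex')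
  fix q assume h: "0 \<le> h" and q: "q \<in> dyadic_times \<inter> {..1}"
  have [measurable]: "(\<lambda>\<omega>. past_increments W h \<omega> q) \<in> borel_measurable (P x)"
    by (rule measurable_compose[OF past_measurable[OF h] measurable_component_singleton[OF q]])
  show "{\<omega>\<in>space (P x). r < norm (past_increments W h \<omega> q)} \<in> sets (P x)" by measurable
qed (use countable_dyadic_times in auto)

lemma not_large_osc:
  assumes \<omega>: "\<omega> \<in> space (P x)" "\<omega> \<notin> large_osc x h r" and h: "0 < h" and t: "0 \<le> t" "t \<le> h"
  shows "norm (W t \<omega> - W 0 \<omega>) \<le> r"
proof (rule ccontr)
  assume "\<not> norm (W t \<omega> - W 0 \<omega>) \<le> r"
  then have gt: "r < norm (W t \<omega> - W 0 \<omega>)" by simp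
  have c: "continuous_on {0..1} (\<lambda>u. norm (W (h * u) \<omega> - W 0 \<omega>))"
    by (intro continuous_intros continuous_on_compose2[OF W_continuous[OF \<omega>(1)]]) (use h in auto)
  have th: "t / h \<in> {0..1}" "h * (t / h) = t" using t h by auto
  obtain d where d: "0 < d" "\<And>u. u \<in> {0..1} \<Longrightarrow> dist u (t / h) < d \<Longrightarrow>
      dist (norm (W (h * u) \<omega> - W 0 \<omega>)) (norm (W (h * (t / h)) \<omega> - W 0 \<omega>)) < norm (W t \<omega> - W 0 \<omega>) - r"
    using c th(1) gt unfolding continuous_on_iff by (metis diff_gt_0_iff_gt)
  have "max 0 (t / h - d) < min 1 (t / h + d)" using th d by auto
  then obtain q where q: "q \<in> dyadic_times" "max 0 (t / h - d) < q" "q < min 1 (t / h + d)"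
    using dyadic_approx[of "max 0 (t / h - d)" "min 1 (t / h + d)"] by auto
  have "dist (norm (W (h * q) \<omega> - W 0 \<omega>)) (norm (W t \<omega> - W 0 \<omega>)) < norm (W t \<omega> - W 0 \<omega>) - r"
    using d(2)[of q] q unfolding th(2) by (auto simp: dist_real_def)
  then have "r < norm (W (h * q) \<omega> - W 0 \<omega>)" by (auto simp: dist_real_def)
  then have "\<omega> \<in> large_osc x h r" using \<omega>(1) q by (auto simp: large_osc_def past_increments_def intro!: bexI[of _ q])
  then show False using \<omega>(2) by simp
qed

text \<open>
  Chaining: union bound over the increments of all dyadic levels \<open>k\<close>, with thresholds
  \<open>(1/10) (9/10)^k r\<close> that sum to \<open>r\<close>.
\<close>

lemma prob_large_osc:
  assumes h: "0 < h" and r: "0 < r"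
  shows "prob x (large_osc x h r) \<le> osc_const TYPE('a) * h\<^sup>2 / r ^ 4"
proof -
  define c where "c k = (1/10) * (9/10) ^ k * r" for k :: nat
  have c0: "0 < c k" for k using r by (simp add: c_def)
  define T where "T k i = h * (real i / 2 ^ k)" for k i :: nat
  have T: "0 \<le> T k i" "T k i < T k (Suc i)" "T k (Suc i) - T k i = h / 2 ^ k" for k i
    using h by (auto simp: T_def divide_strict_right_mono right_diff_distrib[symmetric] diff_divide_distrib[symmetric])
  have Tm [measurable]: "W (T k i) \<in> borel_measurable (P x)" for k i by (rule W_measurable[OF T(1)])
  define A where "A k i = {\<omega>\<in>space (P x). c k < norm (W (T k (Suc i)) \<omega> - W (T k i) \<omega>)}" for k i
  have A [measurable]: "A k i \<in> sets (P x)" for k i unfolding A_def by measurable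
  define B where "B k = (\<Union>i<2 ^ k. A k i)" for k :: nat
  have B [measurable]: "B k \<in> sets (P x)" for k unfolding B_def by measurable
  define \<rho> :: real where "\<rho> = (10/9) ^ 4 / 2"
  have \<rho>: "0 \<le> \<rho>" "\<rho> < 1" by (auto simp: \<rho>_def power4_eq_xxxx)
  have PB: "prob x (B k) \<le> (gauss_moment4 TYPE('a) * 10 ^ 4 * h\<^sup>2 / r ^ 4) * \<rho> ^ k" for k
  proof -
    have "prob x (B k) \<le> (\<Sum>i<2 ^ k. prob x (A k i))"
      unfolding B_def by (rule finite_measure_subadditive_finite) auto
    also have "\<dots> \<le> (\<Sum>i<(2::nat) ^ k. gauss_moment4 TYPE('a) * (h / 2 ^ k)\<^sup>2 / c k ^ 4)"
      using increment_tail[OF T(1,2) c0] unfolding T(3) A_def by (intro sum_mono) auto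
    also have "\<dots> = 2 ^ k * (gauss_moment4 TYPE('a) * (h / 2 ^ k)\<^sup>2 / c k ^ 4)" by simp
    also have "c k ^ 4 = (r ^ 4 / 10 ^ 4) * ((9/10) ^ 4) ^ k"
    proof -
      have "((9/10::real) ^ k) ^ 4 = ((9/10) ^ 4) ^ k" by (simp only: power_mult[symmetric] mult.commute)
      then show ?thesis unfolding c_def power_mult_distrib by (simp only: power_one_over) (simp add: power_one_over)
    qed
    also have "2 ^ k * (gauss_moment4 TYPE('a) * (h / 2 ^ k)\<^sup>2 / ((r ^ 4 / 10 ^ 4) * ((9/10) ^ 4) ^ k)) = (gauss_moment4 TYPE('a) * 10 ^ 4 * h\<^sup>2 / r ^ 4) * \<rho> ^ k"
    proof -
      have "(10000::real) ^ k = 2 ^ k * 5000 ^ k" by (simp flip: power_mult_distrib)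
      then show ?thesis using r by (simp add: \<rho>_def power_divide power2_eq_square power_mult[symmetric] field_simps)
    qed
    finally show ?thesis .
  qed
  have sub: "large_osc x h r \<subseteq> (\<Union>k. B k)"
  proof
    fix \<omega> assume \<omega>: "\<omega> \<in> large_osc x h r"
    show "\<omega> \<in> (\<Union>k. B k)"
    proof (rule ccontr)
      assume n: "\<omega> \<notin> (\<Union>k. B k)"
      have sp: "\<omega> \<in> space (P x)" using \<omega> by (simp add: large_osc_def)
      have step: "norm (W (T k (Suc i)) \<omega> - W (T k i) \<omega>) \<le> (1/10) * (9/10) ^ k * r" if "i < 2 ^ k" for k i
        using n that sp unfolding B_def A_def c_def by force
      obtain q where q: "q \<in> dyadic_times" "q \<le> 1" "r < norm (W (h * q) \<omega> - W 0 \<omega>)"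
        using \<omega> by (auto simp: large_osc_def past_increments_def)
      obtain i k where ik: "q = real i / 2 ^ k" using q by (auto simp: dyadic_times_def)
      have "real i \<le> real (2 ^ k)" using q(2) ik by simp
      then have i: "i \<le> 2 ^ k" by (simp only: of_nat_le_iff)
      have "norm (W (h * q) \<omega> - W 0 \<omega>) \<le> r * (1 - (9/10) ^ Suc k)"
        unfolding ik by (rule chaining_bound[of "\<lambda>t. W t \<omega>", OF step[unfolded T_def] _ i]) (use r in auto)
      also have "\<dots> \<le> r * 1" using r by (intro mult_left_mono) auto
      finally show False using q by simp
    qed
  qed
  have sumB: "summable (\<lambda>k. (gauss_moment4 TYPE('a) * 10 ^ 4 * h\<^sup>2 / r ^ 4) * \<rho> ^ k)"
    using \<rho> by (intro summable_mult summable_geometric) auto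
  have sumPB: "summable (\<lambda>k. prob x (B k))"
    using PB by (intro summable_comparison_test'[OF sumB, of 0]) auto
  have "prob x (large_osc x h r) \<le> prob x (\<Union>k. B k)"
    using sub by (intro finite_measure_mono) auto
  also have "\<dots> \<le> (\<Sum>k. prob x (B k))"
    using sumPB by (intro finite_measure_subadditive_countably) auto
  also have "\<dots> \<le> (\<Sum>k. (gauss_moment4 TYPE('a) * 10 ^ 4 * h\<^sup>2 / r ^ 4) * \<rho> ^ k)"
    by (rule suminf_le[OF PB sumPB sumB])
  also have "\<dots> = (gauss_moment4 TYPE('a) * 10 ^ 4 * h\<^sup>2 / r ^ 4) * (1 / (1 - \<rho>))"
    using \<rho> by (subst suminf_mult) (auto simp: suminf_geometric)
  also have "\<dots> = osc_const TYPE('a) * h\<^sup>2 / r ^ 4" by (simp add: osc_const_def \<rho>_def)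
  finally show ?thesis .
qed

definition exit_fun :: "real \<Rightarrow> ('a \<Rightarrow> real) \<Rightarrow> (real \<Rightarrow> 'a) \<Rightarrow> real" where
  "exit_fun lam f \<xi> = exit_value lam f (first_exit D \<xi>) (exit_pos D \<xi>)"

text \<open>The function v of the overview, defined at every starting point, boundary points
  included.\<close>

definition exit_mean :: "real \<Rightarrow> ('a \<Rightarrow> real) \<Rightarrow> 'a \<Rightarrow> real" where
  "exit_mean lam f = path_mean P W (exit_fun lam f)"

lemma exit_fun_measurable [measurable]:
  assumes [measurable]: "f \<in> borel_measurable borel"
  shows "exit_fun lam f \<in> borel_measurable path_space"
  unfolding exit_fun_def exit_value_def by measurable

lemma first_exit_nonneg: "0 \<le> first_exit D \<xi>"
  unfolding first_exit_def by (intro INF_greatest) auto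

lemma exit_fun_bound: "0 \<le> lam \<Longrightarrow> (\<And>y. \<bar>f y\<bar> \<le> C) \<Longrightarrow> \<bar>exit_fun lam f \<xi>\<bar> \<le> C"
  unfolding exit_fun_def by (rule exit_value_bound[OF _ first_exit_nonneg])

lemma exit_fun_path:
  "\<omega> \<in> space (P x) \<Longrightarrow> exit_fun lam f (restrict (\<lambda>q. W q \<omega>) dyadic_times) = exit_value lam f (exit_time W D \<omega>) (exit_point W D \<omega>)"
  unfolding exit_fun_def first_exit_eq[OF open_D W_continuous] exit_pos_eq[OF open_D W_continuous] exit_point_def exit_time_eq ..

lemma exit_time_measurable [measurable]: "exit_time W D \<in> borel_measurable (P x)"
proof -
  have "(\<lambda>\<omega>. first_exit D (restrict (\<lambda>q. W q \<omega>) dyadic_times)) \<in> borel_measurable (P x)"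
    by (rule measurable_compose[OF measurable_restrict first_exit_measurable]) (auto intro: W_measurable dyadic_times_nonneg)
  then show ?thesis
    by (rule measurable_cong[THEN iffD1, rotated]) (simp add: first_exit_eq[OF open_D W_continuous] exit_time_eq)
qed

lemma exit_point_measurable [measurable]: "exit_point W D \<in> borel_measurable (P x)"
proof -
  have "(\<lambda>\<omega>. exit_pos D (restrict (\<lambda>q. W q \<omega>) dyadic_times)) \<in> borel_measurable (P x)"
    by (rule measurable_compose[OF measurable_restrict exit_pos_measurable]) (auto intro: W_measurable dyadic_times_nonneg)
  then show ?thesis
    by (rule measurable_cong[THEN iffD1, rotated]) (simp add: exit_pos_eq[OF open_D W_continuous] exit_time_eq exit_point_def)
qed

lemma exit_mean_eq:
  assumes [measurable]: "f \<in> borel_measurable borel"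
  shows "exit_mean lam f x = (\<integral>\<omega>. exit_value lam f (exit_time W D \<omega>) (exit_point W D \<omega>) \<partial>P x)"
  unfolding exit_mean_def path_mean_eq[OF exit_fun_measurable[OF assms]]
  by (rule Bochner_Integration.integral_cong[OF refl]) (rule exit_fun_path)

lemma exit_mean_measurable [measurable]: "f \<in> borel_measurable borel \<Longrightarrow> exit_mean lam f \<in> borel_measurable borel"
  unfolding exit_mean_def by measurable

lemma exit_mean_bound: "f \<in> borel_measurable borel \<Longrightarrow> 0 \<le> lam \<Longrightarrow> (\<And>y. \<bar>f y\<bar> \<le> C) \<Longrightarrow> \<bar>exit_mean lam f x\<bar> \<le> C"
  unfolding exit_mean_def by (intro path_mean_bound exit_fun_measurable exit_fun_bound)

section \<open>Exit means are almost heat-invariant\<close>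

lemma exit_shift:
  assumes \<omega>: "\<omega> \<in> space (P x)" and h: "0 < h" and stay: "\<And>t. 0 < t \<Longrightarrow> t \<le> h \<Longrightarrow> W t \<omega> \<in> D"
  shows "exit_value lam f (exit_time W D \<omega>) (exit_point W D \<omega>) = exp (- lam * h) * exit_fun lam f (restrict (\<lambda>q. W (h + q) \<omega>) dyadic_times)"
proof -
  have h0: "0 \<le> h" using h by simp
  note c = W_continuous_shift[OF \<omega> h0]
  let ?e = "Inf (ereal ` {t. 0 < t \<and> W (h + t) \<omega> \<in> - D})"
  have e0: "0 \<le> ?e" by (rule Inf_exit_nonneg)
  have t: "exit_time W D \<omega> = ?e + ereal h"
    unfolding exit_time_eq by (rule Inf_exit_shift[OF stay h0])
  have F: "exit_fun lam f (restrict (\<lambda>q. W (h + q) \<omega>) dyadic_times) = exit_value lam f ?e (W (h + real_of_ereal ?e) \<omega>)"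
    unfolding exit_fun_def first_exit_eq[OF open_D c] exit_pos_eq[OF open_D c] ..
  show ?thesis
  proof (cases "?e = \<infinity>")
    case True then show ?thesis unfolding F t exit_value_def by simp
  next
    case False
    then have "real_of_ereal (?e + ereal h) = h + real_of_ereal ?e" using e0 by (cases ?e) auto
    then show ?thesis unfolding F exit_point_def t exit_value_shift[OF e0] by simp
  qed
qed

text \<open>By the Markov property the discounted average is the mean discounted exit value of the
  path restarted at time h. It agrees with the original exit value unless the path oscillates by
  more than r before h; on that event of probability O(h^2) they differ by at most 2 C.\<close>

lemma exit_mean_almost_invariant:
  assumes f [measurable]: "f \<in> borel_measurable borel" and fC: "\<And>y. \<bar>f y\<bar> \<le> C" and lam: "0 \<le> lam" and h: "0 < h" and r: "0 < r"
    and D: "cball x r \<subseteq> D"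
  shows "\<bar>exp (- lam * h) * smooth_avg (heat 1) h (exit_mean lam f) x - exit_mean lam f x\<bar> \<le> 2 * C * osc_const TYPE('a) / r ^ 4 * h\<^sup>2"
proof -
  have h0: "0 \<le> h" using h by simp
  let ?J = "\<lambda>\<omega>. exit_value lam f (exit_time W D \<omega>) (exit_point W D \<omega>)"
  let ?J' = "\<lambda>\<omega>. exit_fun lam f (restrict (\<lambda>q. W (h + q) \<omega>) dyadic_times)"
  have C0: "0 \<le> C" using fC[of 0] by simp
  have J [measurable]: "?J \<in> borel_measurable (P x)" unfolding exit_value_def by measurable
  have J' [measurable]: "?J' \<in> borel_measurable (P x)"
  proof (rule measurable_compose[OF measurable_restrict exit_fun_measurable[OF f]])
    show "W (h + q) \<in> borel_measurable (P x)" if "q \<in> dyadic_times" for q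
      using dyadic_times_nonneg[OF that] h0 by (intro W_measurable) simp
  qed
  have bJ: "\<bar>?J \<omega>\<bar> \<le> C" for \<omega> by (rule exit_value_bound[OF lam exit_time_nonneg fC])
  have bJ': "\<bar>exp (- lam * h) * ?J' \<omega>\<bar> \<le> C" for \<omega>
  proof -
    have "exp (- lam * h) \<le> 1" using lam h by simp
    then have "exp (- lam * h) * \<bar>?J' \<omega>\<bar> \<le> 1 * C" using exit_fun_bound[OF lam fC] by (intro mult_mono) auto
    then show ?thesis by (simp add: abs_mult)
  qed
  have iJ: "integrable (P x) ?J" by (rule integrable_const_bound[where B=C]) (use bJ in auto)
  have iJ': "integrable (P x) (\<lambda>\<omega>. exp (- lam * h) * ?J' \<omega>)" by (rule integrable_const_bound[where B=C]) (use bJ' in auto)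
  have "exp (- lam * h) * smooth_avg (heat 1) h (exit_mean lam f) x = expectation x (\<lambda>\<omega>. exp (- lam * h) * ?J' \<omega>)"
    unfolding exit_mean_def using markov[OF exit_fun_measurable[OF f] exit_fun_bound[OF lam fC] h, of x] by simp
  then have "\<bar>exp (- lam * h) * smooth_avg (heat 1) h (exit_mean lam f) x - exit_mean lam f x\<bar> = \<bar>expectation x (\<lambda>\<omega>. exp (- lam * h) * ?J' \<omega> - ?J \<omega>)\<bar>"
    using iJ iJ' by (simp add: exit_mean_eq)
  also have "\<dots> \<le> expectation x (\<lambda>\<omega>. \<bar>exp (- lam * h) * ?J' \<omega> - ?J \<omega>\<bar>)" by (rule integral_abs_bound)
  also have "\<dots> \<le> expectation x (\<lambda>\<omega>. 2 * C * indicator (large_osc x h r) \<omega>)"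
  proof (rule integral_mono_AE)
    show "AE \<omega> in P x. \<bar>exp (- lam * h) * ?J' \<omega> - ?J \<omega>\<bar> \<le> 2 * C * indicator (large_osc x h r) \<omega>"
      using W_start[of x] AE_space
    proof eventually_elim
      case (elim \<omega>)
      show ?case
      proof (cases "\<omega> \<in> large_osc x h r")
        case True
        then show ?thesis using bJ[of \<omega>] bJ'[of \<omega>] by (simp add: abs_le_iff)
      next
        case False
        have "W t \<omega> \<in> D" if "0 < t" "t \<le> h" for t
          using not_large_osc[OF elim(2) False h, of t] that elim(1) D by (auto simp: dist_norm norm_minus_commute subset_iff)
        then show ?thesis using False exit_shift[OF elim(2) h] by simp
      qed
    qed
  qed (use iJ iJ' large_osc_measurable[OF h0, of x r] in \<open>auto simp: integrable_indicator_iff emeasure_eq_measure\<close>)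
  also have "\<dots> = 2 * C * prob x (large_osc x h r)" using h0 by simp
  also have "\<dots> \<le> 2 * C * (osc_const TYPE('a) * h\<^sup>2 / r ^ 4)" using C0 by (intro mult_left_mono prob_large_osc h r) auto
  finally show ?thesis by simp
qed

lemma exit_mean_regular:
  assumes f [measurable]: "f \<in> borel_measurable borel" and fC: "\<And>y. \<bar>f y\<bar> \<le> C" and lam: "0 \<le> lam"
  shows "C2_on D (exit_mean lam f) \<and> (\<forall>x\<in>D. laplacian (exit_mean lam f) x = 2 * lam * exit_mean lam f x)"
proof (rule almost_heat_invariant_regular[of _ C], unfold_locales)
  show "exit_mean lam f \<in> borel_measurable borel" by measurable
  show "\<bar>exit_mean lam f y\<bar> \<le> C" for y by (rule exit_mean_bound[OF f lam fC])
  fix x0 assume "x0 \<in> D"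
  then obtain r where r: "0 < r" "cball x0 r \<subseteq> D" using open_D open_contains_cball by blast
  have "cball x (r/2) \<subseteq> D" if "x \<in> ball x0 (r/2)" for x
  proof -
    have "dist x0 y \<le> r" if "dist x y \<le> r/2" for y
      using dist_triangle[of x0 y x] that \<open>x \<in> ball x0 (r/2)\<close> by simp
    then show ?thesis using r(2) by (auto simp: subset_iff)
  qed
  then have "\<forall>x\<in>ball x0 (r/2). \<forall>h. 0 < h \<and> h \<le> 1 \<longrightarrow>
      \<bar>exp (- lam * h) * smooth_avg (heat 1) h (exit_mean lam f) x - exit_mean lam f x\<bar> \<le> 2 * C * osc_const TYPE('a) / (r/2) ^ 4 * h\<^sup>2"
    using exit_mean_almost_invariant[OF f fC lam, of _ "r/2"] r(1) by simp
  then show "\<exists>r>0. \<exists>K. \<forall>x\<in>ball x0 r. \<forall>h. 0 < h \<and> h \<le> 1 \<longrightarrow>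
      \<bar>exp (- lam * h) * smooth_avg (heat 1) h (exit_mean lam f) x - exit_mean lam f x\<bar> \<le> K * h\<^sup>2"
    using r(1) half_gt_zero[of r] by blast
qed (use lam open_D in auto)

end

section \<open>Boundary continuity\<close>

text \<open>Since the path starts in \<open>D\<close>, the set of exit times is closed, so its
  infimum T is attained and positive. At earlier times the path is in \<open>D\<close>, so its
  position at T is a limit of points of \<open>D\<close>.\<close>

lemma exit_hits_frontier:
  fixes w :: "real \<Rightarrow> 'a::euclidean_space"
  assumes D: "open D" and w: "continuous_on {0..} w" and w0: "w 0 \<in> D"
    and fin: "Inf (ereal ` {t. 0 < t \<and> w t \<in> - D}) < \<infinity>"
  obtains T where "0 < T" "Inf (ereal ` {t. 0 < t \<and> w t \<in> - D}) = ereal T" "w T \<in> frontier D"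
proof -
  let ?A = "{t. 0 < t \<and> w t \<in> - D}"
  have "?A = {0..} \<inter> w -` (- D)" using w0 by (auto simp: less_le)
  moreover have "closed ({0..} \<inter> w -` (- D))"
    by (rule continuous_closed_preimage[OF w closed_atLeast]) (use D in \<open>simp add: closed_Compl\<close>)
  ultimately have cl: "closed ?A" by simp
  have ne: "?A \<noteq> {}"
  proof
    assume "?A = {}"
    then show False using fin by (simp only: image_empty Inf_empty top_ereal_def less_irrefl)
  qed
  have bd: "bdd_below ?A" by (rule bdd_belowI[of _ 0]) auto
  define T where "T = Inf ?A"
  have T: "T \<in> ?A" unfolding T_def by (rule closed_contains_Inf[OF ne bd cl])
  have low: "T \<le> t" if "t \<in> ?A" for t unfolding T_def by (rule cInf_lower[OF that bd])
  have "Inf (ereal ` ?A) = ereal T"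
    by (rule antisym) (use T low in \<open>auto intro!: Inf_lower Inf_greatest\<close>)
  moreover have "w T \<in> closure D"
  proof -
    define s where "s n = T * (1 - 1 / real (Suc (Suc n)))" for n
    have s: "0 \<le> s n" "s n < T" for n using T by (auto simp: s_def field_simps)
    have "w (s n) \<in> D" for n
    proof (cases "s n = 0")
      case False
      then show ?thesis using s[of n] low[of "s n"] by force
    qed (use w0 in simp)
    moreover have "s \<longlonglongrightarrow> T * (1 - 0)" unfolding s_def
      by (intro tendsto_intros LIMSEQ_Suc lim_1_over_n[THEN LIMSEQ_Suc, simplified])
    then have "(\<lambda>n. w (s n)) \<longlonglongrightarrow> w T"
      by (intro continuous_on_tendsto_compose[OF w]) (use T s in auto)
    ultimately show ?thesis unfolding closure_sequential by (intro exI[of _ "\<lambda>n. w (s n)"]) simp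
  qed
  ultimately show ?thesis using that[of T] T D by (auto simp: frontier_def interior_open)
qed

context brownian_domain
begin

lemma exit_frontier:
  assumes "\<omega> \<in> space (P x)" "W 0 \<omega> \<in> D" "exit_time W D \<omega> < \<infinity>"
  obtains T where "0 < T" "exit_time W D \<omega> = ereal T" "exit_point W D \<omega> = W T \<omega>" "W T \<omega> \<in> frontier D"
proof -
  obtain T where "0 < T" "exit_time W D \<omega> = ereal T" "W T \<omega> \<in> frontier D"
    using exit_hits_frontier[OF open_D W_continuous[OF assms(1)] assms(2) assms(3)[unfolded exit_time_eq]]
    unfolding exit_time_eq by metis
  then show ?thesis using that by (simp add: exit_point_def)
qed

definition stay :: "'a \<Rightarrow> real \<Rightarrow> real \<Rightarrow> 'w set" where
  "stay x s t = {\<omega>\<in>space (P x). \<forall>r\<in>{s..t}. W r \<omega> \<in> D}"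

lemma stay_eq:
  assumes "s \<in> dyadic_times" "t \<in> dyadic_times" "s \<le> t"
  shows "stay x s t = {\<omega>\<in>space (P x). \<not> visits D (restrict (\<lambda>q. W q \<omega>) dyadic_times) s t}"
  unfolding stay_def using visits_iff[OF open_D W_continuous assms] by blast

lemma stay_measurable [measurable]:
  assumes "s \<in> dyadic_times" "t \<in> dyadic_times" "s \<le> t"
  shows "stay x s t \<in> sets (P x)"
proof -
  have "(\<lambda>\<omega>. restrict (\<lambda>q. W q \<omega>) dyadic_times) \<in> P x \<rightarrow>\<^sub>M path_space"
    by (rule measurable_restrict) (auto intro: W_measurable dyadic_times_nonneg)
  then have "Measurable.pred (P x) (\<lambda>\<omega>. visits D (restrict (\<lambda>q. W q \<omega>) dyadic_times) s t)"
    by (rule measurable_compose[OF _ visits_measurable])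
  then show ?thesis unfolding stay_eq[OF assms] by measurable
qed

text \<open>By the Markov property at s the probability is a Gaussian average of a bounded
  measurable function, which is continuous however rough that function is. This smoothing is why the
  interval starts at s > 0.\<close>

lemma prob_stay_continuous:
  assumes s: "s \<in> dyadic_times" "0 < s" and t: "t \<in> dyadic_times"
  obtains g where "continuous_on UNIV g" "\<And>x. prob x (stay x s (s + t)) = g x"
proof -
  let ?F = "\<lambda>\<xi>. if visits D \<xi> 0 t then 0 else 1 :: real"
  have F [measurable]: "?F \<in> borel_measurable path_space" by measurable
  have bF: "\<bar>?F \<xi>\<bar> \<le> 1" for \<xi> by simp
  have t0: "0 \<le> t" using t by (rule dyadic_times_nonneg)
  have "prob x (stay x s (s + t)) = smooth_avg (heat 1) s (path_mean P W ?F) x" for x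
  proof -
    have eq: "?F (restrict (\<lambda>q. W (s + q) \<omega>) dyadic_times) = indicator (stay x s (s + t)) \<omega>" if "\<omega> \<in> space (P x)" for \<omega>
    proof -
      have "(\<exists>r\<in>{0..t}. W (s + r) \<omega> \<notin> D) \<longleftrightarrow> (\<exists>r\<in>{s..s+t}. W r \<omega> \<notin> D)"
      proof
        assume "\<exists>r\<in>{s..s+t}. W r \<omega> \<notin> D"
        then obtain r where "r \<in> {s..s+t}" "W r \<omega> \<notin> D" by blast
        then show "\<exists>r\<in>{0..t}. W (s + r) \<omega> \<notin> D" by (intro bexI[of _ "r - s"]) auto
      qed auto
      then show ?thesis
        using visits_iff[OF open_D W_continuous_shift[OF that, of s] zero_dyadic_times t t0] s(2) that
        by (auto simp: stay_def indicator_def)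
    qed
    have m: "stay x s (s + t) \<in> sets (P x)"
    proof -
      have [measurable]: "(\<lambda>\<omega>. ?F (restrict (\<lambda>q. W (s + q) \<omega>) dyadic_times)) \<in> borel_measurable (P x)"
      proof (rule measurable_compose[OF measurable_restrict F])
        show "W (s + q) \<in> borel_measurable (P x)" if "q \<in> dyadic_times" for q
          using dyadic_times_nonneg[OF that] s by (intro W_measurable) simp
      qed
      have "{\<omega>\<in>space (P x). ?F (restrict (\<lambda>q. W (s + q) \<omega>) dyadic_times) = 1} \<in> sets (P x)" by measurable
      moreover have "{\<omega>\<in>space (P x). ?F (restrict (\<lambda>q. W (s + q) \<omega>) dyadic_times) = 1} = stay x s (s + t)"
      proof -
        have "?F (restrict (\<lambda>q. W (s + q) \<omega>) dyadic_times) = 1 \<longleftrightarrow> \<omega> \<in> stay x s (s + t)" if "\<omega> \<in> space (P x)" for \<omega>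
          unfolding eq[OF that] by (simp add: indicator_def)
        moreover have "stay x s (s + t) \<subseteq> space (P x)" by (auto simp: stay_def)
        ultimately show ?thesis by blast
      qed
      ultimately show ?thesis by simp
    qed
    have "prob x (stay x s (s + t)) = expectation x (\<lambda>\<omega>. ?F (restrict (\<lambda>q. W (s + q) \<omega>) dyadic_times))"
      using eq m by (simp cong: Bochner_Integration.integral_cong)
    then show ?thesis using markov[OF F bF s(2)] by simp
  qed
  moreover have "continuous_on UNIV (smooth_avg (heat 1) s (path_mean P W ?F))"
    by (rule continuous_smooth_avg[OF gauss_dom_gauss path_mean_measurable[OF F] path_mean_bound[OF F bF] s(2)])
  ultimately show ?thesis using that by blast
qed

lemma exit_mean_frontier:
  assumes f [measurable]: "f \<in> borel_measurable borel"
    and reg: "prob x {\<omega>\<in>space (P x). exit_time W D \<omega> = 0} = 1"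
  shows "exit_mean lam f x = f x"
proof -
  have "AE \<omega> in P x. exit_time W D \<omega> = 0" using reg by (subst (asm) prob_Collect_eq_1) auto
  then have "AE \<omega> in P x. exit_value lam f (exit_time W D \<omega>) (exit_point W D \<omega>) = f x"
    using W_start[of x] by eventually_elim (simp add: exit_value_def exit_point_def)
  then have "exit_mean lam f x = expectation x (\<lambda>\<omega>. f x)"
    unfolding exit_mean_eq[OF f] by (intro integral_cong_AE) (auto simp: exit_value_def)
  then show ?thesis by (simp add: prob_space)
qed

text \<open>As s decreases to 0, the events of staying in \<open>D\<close> during [s, t] decrease to
  one that is null at the regular point y. An s with small probability at y is fixed, and
  \<open>prob_stay_continuous\<close> carries the bound to nearby poles.\<close>

lemma exit_time_small_near_regular:
  assumes reg: "prob y {\<omega>\<in>space (P y). exit_time W D \<omega> = 0} = 1" and e: "0 < e"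
  shows "\<exists>d>0. \<exists>n. \<forall>x. dist x y < d \<longrightarrow> prob x (stay x ((1/2) ^ (m + Suc n)) ((1/2) ^ m)) < e"
proof -
  let ?t = "(1/2::real) ^ m" and ?s = "\<lambda>n. (1/2::real) ^ (m + Suc n)"
  have dy: "(1/2::real) ^ k \<in> dyadic_times" for k using dyadic_timesI[of 1 k] by (simp add: power_one_over)
  have le: "?s n \<le> ?t" for n by (rule power_decreasing) auto
  have stm: "stay y (?s n) ?t \<in> sets (P y)" for n using stay_measurable[OF dy dy le] .
  have "AE \<omega> in P y. exit_time W D \<omega> = 0" using reg by (subst (asm) prob_Collect_eq_1) auto
  then have ae: "AE \<omega> in P y. \<omega> \<notin> (\<Inter>n. stay y (?s n) ?t)"
  proof eventually_elim
    case (elim \<omega>)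
    have "Inf (ereal ` {t. 0 < t \<and> W t \<omega> \<in> - D}) < ereal ?t" using elim by (simp add: exit_time_eq)
    then obtain r where r: "0 < r" "r < ?t" "W r \<omega> \<notin> D" by (auto simp: Inf_less_iff)
    obtain n where "(1/2::real) ^ n < r" using real_arch_pow_inv[OF r(1), of "1/2"] by auto
    moreover have "?s n \<le> (1/2) ^ n" by (rule power_decreasing) auto
    ultimately have "r \<in> {?s n..?t}" using r by simp
    then have "\<omega> \<notin> stay y (?s n) ?t" using r(3) by (auto simp: stay_def)
    then show ?case by blast
  qed
  have Im: "(\<Inter>n. stay y (?s n) ?t) \<in> sets (P y)" using stm by auto
  have "prob y (\<Inter>n. stay y (?s n) ?t) = 0"
    using ae Im by (subst prob_eq_0) auto
  moreover have "(\<lambda>n. prob y (stay y (?s n) ?t)) \<longlonglongrightarrow> prob y (\<Inter>n. stay y (?s n) ?t)"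
  proof (rule finite_Lim_measure_decseq)
    show "decseq (\<lambda>n. stay y (?s n) ?t)"
    proof (rule decseq_SucI)
      fix n
      have "?s (Suc n) \<le> ?s n" by (rule power_decreasing) auto
      then show "stay y (?s (Suc n)) ?t \<subseteq> stay y (?s n) ?t"
        unfolding stay_def atLeastAtMost_iff Ball_def by (blast intro: order_trans)
    qed
  qed (use stm in auto)
  ultimately have "\<forall>\<^sub>F n in sequentially. prob y (stay y (?s n) ?t) < e" using e by (intro order_tendstoD(2)) auto
  then obtain n where n: "prob y (stay y (?s n) ?t) < e" by (auto simp: eventually_sequentially)
  have df: "?t - ?s n \<in> dyadic_times"
  proof -
    have "?t - ?s n = real (2 ^ Suc n - 1) / 2 ^ (m + Suc n)"
      by (simp add: of_nat_diff power_add power_one_over field_simps)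
    then show ?thesis by (simp only: dyadic_timesI)
  qed
  obtain g where g: "continuous_on UNIV g" "\<And>x. prob x (stay x (?s n) (?s n + (?t - ?s n))) = g x"
    using prob_stay_continuous[OF dy _ df, of "m + Suc n"] by auto
  then have g2: "prob x (stay x (?s n) ?t) = g x" for x by simp
  have "isCont g y" using g(1) by (simp add: continuous_on_eq_continuous_at)
  then have "\<forall>\<^sub>F x in nhds y. g x < e"
    using n unfolding g2 isCont_def tendsto_at_iff_tendsto_nhds by (intro order_tendstoD(2))
  then show ?thesis unfolding eventually_nhds_metric g2[symmetric] by blast
qed

text \<open>From a start close to y the path probably leaves \<open>D\<close> before a short time t
  and has moved little by then, so it exits near y with a discount close to 1.\<close>

lemma exit_mean_tendsto:
  assumes f [measurable]: "f \<in> borel_measurable borel" and fC: "\<And>y. \<bar>f y\<bar> \<le> C" and lam: "0 \<le> lam"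
    and cont: "continuous_on (frontier D) f" and y: "y \<in> frontier D"
    and reg: "prob y {\<omega>\<in>space (P y). exit_time W D \<omega> = 0} = 1" and e: "0 < e"
  shows "\<exists>d>0. \<forall>x\<in>D. dist x y < d \<longrightarrow> \<bar>exit_mean lam f x - f y\<bar> \<le> e"
proof -
  have C0: "0 \<le> C" using fC[of 0] by simp
  obtain \<eta> where \<eta>: "0 < \<eta>" "\<And>z. z \<in> frontier D \<Longrightarrow> dist z y < \<eta> \<Longrightarrow> \<bar>f z - f y\<bar> < e / 4"
    using cont y e unfolding continuous_on_iff dist_real_def by (metis zero_less_divide_iff zero_less_numeral)
  \<comment> \<open>Two exceptional events of probability at most e' contribute at most 4 C e' \<le>
    e/2, and C + 1 avoids division by 0. The other half of e is shared by the variation of f near y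
    and the discount.\<close>
  define e' where "e' = e / (8 * (C + 1))"
  have e': "0 < e'" using e C0 by (simp add: e'_def)
  have h0: "(\<lambda>m. (1/2::real) ^ m) \<longlonglongrightarrow> 0" by (rule LIMSEQ_realpow_zero) auto
  have "(\<lambda>m. C * lam * (1/2) ^ m) \<longlonglongrightarrow> 0" using tendsto_mult_right_zero[OF h0] .
  then have ev1: "\<forall>\<^sub>F m in sequentially. C * lam * (1/2) ^ m < e / 4" using e by (intro order_tendstoD(2)) auto
  have "(\<lambda>m. osc_const TYPE('a) * ((1/2) ^ m)\<^sup>2 / (\<eta>/2) ^ 4) \<longlonglongrightarrow> osc_const TYPE('a) * 0\<^sup>2 / (\<eta>/2) ^ 4"
    using \<eta>(1) by (intro tendsto_intros h0) auto
  then have ev2: "\<forall>\<^sub>F m in sequentially. osc_const TYPE('a) * ((1/2) ^ m)\<^sup>2 / (\<eta>/2) ^ 4 < e'" using e' by (intro order_tendstoD(2)) auto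
  obtain m where m: "C * lam * (1/2) ^ m < e / 4" "osc_const TYPE('a) * ((1/2) ^ m)\<^sup>2 / (\<eta>/2) ^ 4 < e'"
    using eventually_conj[OF ev1 ev2] by (auto simp: eventually_sequentially)
  define t where "t = (1/2::real) ^ m"
  have t: "0 < t" by (simp add: t_def)
  obtain d n where d: "0 < d" "\<And>x. dist x y < d \<Longrightarrow> prob x (stay x ((1/2) ^ (m + Suc n)) t) < e'"
    using exit_time_small_near_regular[OF reg e', of m] unfolding t_def by blast
  let ?s = "(1/2::real) ^ (m + Suc n)"
  have s: "0 < ?s" "?s \<le> t" unfolding t_def by (simp, rule power_decreasing) auto
  have dy: "(1/2::real) ^ k \<in> dyadic_times" for k using dyadic_timesI[of 1 k] by (simp add: power_one_over)
  have st [measurable]: "stay x ?s t \<in> sets (P x)" for x 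
    unfolding t_def by (rule stay_measurable[OF dy dy s(2)[unfolded t_def]])
  have os [measurable]: "large_osc x t (\<eta>/2) \<in> sets (P x)" for x using t by simp
  show ?thesis
  proof (intro exI[of _ "min d (\<eta>/2)"] conjI ballI impI)
    show "0 < min d (\<eta>/2)" using d \<eta> by simp
    fix x assume x: "x \<in> D" and xy: "dist x y < min d (\<eta>/2)"
    let ?J = "\<lambda>\<omega>. exit_value lam f (exit_time W D \<omega>) (exit_point W D \<omega>)"
    have J [measurable]: "?J \<in> borel_measurable (P x)" unfolding exit_value_def by measurable
    have bJ: "\<bar>?J \<omega>\<bar> \<le> C" for \<omega> by (rule exit_value_bound[OF lam exit_time_nonneg fC])
    have iJ: "integrable (P x) ?J" by (rule integrable_const_bound[where B=C]) (use bJ in auto)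
    have ind: "integrable (P x) (indicator (stay x ?s t) :: 'w \<Rightarrow> real)" "integrable (P x) (indicator (large_osc x t (\<eta>/2)) :: 'w \<Rightarrow> real)"
      using st[of x] os[of x] by (simp_all only: integrable_indicator_iff emeasure_eq_measure) auto
    have "\<bar>exit_mean lam f x - f y\<bar> = \<bar>expectation x (\<lambda>\<omega>. ?J \<omega> - f y)\<bar>"
      using iJ by (simp add: exit_mean_eq prob_space)
    also have "\<dots> \<le> expectation x (\<lambda>\<omega>. \<bar>?J \<omega> - f y\<bar>)" by (rule integral_abs_bound)
    also have "\<dots> \<le> expectation x (\<lambda>\<omega>. e / 2 + 2 * C * indicator (stay x ?s t) \<omega> + 2 * C * indicator (large_osc x t (\<eta>/2)) \<omega>)"
    proof (rule integral_mono_AE)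
      show "AE \<omega> in P x. \<bar>?J \<omega> - f y\<bar> \<le> e / 2 + 2 * C * indicator (stay x ?s t) \<omega> + 2 * C * indicator (large_osc x t (\<eta>/2)) \<omega>"
        using W_start[of x] AE_space
      proof eventually_elim
        case (elim \<omega>)
        have crude: "\<bar>?J \<omega> - f y\<bar> \<le> 2 * C" using bJ[of \<omega>] fC[of y] by (simp add: abs_le_iff)
        show ?case
        proof (cases "\<omega> \<in> stay x ?s t \<or> \<omega> \<in> large_osc x t (\<eta>/2)")
          case True
          then show ?thesis using crude e C0 by (auto simp: indicator_def)
        next
          case False
          then obtain r where r: "?s \<le> r" "r \<le> t" "W r \<omega> \<notin> D" using elim by (auto simp: stay_def)
          then have "exit_time W D \<omega> \<le> ereal r" 
            unfolding exit_time_eq using less_le_trans[OF s(1) r(1)] by (intro Inf_lower imageI) simp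
          then have fin: "exit_time W D \<omega> < \<infinity>" and le: "exit_time W D \<omega> \<le> ereal t" using r(2) by (auto intro: order_trans le_less_trans)
          obtain T where T: "0 < T" "exit_time W D \<omega> = ereal T" "exit_point W D \<omega> = W T \<omega>" "W T \<omega> \<in> frontier D"
            using exit_frontier[OF elim(2) _ fin] elim(1) x by auto
          have "norm (W T \<omega> - W 0 \<omega>) \<le> \<eta>/2" using False T le by (intro not_large_osc[OF elim(2) _ t]) auto
          then have "dist (W T \<omega>) y < \<eta>" using elim(1) xy dist_triangle[of "W T \<omega>" y x] by (simp add: dist_norm)
          then have 1: "\<bar>f (W T \<omega>) - f y\<bar> < e / 4" using \<eta>(2) T by blast
          have "1 - lam * t \<le> 1 - lam * T" using lam le T by (auto intro!: mult_left_mono)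
          also have "\<dots> \<le> exp (- lam * T)" using exp_ge_add_one_self[of "- lam * T"] by simp
          finally have "1 - exp (- lam * T) \<le> lam * t" by simp
          moreover have "exp (- lam * T) \<le> 1" using lam T by simp
          ultimately have "\<bar>exp (- lam * T) - 1\<bar> * \<bar>f (W T \<omega>)\<bar> \<le> (lam * t) * C" using fC lam t by (intro mult_mono) auto
          moreover have "exp (- lam * T) * f (W T \<omega>) - f (W T \<omega>) = (exp (- lam * T) - 1) * f (W T \<omega>)"
            by (simp add: left_diff_distrib)
          ultimately have 2: "\<bar>exp (- lam * T) * f (W T \<omega>) - f (W T \<omega>)\<bar> \<le> C * lam * t"
            by (simp only: abs_mult) (simp add: mult_ac)
          have "?J \<omega> = exp (- lam * T) * f (W T \<omega>)" using T by (simp add: exit_value_def)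
          then have "\<bar>?J \<omega> - f y\<bar> \<le> e / 2" using 1 2 m(1) unfolding t_def by linarith
          then show ?thesis using False by simp
        qed
      qed
    qed (use iJ ind in auto)
    also have "\<dots> = e / 2 + 2 * C * prob x (stay x ?s t) + 2 * C * prob x (large_osc x t (\<eta>/2))"
      using ind sets.Int_space_eq2[OF st[of x]] sets.Int_space_eq2[OF os[of x]] by (simp add: prob_space)
    also have "\<dots> \<le> e / 2 + 2 * C * e' + 2 * C * e'"
    proof -
      have "prob x (stay x ?s t) \<le> e'" using d(2)[of x] xy by simp
      moreover have "prob x (large_osc x t (\<eta>/2)) \<le> e'"
        using prob_large_osc[OF t, of "\<eta>/2" x] \<eta>(1) m(2) unfolding t_def by simp
      ultimately show ?thesis using C0 by (intro add_mono mult_left_mono) auto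
    qed
    also have "\<dots> \<le> e"
    proof -
      have "4 * C * e' \<le> 4 * (C + 1) * e'" using e' by (intro mult_right_mono) auto
      also have "\<dots> = e / 2" using C0 by (simp add: e'_def field_simps)
      finally show ?thesis by simp
    qed
    finally show "\<bar>exit_mean lam f x - f y\<bar> \<le> e" .
  qed
qed

lemma exit_mean_continuous:
  assumes f [measurable]: "f \<in> borel_measurable borel" and fC: "\<And>y. \<bar>f y\<bar> \<le> C" and lam: "0 \<le> lam"
    and cont: "continuous_on (frontier D) f"
    and reg: "\<And>y. y \<in> frontier D \<Longrightarrow> prob y {\<omega>\<in>space (P y). exit_time W D \<omega> = 0} = 1"
  shows "continuous_on (closure D) (exit_mean lam f)"
  unfolding continuous_on_iff
proof (intro ballI allI impI)
  fix y and e :: real assume y: "y \<in> closure D" and e: "0 < e"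
  show "\<exists>d>0. \<forall>x\<in>closure D. dist x y < d \<longrightarrow> dist (exit_mean lam f x) (exit_mean lam f y) < e"
  proof (cases "y \<in> D")
    case True
    have "continuous_on D (exit_mean lam f)"
      using exit_mean_regular[OF f fC lam] by (simp add: C2_on_def C1_on_def)
    then obtain d where d: "0 < d" "\<And>x. x \<in> D \<Longrightarrow> dist x y < d \<Longrightarrow> dist (exit_mean lam f x) (exit_mean lam f y) < e"
      using True e unfolding continuous_on_iff by blast
    obtain r where r: "0 < r" "ball y r \<subseteq> D" using open_D True open_contains_ball by blast
    show ?thesis
      by (intro exI[of _ "min d r"]) (use d r in \<open>auto simp: subset_iff dist_commute\<close>)
  next
    case False
    then have yf: "y \<in> frontier D" using y open_D by (simp add: frontier_def interior_open)
    have vy: "exit_mean lam f x = f x" if "x \<in> frontier D" for x using exit_mean_frontier[OF f reg[OF that]] .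
    obtain d1 where d1: "0 < d1" "\<And>x. x \<in> D \<Longrightarrow> dist x y < d1 \<Longrightarrow> \<bar>exit_mean lam f x - f y\<bar> \<le> e/2"
      using exit_mean_tendsto[OF f fC lam cont yf reg[OF yf], of "e/2"] e by auto
    obtain d2 where d2: "0 < d2" "\<And>x. x \<in> frontier D \<Longrightarrow> dist x y < d2 \<Longrightarrow> dist (f x) (f y) < e"
      using cont yf e unfolding continuous_on_iff by blast
    show ?thesis
    proof (intro exI[of _ "min d1 d2"] conjI ballI impI)
      fix x assume x: "x \<in> closure D" "dist x y < min d1 d2"
      show "dist (exit_mean lam f x) (exit_mean lam f y) < e"
      proof (cases "x \<in> D")
        case True
        then have "\<bar>exit_mean lam f x - f y\<bar> \<le> e/2" using d1(2) x by simp
        then show ?thesis using vy[OF yf] e by (simp add: dist_real_def)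
      next
        case False
        then have xf: "x \<in> frontier D" using x open_D by (simp add: frontier_def interior_open)
        then show ?thesis using vy yf d2(2)[OF xf] x by simp
      qed
    qed (use d1 d2 in auto)
  qed
qed

end

section \<open>Comparison principle\<close>

text \<open>At the maximum the first derivative vanishes; a positive second derivative makes it
  positive just to the right, so larger values occur there.\<close>

lemma no_strict_convex_max:
  fixes \<phi> \<phi>' :: "real \<Rightarrow> real"
  assumes d: "0 < d" and der: "\<And>t. \<bar>t\<bar> < d \<Longrightarrow> (\<phi> has_real_derivative \<phi>' t) (at t)"
    and der2: "(\<phi>' has_real_derivative l) (at 0)" and l: "0 < l"
    and max: "\<And>t. \<bar>t\<bar> < d \<Longrightarrow> \<phi> t \<le> \<phi> 0"
  shows False
proof -
  have "\<phi>' 0 = 0" by (rule DERIV_local_max[OF der d]) (use d max in auto)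
  then obtain e where e: "0 < e" "\<And>h. 0 < h \<Longrightarrow> h < e \<Longrightarrow> 0 < \<phi>' h"
    using DERIV_pos_inc_right[OF der2 l] by auto
  define h where "h = min d e / 2"
  have h: "0 < h" "h < d" "h < e" using d e by (auto simp: h_def)
  obtain z where z: "0 < z" "z < h" "\<phi> h - \<phi> 0 = (h - 0) * \<phi>' z"
    using MVT2[of 0 h \<phi> \<phi>'] der h by auto
  then have "\<phi> 0 < \<phi> h" using e(2)[of z] h by (simp add: algebra_simps)
  then show False using max[of h] h by simp
qed

text \<open>A \<open>\<mu>\<close>-panharmonic barrier tending to infinity, which makes up for the possible unboundedness of \<open>D\<close>.\<close>

definition cosh_sum :: "real \<Rightarrow> 'a::euclidean_space \<Rightarrow> real" where
  "cosh_sum \<mu> x = (\<Sum>b\<in>Basis. cosh (\<mu> * (x \<bullet> b)))"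

lemma cosh_ge_abs: "\<bar>y\<bar> \<le> cosh (y::real)"
proof -
  have "\<bar>y\<bar> \<le> exp \<bar>y\<bar> / 2"
    using exp_lower_Taylor_quadratic[of "\<bar>y\<bar>"] zero_le_power2[of "\<bar>y\<bar> - 1"] by (simp add: power2_eq_square algebra_simps)
  also have "\<dots> \<le> cosh \<bar>y\<bar>" by (simp add: cosh_field_def)
  finally have "\<bar>y\<bar> \<le> cosh \<bar>y\<bar>" .
  then show ?thesis by simp
qed

lemma cosh_sum_lower: "\<mu> * norm x \<le> cosh_sum \<mu> x" if "0 \<le> \<mu>" for x :: "'a::euclidean_space"
proof -
  have "\<mu> * norm x \<le> \<mu> * (\<Sum>b\<in>Basis. \<bar>x \<bullet> b\<bar>)" using that by (intro mult_left_mono norm_le_l1) auto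
  also have "\<dots> = (\<Sum>b\<in>Basis. \<bar>\<mu> * (x \<bullet> b)\<bar>)" using that by (simp add: sum_distrib_left abs_mult)
  also have "\<dots> \<le> cosh_sum \<mu> x" unfolding cosh_sum_def by (intro sum_mono cosh_ge_abs)
  finally show ?thesis .
qed

lemma cosh_sum_pos: "0 < cosh_sum \<mu> x"
  unfolding cosh_sum_def by (intro sum_pos) auto

lemma has_real_derivative_cosh_sum:
  assumes "b \<in> Basis"
  shows "((\<lambda>t. cosh_sum \<mu> (z + t *\<^sub>R b)) has_real_derivative \<mu> * sinh (\<mu> * ((z + t *\<^sub>R b) \<bullet> b))) (at t)"
proof -
  have "((\<lambda>t. \<Sum>c\<in>Basis. cosh (\<mu> * ((z + t *\<^sub>R b) \<bullet> c))) has_real_derivative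
      (\<Sum>c\<in>Basis. \<mu> * (b \<bullet> c) * sinh (\<mu> * ((z + t *\<^sub>R b) \<bullet> c)))) (at t)"
    unfolding inner_add_left inner_scaleR_left
    by (rule DERIV_sum) (auto intro!: derivative_eq_intros)
  also have "(\<Sum>c\<in>Basis. \<mu> * (b \<bullet> c) * sinh (\<mu> * ((z + t *\<^sub>R b) \<bullet> c))) = (\<Sum>c\<in>Basis. if c = b then \<mu> * sinh (\<mu> * ((z + t *\<^sub>R b) \<bullet> b)) else 0)"
    using assms by (intro sum.cong) (auto simp: inner_Basis)
  also have "\<dots> = \<mu> * sinh (\<mu> * ((z + t *\<^sub>R b) \<bullet> b))" using assms by simp
  finally show ?thesis unfolding cosh_sum_def .
qed

lemma C1_on_line_derivative:
  assumes "C1_on D u" "b \<in> Basis" "z + t *\<^sub>R b \<in> D"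
  shows "((\<lambda>s. u (z + s *\<^sub>R b)) has_real_derivative partial b u (z + t *\<^sub>R b)) (at t)"
proof -
  have "(\<lambda>s. u ((z + t *\<^sub>R b) + s *\<^sub>R b)) differentiable (at 0)" using assms by (auto simp: C1_on_def)
  then have "((\<lambda>s. u ((z + t *\<^sub>R b) + s *\<^sub>R b)) has_real_derivative partial b u (z + t *\<^sub>R b)) (at 0)"
    unfolding partial_def by (simp add: DERIV_deriv_iff_real_differentiable)
  then show ?thesis unfolding DERIV_def by (simp add: algebra_simps)
qed

text \<open>If u exceeds v at x, subtract a small multiple of the barrier. The difference g is
  positive at x, negative on the frontier and nonpositive far away, so it has a positive maximum
  inside \<open>D\<close>. There its Laplacian is \<mu>^2 g > 0, hence some second partial
  derivative is positive.\<close>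

lemma panharmonic_comparison:
  fixes u v :: "'a::euclidean_space \<Rightarrow> real"
  assumes D: "open D" and \<mu>: "0 < \<mu>" and pu: "panharmonic_on \<mu> D u" and pv: "panharmonic_on \<mu> D v"
    and cu: "continuous_on (closure D) u" and cv: "continuous_on (closure D) v"
    and bu: "\<And>x. x \<in> closure D \<Longrightarrow> \<bar>u x\<bar> \<le> C" and bv: "\<And>x. x \<in> closure D \<Longrightarrow> \<bar>v x\<bar> \<le> C"
    and le: "\<And>x. x \<in> frontier D \<Longrightarrow> u x \<le> v x" and x: "x \<in> D"
  shows "u x \<le> v x"
proof (rule ccontr)
  assume "\<not> u x \<le> v x"
  then have pos: "0 < u x - v x" by simp
  \<comment> \<open>Chosen so that exactly half of the excess remains: g x = (u x - v x) /
    2.\<close>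
  define e where "e = (u x - v x) / (2 * cosh_sum \<mu> x)"
  have e: "0 < e" using pos cosh_sum_pos[of \<mu> x] by (simp add: e_def)
  define g where "g y = u y - v y - e * cosh_sum \<mu> y" for y
  have gx: "0 < g x" using pos cosh_sum_pos[of \<mu> x] by (simp add: g_def e_def)
  \<comment> \<open>From this radius on, the subtracted barrier, which is at least e \<mu> |y|,
    outweighs u - v \<le> 2 C.\<close>
  define R where "R = 2 * C / (e * \<mu>)"
  have far: "g y \<le> 0" if "y \<in> closure D" "R \<le> norm y" for y
  proof -
    have "2 * C \<le> e * (\<mu> * norm y)" using that(2) e \<mu> by (simp add: R_def field_simps)
    also have "\<dots> \<le> e * cosh_sum \<mu> y" using e \<mu> by (intro mult_left_mono cosh_sum_lower) auto
    finally show ?thesis using bu[OF that(1)] bv[OF that(1)] by (simp add: g_def abs_le_iff)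
  qed
  have xc: "x \<in> closure D" using x closure_subset by blast
  have "compact (closure D \<inter> cball 0 R)" by (intro closed_Int_compact) auto
  moreover have "x \<in> closure D \<inter> cball 0 R" using far[OF xc] gx xc by force
  moreover have "continuous_on (closure D \<inter> cball 0 R) g"
    unfolding g_def cosh_sum_def by (intro continuous_intros continuous_on_subset[OF cu] continuous_on_subset[OF cv]) auto
  ultimately obtain z where z: "z \<in> closure D" "\<And>y. y \<in> closure D \<inter> cball 0 R \<Longrightarrow> g y \<le> g z"
    using continuous_attains_sup[of "closure D \<inter> cball 0 R" g] by blast
  have gz: "0 < g z" using z(2)[of x] gx \<open>x \<in> closure D \<inter> cball 0 R\<close> by simp
  have zmax: "g y \<le> g z" if "y \<in> closure D" for y
  proof (cases "norm y \<le> R")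
    case True then show ?thesis using z(2)[of y] that by simp
  next
    case False then show ?thesis using far[OF that] gz by simp
  qed
  have "0 < e * cosh_sum \<mu> z" using e cosh_sum_pos[of \<mu> z] by simp
  then have "z \<notin> frontier D" using le[of z] gz by (auto simp: g_def)
  then have zD: "z \<in> D" using z(1) D by (simp add: frontier_def interior_open)
  obtain d where d: "0 < d" "ball z d \<subseteq> D" using D zD open_contains_ball by blast
  have inD: "z + t *\<^sub>R b \<in> D" if "b \<in> Basis" "\<bar>t\<bar> < d" for b t
    using d(2) that by (auto simp: subset_iff dist_norm)
  have C2: "C2_on D u" "C2_on D v" using pu pv by (auto simp: panharmonic_on_def)
  have "\<exists>b\<in>Basis. 0 < partial b (partial b u) z - partial b (partial b v) z - e * (\<mu>\<^sup>2 * cosh (\<mu> * (z \<bullet> b)))"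
  proof (rule ccontr)
    assume "\<not> ?thesis"
    then have "(\<Sum>b\<in>Basis. partial b (partial b u) z - partial b (partial b v) z - e * (\<mu>\<^sup>2 * cosh (\<mu> * (z \<bullet> b)))) \<le> 0"
      by (intro sum_nonpos) (auto simp: not_less)
    also have "(\<Sum>b\<in>Basis. partial b (partial b u) z - partial b (partial b v) z - e * (\<mu>\<^sup>2 * cosh (\<mu> * (z \<bullet> b)))) =
        laplacian u z - laplacian v z - e * \<mu>\<^sup>2 * cosh_sum \<mu> z"
      by (simp add: laplacian_def cosh_sum_def sum_subtractf sum_distrib_left mult.assoc)
    also have "\<dots> = \<mu>\<^sup>2 * g z" using pu pv zD by (simp add: panharmonic_on_def g_def algebra_simps)
    finally show False using gz \<mu> by (simp add: mult_le_0_iff)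
  qed
  then obtain b where b: "b \<in> Basis" and pos2: "0 < partial b (partial b u) z - partial b (partial b v) z - e * (\<mu>\<^sup>2 * cosh (\<mu> * (z \<bullet> b)))"
    by blast
  have bb: "b \<bullet> b = 1" using b by (simp add: inner_same_Basis)
  show False
  proof (rule no_strict_convex_max[of d "\<lambda>t. g (z + t *\<^sub>R b)"
      "\<lambda>t. partial b u (z + t *\<^sub>R b) - partial b v (z + t *\<^sub>R b) - e * (\<mu> * sinh (\<mu> * ((z + t *\<^sub>R b) \<bullet> b)))"])
    show "0 < d" by (rule d)
    show "((\<lambda>t. g (z + t *\<^sub>R b)) has_real_derivative partial b u (z + t *\<^sub>R b) - partial b v (z + t *\<^sub>R b) - e * (\<mu> * sinh (\<mu> * ((z + t *\<^sub>R b) \<bullet> b)))) (at t)"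
      if "\<bar>t\<bar> < d" for t
      unfolding g_def using C2 inD[OF b that] b
      by (intro DERIV_diff DERIV_cmult has_real_derivative_cosh_sum C1_on_line_derivative) (auto simp: C2_on_def)
    have s: "((\<lambda>t. \<mu> * sinh (\<mu> * ((z + t *\<^sub>R b) \<bullet> b))) has_real_derivative \<mu>\<^sup>2 * cosh (\<mu> * (z \<bullet> b))) (at 0)"
      unfolding inner_add_left inner_scaleR_left bb by (auto intro!: derivative_eq_intros simp: power2_eq_square)
    have p: "((\<lambda>t. partial b w (z + t *\<^sub>R b)) has_real_derivative partial b (partial b w) z) (at 0)" if "C2_on D w" for w
      using C1_on_line_derivative[of D "partial b w" b z 0] that b zD by (simp add: C2_on_def)
    show "((\<lambda>t. partial b u (z + t *\<^sub>R b) - partial b v (z + t *\<^sub>R b) - e * (\<mu> * sinh (\<mu> * ((z + t *\<^sub>R b) \<bullet> b)))) has_real_derivative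
        partial b (partial b u) z - partial b (partial b v) z - e * (\<mu>\<^sup>2 * cosh (\<mu> * (z \<bullet> b)))) (at 0)"
      by (intro DERIV_diff DERIV_cmult s p C2)
    show "0 < partial b (partial b u) z - partial b (partial b v) z - e * (\<mu>\<^sup>2 * cosh (\<mu> * (z \<bullet> b)))" by (rule pos2)
    show "g (z + t *\<^sub>R b) \<le> g (z + 0 *\<^sub>R b)" if "\<bar>t\<bar> < d" for t
      using zmax[of "z + t *\<^sub>R b"] inD[OF b that] closure_subset by auto
  qed
qed

section \<open>Propagation of zeros\<close>

context brownian_domain
begin

lemma exit_mean_nonneg:
  assumes [measurable]: "f \<in> borel_measurable borel" and "\<And>y. 0 \<le> f y"
  shows "0 \<le> exit_mean lam f x"
  unfolding exit_mean_eq[OF assms(1)] using assms(2)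
  by (intro Bochner_Integration.integral_nonneg) (simp add: exit_value_def)

text \<open>With n the unit vector from z to x1, the vector from z + sqrt \<delta> w to x1 is (d -
  sqrt \<delta>) n + sqrt \<delta> (n - w), shorter than d when |n - w| < 1/2. The point is that the
  lower bound does not depend on \<delta>.\<close>

lemma hitting_ball_lower_bound:
  assumes d: "0 < d" "dist x1 z = d" and \<delta>: "0 < \<delta>" "sqrt \<delta> \<le> d"
  shows "(\<integral>w. heat 1 w * indicator (ball ((1 / d) *\<^sub>R (x1 - z)) (1/2)) w \<partial>lborel) \<le>
    prob z {\<omega>\<in>space (P z). z + (W \<delta> \<omega> - W 0 \<omega>) \<in> ball x1 d}"
proof -
  let ?n = "(1 / d) *\<^sub>R (x1 - z)"
  have \<delta>0: "0 \<le> \<delta>" using \<delta> by simp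
  have [measurable]: "W \<delta> \<in> borel_measurable (P z)" "W 0 \<in> borel_measurable (P z)" using \<delta> by (auto intro: W_measurable)
  have n: "norm ?n = 1" using d by (simp add: dist_norm)
  have sub: "z + sqrt \<delta> *\<^sub>R w \<in> ball x1 d" if "w \<in> ball ?n (1/2)" for w
  proof -
    have "x1 - (z + sqrt \<delta> *\<^sub>R w) = (d - sqrt \<delta>) *\<^sub>R ?n + sqrt \<delta> *\<^sub>R (?n - w)"
    proof -
      have "d *\<^sub>R ?n = x1 - z" using d(1) by simp
      moreover have "(a - b) *\<^sub>R m + b *\<^sub>R (m - w) = a *\<^sub>R m - b *\<^sub>R w" for a b and m w :: 'a
        by (simp add: algebra_simps)
      ultimately show ?thesis by (simp only: diff_diff_eq)
    qed
    then have "norm (x1 - (z + sqrt \<delta> *\<^sub>R w)) \<le> norm ((d - sqrt \<delta>) *\<^sub>R ?n) + norm (sqrt \<delta> *\<^sub>R (?n - w))"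
      by (simp only: norm_triangle_ineq)
    also have "\<dots> = (d - sqrt \<delta>) + sqrt \<delta> * norm (?n - w)"
      using \<delta> n by (simp only: norm_scaleR) simp
    also have "\<dots> < (d - sqrt \<delta>) + sqrt \<delta> * 1"
      using that \<delta> by (intro add_strict_left_mono mult_strict_left_mono) (auto simp: dist_norm)
    finally show ?thesis by (simp add: dist_norm)
  qed
  let ?g = "indicator (ball x1 d) :: 'a \<Rightarrow> real"
  have hi: "integrable lborel (heat 1 :: 'a \<Rightarrow> real)" by (simp add: integrable_heat)
  have "(\<integral>w. heat 1 w * indicator (ball ?n (1/2)) w \<partial>lborel) \<le> (\<integral>w. heat 1 w * ?g (z + sqrt \<delta> *\<^sub>R w) \<partial>lborel)"
  proof (rule integral_mono)
    show "integrable lborel (\<lambda>w. heat 1 w * indicator (ball ?n (1/2)) w)"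
      by (rule integrable_mult_bounded[OF hi, where C=1]) (auto simp: indicator_def)
    show "integrable lborel (\<lambda>w. heat 1 w * ?g (z + sqrt \<delta> *\<^sub>R w))"
      by (rule integrable_mult_bounded[OF hi, where C=1]) (auto simp: indicator_def)
    show "heat 1 w * indicator (ball ?n (1/2)) w \<le> heat 1 w * ?g (z + sqrt \<delta> *\<^sub>R w)" for w :: 'a
      using sub[of w] heat_pos[of 1 w] by (auto simp: indicator_def)
  qed
  also have "\<dots> = expectation z (\<lambda>\<omega>. ?g (z + (W \<delta> \<omega> - W 0 \<omega>)))"
  proof -
    have "?g \<in> borel_measurable borel" by (intro borel_measurable_indicator) simp
    from integral_increment[OF this \<delta>(1), of z] show ?thesis by (simp add: smooth_avg_def)
  qed
  also have "\<dots> = expectation z (indicator {\<omega>\<in>space (P z). z + (W \<delta> \<omega> - W 0 \<omega>) \<in> ball x1 d})"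
    by (intro Bochner_Integration.integral_cong) (auto simp: indicator_def)
  also have "\<dots> = prob z {\<omega>\<in>space (P z). z + (W \<delta> \<omega> - W 0 \<omega>) \<in> ball x1 d}" by simp
  finally show ?thesis .
qed

text \<open>
  Seen from a boundary point at scale \<open>sqrt \<delta>\<close>, a ball has Gaussian measure bounded below, whereas
  leaving \<open>D\<close> before time \<open>\<delta>\<close> has probability \<open>O(\<delta>\<^sup>2)\<close>.
\<close>

lemma exit_mean_zero_no_touching_ball:
  assumes f [measurable]: "f \<in> borel_measurable borel" and f0: "\<And>y. 0 \<le> f y" and fC: "\<And>y. f y \<le> C" and lam: "0 \<le> lam"
    and z: "z \<in> D" "exit_mean lam f z = 0" and d: "0 < d" "dist x1 z = d"
    and pos: "\<And>y. y \<in> ball x1 d \<Longrightarrow> 0 < exit_mean lam f y"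
  shows False
proof -
  let ?c = "\<integral>w. heat 1 w * indicator (ball ((1 / d) *\<^sub>R (x1 - z)) (1/2)) w \<partial>lborel"
  let ?N = "PiM (dyadic_times \<inter> {..1}) (\<lambda>_. borel) :: (real \<Rightarrow> 'a) measure"
  have fC': "\<bar>f y\<bar> \<le> C" for y using f0[of y] fC[of y] by simp
  have hi: "integrable lborel (heat 1 :: 'a \<Rightarrow> real)" by (simp add: integrable_heat)
  have c: "0 < ?c"
  proof -
    have i: "integrable lborel (\<lambda>w. heat 1 w * indicator (ball ((1 / d) *\<^sub>R (x1 - z)) (1/2)) w)"
      by (rule integrable_mult_bounded[OF hi, where C=1]) (auto simp: indicator_def)
    have nn: "0 \<le> heat 1 w * indicator (ball ((1 / d) *\<^sub>R (x1 - z)) (1/2)) w" for w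
      using heat_pos[of 1 w] by simp
    have "?c \<noteq> 0"
    proof
      assume "?c = 0"
      then have "AE w in lborel. heat 1 w * indicator (ball ((1 / d) *\<^sub>R (x1 - z)) (1/2)) w = (0::real)"
        using integral_nonneg_eq_0_iff_AE[OF i] nn by simp
      then have "AE w in lborel. w \<notin> ball ((1 / d) *\<^sub>R (x1 - z)) (1/2)"
      proof eventually_elim
        case (elim w)
        then show ?case using heat_pos[of 1 w] by (auto simp: indicator_def split: if_splits)
      qed
      then have "emeasure lborel (ball ((1 / d) *\<^sub>R (x1 - z)) (1/2)) = 0"
        by (subst (asm) AE_iff_measurable[of "ball ((1 / d) *\<^sub>R (x1 - z)) (1/2)"]) auto
      then have "negligible (ball ((1 / d) *\<^sub>R (x1 - z)) (1/2))"
        unfolding negligible_iff_null_sets by (intro null_sets_completionI null_setsI) auto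
      then show False using open_not_negligible[of "ball ((1 / d) *\<^sub>R (x1 - z)) (1/2)"] by simp
    qed
    moreover have "0 \<le> ?c" using nn by (intro Bochner_Integration.integral_nonneg) auto
    ultimately show ?thesis by simp
  qed
  obtain r where r: "0 < r" "cball z r \<subseteq> D" using open_D z(1) open_contains_cball by blast
  have h0: "(\<lambda>m. (1/2::real) ^ m) \<longlonglongrightarrow> 0" by (rule LIMSEQ_realpow_zero) auto
  have "(\<lambda>m. osc_const TYPE('a) * ((1/2) ^ m)\<^sup>2 / r ^ 4) \<longlonglongrightarrow> osc_const TYPE('a) * 0\<^sup>2 / r ^ 4"
    using r(1) by (intro tendsto_intros h0) auto
  then have ev1: "\<forall>\<^sub>F m in sequentially. osc_const TYPE('a) * ((1/2) ^ m)\<^sup>2 / r ^ 4 < ?c" using c by (intro order_tendstoD(2)) auto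
  have "(\<lambda>m. sqrt ((1/2::real) ^ m)) \<longlonglongrightarrow> sqrt 0" by (intro tendsto_intros h0)
  then have ev2: "\<forall>\<^sub>F m in sequentially. sqrt ((1/2::real) ^ m) < d" using d by (intro order_tendstoD(2)) auto
  obtain m where m: "osc_const TYPE('a) * ((1/2) ^ m)\<^sup>2 / r ^ 4 < ?c" "sqrt ((1/2::real) ^ m) < d"
    using eventually_conj[OF ev1 ev2] by (auto simp: eventually_sequentially)
  define \<delta> where "\<delta> = (1/2::real) ^ m"
  have \<delta>: "0 < \<delta>" "0 \<le> \<delta>" "sqrt \<delta> \<le> d" using m by (auto simp: \<delta>_def)
  have one: "1 \<in> dyadic_times \<inter> {..1}" using one_dyadic_times by simp
  have [measurable]: "(\<lambda>p. p q) \<in> borel_measurable ?N" if "q \<in> dyadic_times \<inter> {..1}" for q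
    using that by (rule measurable_component_singleton)
  note [measurable] = this[OF one]
  note [measurable] = increments_measurable[OF \<delta>(2)] past_measurable[OF \<delta>(2)]
  \<comment> \<open>The complement of \<open>large_osc\<close>, as a set of pasts, so that ?F below
    is a factor of the past times a function of its end point and the future.\<close>
  define G where "G = {p \<in> space ?N. \<not> (\<exists>q\<in>dyadic_times \<inter> {..1}. r < norm (p q))}"
  have G [measurable]: "G \<in> sets ?N"
  proof -
    have "{p \<in> space ?N. \<exists>q\<in>dyadic_times \<inter> {..1}. r < norm (p q)} \<in> sets ?N"
      by (intro sets.sets_Collect_countable_Ex') (auto simp: countable_dyadic_times)
    then have "space ?N - {p \<in> space ?N. \<exists>q\<in>dyadic_times \<inter> {..1}. r < norm (p q)} \<in> sets ?N" by auto
    then show ?thesis by (simp add: G_def set_diff_eq) (metis (no_types, lifting) Collect_cong)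
  qed
  have Gosc: "past_increments W \<delta> \<omega> \<in> G \<longleftrightarrow> \<omega> \<notin> large_osc z \<delta> r" if "\<omega> \<in> space (P z)" for \<omega>
    using that measurable_space[OF past_measurable[OF \<delta>(2)] that] by (auto simp: G_def large_osc_def)
  \<comment> \<open>Almost surely zero along the path from z: on pasts in \<open>G\<close> the exit
    value is the discounted exit value of the restarted path, and it vanishes almost surely, being
    nonnegative with mean 0.\<close>
  let ?F = "\<lambda>p. indicator G (fst p) * exit_fun lam f (path_from (z + fst p 1) (snd p)) :: real"
  have F [measurable]: "?F \<in> borel_measurable (?N \<Otimes>\<^sub>M path_space)"
  proof -
    have "(\<lambda>p. (z + fst p 1, snd p)) \<in> ?N \<Otimes>\<^sub>M path_space \<rightarrow>\<^sub>M borel \<Otimes>\<^sub>M path_space" by measurable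
    from measurable_compose[OF measurable_compose[OF this path_from_measurable] exit_fun_measurable[OF f]]
    have [measurable]: "(\<lambda>p. exit_fun lam f (path_from (z + fst p 1) (snd p))) \<in> borel_measurable (?N \<Otimes>\<^sub>M path_space)" by simp
    show ?thesis by measurable
  qed
  have bE: "\<bar>exit_fun lam f \<xi>\<bar> \<le> C" for \<xi> by (rule exit_fun_bound[OF lam fC'])
  have bF: "\<bar>?F p\<bar> \<le> C" for p using bE[of "path_from (z + fst p 1) (snd p)"] order_trans[OF abs_ge_zero bE] by (auto simp: indicator_def)
  have E0: "0 \<le> exit_fun lam f \<xi>" for \<xi> using f0 by (simp add: exit_fun_def exit_value_def)
  let ?J = "\<lambda>\<omega>. exit_value lam f (exit_time W D \<omega>) (exit_point W D \<omega>)"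
  have J [measurable]: "?J \<in> borel_measurable (P z)" unfolding exit_value_def by measurable
  have iJ: "integrable (P z) ?J"
    by (rule integrable_const_bound[where B=C]) (auto intro: exit_value_bound[OF lam exit_time_nonneg fC'])
  have J0: "AE \<omega> in P z. ?J \<omega> = 0"
    using integral_nonneg_eq_0_iff_AE[OF iJ] z(2) f0 unfolding exit_mean_eq[OF f] by (simp add: exit_value_def)
  have p1: "past_increments W \<delta> \<omega> 1 = W \<delta> \<omega> - W 0 \<omega>" for \<omega> using one by (simp add: past_increments_def)
  have "AE \<omega> in P z. ?F (past_increments W \<delta> \<omega>, increments W \<delta> \<omega>) = 0"
    using J0 W_start[of z] AE_space
  proof eventually_elim
    case (elim \<omega>)
    show ?case
    proof (cases "\<omega> \<in> large_osc z \<delta> r")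
      case True then show ?thesis using Gosc[OF elim(3)] by simp
    next
      case False
      have "W t \<omega> \<in> D" if "0 < t" "t \<le> \<delta>" for t
        using not_large_osc[OF elim(3) False \<delta>(1), of t] that elim(2) r(2) by (auto simp: dist_norm norm_minus_commute subset_iff)
      then have "exp (- lam * \<delta>) * exit_fun lam f (restrict (\<lambda>q. W (\<delta> + q) \<omega>) dyadic_times) = 0"
        using exit_shift[OF elim(3) \<delta>(1)] elim(1) by simp
      then show ?thesis using path_from_increments[of W \<delta> \<omega>] elim(2) by (simp add: p1)
    qed
  qed
  then have "(\<integral>\<omega>. ?F (past_increments W \<delta> \<omega>, increments W \<delta> \<omega>) \<partial>P z) = 0"
    by (rule integral_eq_zero_AE)
  then have "(\<integral>\<omega>. (\<integral>\<eta>. ?F (past_increments W \<delta> \<omega>, \<eta>) \<partial>wiener_law P W) \<partial>P z) = 0"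
    using past_future_integral[OF F bF \<delta>(1), of z] by simp
  then have Q0: "(\<integral>\<omega>. indicator G (past_increments W \<delta> \<omega>) * exit_mean lam f (z + (W \<delta> \<omega> - W 0 \<omega>)) \<partial>P z) = 0"
    by (simp add: exit_mean_def path_mean_def p1)
  have [measurable]: "W \<delta> \<in> borel_measurable (P z)" "W 0 \<in> borel_measurable (P z)" using \<delta> by (auto intro: W_measurable)
  let ?Q = "\<lambda>\<omega>. indicator G (past_increments W \<delta> \<omega>) * exit_mean lam f (z + (W \<delta> \<omega> - W 0 \<omega>))"
  have Q [measurable]: "?Q \<in> borel_measurable (P z)" by measurable
  have em0: "0 \<le> exit_mean lam f y" for y by (rule exit_mean_nonneg[OF f f0])
  have iQ: "integrable (P z) ?Q"
    by (rule integrable_const_bound[where B=C])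
       (use exit_mean_bound[OF f lam fC'] order_trans[OF abs_ge_zero bE] in \<open>auto simp: indicator_def\<close>)
  have aeQ: "AE \<omega> in P z. ?Q \<omega> = 0"
    using integral_nonneg_eq_0_iff_AE[OF iQ] Q0 em0 by simp
  let ?B = "{\<omega>\<in>space (P z). z + (W \<delta> \<omega> - W 0 \<omega>) \<in> ball x1 d}"
  \<comment> \<open>On ?B the mean of the restarted path is positive, so the product ?Q can vanish
    only through its indicator.\<close>
  have "AE \<omega> in P z. \<omega> \<in> ?B \<longrightarrow> \<omega> \<in> large_osc z \<delta> r"
    using aeQ AE_space
  proof eventually_elim
    case (elim \<omega>)
    show ?case
    proof
      assume "\<omega> \<in> ?B"
      then have "exit_mean lam f (z + (W \<delta> \<omega> - W 0 \<omega>)) \<noteq> 0" using pos by force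
      then have "past_increments W \<delta> \<omega> \<notin> G" using elim(1) by (auto simp: indicator_def)
      then show "\<omega> \<in> large_osc z \<delta> r" using Gosc elim(2) by blast
    qed
  qed
  then have "prob z ?B \<le> prob z (large_osc z \<delta> r)"
    by (rule finite_measure_mono_AE) (use \<delta> in auto)
  also have "\<dots> \<le> osc_const TYPE('a) * \<delta>\<^sup>2 / r ^ 4" by (rule prob_large_osc[OF \<delta>(1) r(1)])
  also have "\<dots> < ?c" using m(1) by (simp add: \<delta>_def)
  also have "\<dots> \<le> prob z ?B" by (rule hitting_ball_lower_bound[OF d \<delta>(1,3)])
  finally show False by simp
qed

text \<open>The zero set is closed in \<open>D\<close> by continuity. It is open as well: if u1 near
  a zero u were no zero, the zero nearest to u1 would be touched by a ball of positivity around
  u1.\<close>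

lemma exit_mean_zero_propagates:
  assumes f [measurable]: "f \<in> borel_measurable borel" and f0: "\<And>y. 0 \<le> f y" and fC: "\<And>y. f y \<le> C" and lam: "0 \<le> lam"
    and conn: "connected D" and x: "x \<in> D" "exit_mean lam f x = 0" and y: "y \<in> D"
  shows "exit_mean lam f y = 0"
proof -
  let ?v = "exit_mean lam f"
  have fC': "\<bar>f y\<bar> \<le> C" for y using f0[of y] fC[of y] by simp
  have v0: "0 \<le> ?v u" for u by (rule exit_mean_nonneg[OF f f0])
  have cont: "continuous_on D ?v"
    using exit_mean_regular[OF f fC' lam] by (simp add: C2_on_def C1_on_def)
  define S where "S = {u \<in> D. ?v u = 0}"
  have closed: "closedin (top_of_set D) S"
    unfolding S_def using continuous_closedin_preimage_constant[OF cont, of 0] by (simp add: vimage_def Int_def conj_commute)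
  have "openin (top_of_set D) S"
    unfolding openin_contains_ball
  proof (intro conjI ballI)
    show "S \<subseteq> D" by (auto simp: S_def)
    fix u assume u: "u \<in> S"
    then obtain r where r: "0 < r" "ball u (2 * r) \<subseteq> D"
      using open_D open_contains_ball unfolding S_def by (metis (no_types, lifting) CollectD field_sum_of_halves half_gt_zero mult_2)
    have "u1 \<in> S" if u1: "u1 \<in> ball u r" for u1
    proof (rule ccontr)
      assume "u1 \<notin> S"
      \<comment> \<open>This closed ball passes through the zero u, so it contains the zeros nearest
        to u1; it lies in \<open>D\<close> because the ball of radius 2 r around u does.\<close>
      define K where "K = cball u1 (dist u1 u)"
      have KD: "K \<subseteq> D"
      proof
        fix w assume "w \<in> K"
        then have "dist u w < 2 * r" using u1 dist_triangle[of u w u1] by (simp add: K_def dist_commute)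
        then show "w \<in> D" using r(2) by auto
      qed
      have "closed (K \<inter> ?v -` {0})"
        by (rule continuous_closed_preimage[OF continuous_on_subset[OF cont KD]]) (auto simp: K_def)
      then have "compact (K \<inter> (K \<inter> ?v -` {0}))" unfolding K_def by (intro compact_Int_closed) auto
      then have "compact (K \<inter> ?v -` {0})" by (simp add: Int_assoc[symmetric])
      moreover have "u \<in> K \<inter> ?v -` {0}" using u by (simp add: K_def S_def)
      ultimately
      obtain z where z: "z \<in> K \<inter> ?v -` {0}" "\<And>w. w \<in> K \<inter> ?v -` {0} \<Longrightarrow> dist u1 z \<le> dist u1 w"
      proof -
        have "continuous_on (K \<inter> ?v -` {0}) (\<lambda>w. dist u1 w)" by (intro continuous_intros)
        then show ?thesis
          using continuous_attains_inf[of "K \<inter> ?v -` {0}" "\<lambda>w. dist u1 w"] \<open>compact (K \<inter> ?v -` {0})\<close> \<open>u \<in> K \<inter> ?v -` {0}\<close> that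
          by blast
      qed
      have zD: "z \<in> D" "?v z = 0" using z KD by auto
      have "u1 \<in> D" using KD by (auto simp: K_def)
      then have d: "0 < dist u1 z" using \<open>u1 \<notin> S\<close> zD by (auto simp: S_def)
      have "0 < ?v w" if "w \<in> ball u1 (dist u1 z)" for w
      proof (rule ccontr)
        assume "\<not> 0 < ?v w"
        then have "?v w = 0" using v0[of w] by simp
        moreover have "w \<in> K" using that z(1) by (auto simp: K_def)
        ultimately have "dist u1 z \<le> dist u1 w" by (intro z(2)) auto
        then show False using that by simp
      qed
      then show False by (rule exit_mean_zero_no_touching_ball[OF f f0 fC lam zD d refl])
    qed
    then show "\<exists>e>0. ball u e \<inter> D \<subseteq> S" using r(1) by blast
  qed
  then have "S = {} \<or> S = D" using conn closed unfolding connected_clopen by blast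
  then show ?thesis using x y by (auto simp: S_def)
qed

end

section \<open>Identification of the panharmonic measures\<close>

lemma finite_measure_eqI_closed:
  fixes M N :: "'a::metric_space measure"
  assumes M: "sets M = sets borel" "finite_measure M" and N: "sets N = sets borel"
    and eq: "\<And>S. closed S \<Longrightarrow> emeasure M S = emeasure N S"
  shows "M = N"
proof (rule measure_eqI_generator_eq[where E="Collect closed" and \<Omega>=UNIV and A="\<lambda>_. UNIV"])
  show "sets M = sigma_sets UNIV (Collect closed)" "sets N = sigma_sets UNIV (Collect closed)"
    using M(1) N by (simp_all add: borel_eq_closed)
  show "emeasure M UNIV \<noteq> \<infinity>" using finite_measure.emeasure_finite[OF M(2)] by simp
qed (auto simp: Int_stable_def eq)

text \<open>Lipschitz functions decreasing to the indicator. The empty set is excluded because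
  \<open>infdist\<close> to it is 0.\<close>

lemma indicator_closed_limit:
  fixes S :: "'a::metric_space set"
  assumes "closed S" "S \<noteq> {}"
  shows "(\<lambda>n. max 0 (1 - real n * infdist y S)) \<longlonglongrightarrow> indicator S y"
proof (cases "y \<in> S")
  case True then show ?thesis by simp
next
  case False
  then have p: "0 < infdist y S"
    using in_closed_iff_infdist_zero[OF assms] infdist_nonneg[of y S] by (metis less_eq_real_def)
  obtain N where N: "1 / infdist y S < real N" using reals_Archimedean2 by blast
  have "max 0 (1 - real n * infdist y S) = 0" if "n \<ge> N" for n
  proof -
    have "1 / infdist y S \<le> real n" using N that by simp
    then show ?thesis using p by (simp add: divide_le_eq max_def)
  qed
  then have "\<forall>\<^sub>F n in sequentially. max 0 (1 - real n * infdist y S) = 0" by (auto simp: eventually_sequentially)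
  then show ?thesis using False by (simp add: tendsto_eventually)
qed

context brownian_domain
begin

text \<open>The exit value of the constant 1 is the weight exp (- lam tau) where tau is finite and 0
  elsewhere. With lam = \<mu>^2 / 2 this is the candidate for the panharmonic measure, restricted to
  the frontier in the same way as \<open>harmonic_measure\<close>.\<close>

definition exit_law :: "real \<Rightarrow> 'a \<Rightarrow> 'a measure" where
  "exit_law lam x = restrict_space
     (distr (density (P x) (\<lambda>\<omega>. ennreal (exit_value lam (\<lambda>_. 1) (exit_time W D \<omega>) (exit_point W D \<omega>)))) borel (exit_point W D))
     (frontier D)"

lemma sets_exit_law [simp]: "sets (exit_law lam x) = sets (restrict_space borel (frontier D))"
  unfolding exit_law_def by (intro sets_restrict_space_cong) simp

lemma space_exit_law [simp]: "space (exit_law lam x) = frontier D"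
  by (simp add: exit_law_def space_restrict_space)

lemma frontier_borel: "frontier D \<in> sets borel"
  by (intro borel_closed frontier_closed)

lemma exit_value_measurable [measurable]:
  assumes [measurable]: "f \<in> borel_measurable borel"
  shows "(\<lambda>\<omega>. exit_value lam f (exit_time W D \<omega>) (exit_point W D \<omega>)) \<in> borel_measurable (P x)"
  unfolding exit_value_def by measurable

lemma integrable_exit_value:
  assumes f [measurable]: "f \<in> borel_measurable borel" and lam: "0 \<le> lam" and fC: "\<And>y. \<bar>f y\<bar> \<le> C"
  shows "integrable (P x) (\<lambda>\<omega>. exit_value lam f (exit_time W D \<omega>) (exit_point W D \<omega>))"
  by (rule integrable_const_bound[where B=C]) (auto intro: exit_value_bound[OF lam exit_time_nonneg fC])

text \<open>Only the values of \<open>u\<close> on the frontier are controlled; extending them by 0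
  gives the total Borel function that \<open>exit_mean\<close> takes.\<close>

lemma exit_law_integral:
  assumes u: "(\<lambda>y. indicator (frontier D) y *\<^sub>R u y) \<in> borel_measurable borel"
    and lam: "0 \<le> lam" and bound: "\<And>y. y \<in> frontier D \<Longrightarrow> \<bar>u y\<bar> \<le> C"
  shows "integrable (exit_law lam x) u"
    and "(\<integral>y. u y \<partial>exit_law lam x) = exit_mean lam (\<lambda>y. indicator (frontier D) y *\<^sub>R u y) x"
proof -
  let ?f = "\<lambda>y. indicator (frontier D) y *\<^sub>R u y"
  let ?w = "\<lambda>\<omega>. exit_value lam (\<lambda>_. 1) (exit_time W D \<omega>) (exit_point W D \<omega>)"
  note [measurable] = u
  \<comment> \<open>On an empty frontier \<open>C\<close> may be negative, hence
    \<open>max 0 C\<close>.\<close>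
  have fC: "\<bar>?f y\<bar> \<le> max 0 C" for y using bound[of y] by (auto simp: indicator_def)
  have F: "frontier D \<inter> space (distr (density (P x) (\<lambda>\<omega>. ennreal (?w \<omega>))) borel (exit_point W D)) \<in>
      sets (distr (density (P x) (\<lambda>\<omega>. ennreal (?w \<omega>))) borel (exit_point W D))"
    using frontier_borel by simp
  have w0: "0 \<le> ?w \<omega>" for \<omega> by (simp add: exit_value_def)
  have [measurable]: "?w \<in> borel_measurable (P x)" by measurable
  have eq: "?w \<omega> *\<^sub>R ?f (exit_point W D \<omega>) = exit_value lam ?f (exit_time W D \<omega>) (exit_point W D \<omega>)" for \<omega>
    by (simp add: exit_value_def)
  have X: "exit_point W D \<in> density (P x) (\<lambda>\<omega>. ennreal (?w \<omega>)) \<rightarrow>\<^sub>M borel" by measurable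
  have fX: "(\<lambda>\<omega>. ?f (exit_point W D \<omega>)) \<in> borel_measurable (P x)" by measurable
  show "integrable (exit_law lam x) u"
    unfolding exit_law_def integrable_restrict_space[OF F] integrable_distr_eq[OF X u]
    using integrable_exit_value[OF u lam fC, of x] w0 eq fX
    by (subst integrable_density) auto
  have "(\<integral>y. u y \<partial>exit_law lam x) = (\<integral>\<omega>. ?f (exit_point W D \<omega>) \<partial>density (P x) (\<lambda>\<omega>. ennreal (?w \<omega>)))"
    unfolding exit_law_def integral_restrict_space[OF F] by (rule integral_distr[OF X u])
  also have "\<dots> = (\<integral>\<omega>. ?w \<omega> *\<^sub>R ?f (exit_point W D \<omega>) \<partial>P x)"
    by (rule integral_density) (use w0 fX in auto)
  finally show "(\<integral>y. u y \<partial>exit_law lam x) = exit_mean lam ?f x"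
    unfolding eq exit_mean_eq[OF u] .
qed

lemma sets_frontier_iff: "A \<in> sets (restrict_space borel (frontier D)) \<longleftrightarrow> A \<subseteq> frontier D \<and> A \<in> sets borel"
  by (rule sets_restrict_space_iff) (simp add: frontier_borel)

lemma emeasure_exit_law:
  assumes A: "A \<in> sets (restrict_space borel (frontier D))" and lam: "0 \<le> lam"
  shows "emeasure (exit_law lam x) A = ennreal (exit_mean lam (indicator A) x)"
proof -
  have A': "A \<subseteq> frontier D" "A \<in> sets borel" using A unfolding sets_frontier_iff by auto
  then have [measurable]: "A \<in> sets borel" by simp
  have ind: "(\<lambda>y. indicator (frontier D) y *\<^sub>R (indicator A y :: real)) = indicator A"
  proof
    fix y show "indicator (frontier D) y *\<^sub>R (indicator A y :: real) = indicator A y"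
      using A'(1) by (cases "y \<in> A") auto
  qed
  have u: "(\<lambda>y. indicator (frontier D) y *\<^sub>R (indicator A y :: real)) \<in> borel_measurable borel"
    unfolding ind by measurable
  have 1: "integrable (exit_law lam x) (indicator A :: 'a \<Rightarrow> real)"
    and 2: "(\<integral>y. indicator A y \<partial>exit_law lam x) = exit_mean lam (indicator A) x"
  proof -
    have b: "\<bar>indicator A y :: real\<bar> \<le> 1" for y by (simp add: indicator_def)
    show "integrable (exit_law lam x) (indicator A :: 'a \<Rightarrow> real)" "(\<integral>y. indicator A y \<partial>exit_law lam x) = exit_mean lam (indicator A) x"
      using exit_law_integral[OF u lam b] unfolding ind by blast+
  qed
  have AM: "A \<in> sets (exit_law lam x)" using A by simp
  have "emeasure (exit_law lam x) A = (\<integral>\<^sup>+y. ennreal (indicator A y) \<partial>exit_law lam x)"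
    using AM by (simp add: ennreal_indicator)
  also have "\<dots> = ennreal (\<integral>y. indicator A y \<partial>exit_law lam x)" by (rule nn_integral_eq_integral[OF 1]) simp
  finally show ?thesis unfolding 2 .
qed

lemma harmonic_measure_eq: "harmonic_measure P W D x = exit_law 0 x"
proof -
  let ?S = "{\<omega>. exit_time W D \<omega> < \<infinity>}"
  have S: "?S \<inter> space (P x) \<in> sets (P x)"
  proof -
    have "{\<omega>\<in>space (P x). exit_time W D \<omega> < \<infinity>} \<in> sets (P x)" by measurable
    then show ?thesis by (simp add: Int_def conj_commute)
  qed
  have "distr (restrict_space (P x) ?S) borel (exit_point W D) =
      distr (density (P x) (\<lambda>\<omega>. ennreal (exit_value 0 (\<lambda>_. 1) (exit_time W D \<omega>) (exit_point W D \<omega>)))) borel (exit_point W D)"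
  proof (rule measure_eqI)
    fix A assume "A \<in> sets (distr (restrict_space (P x) ?S) borel (exit_point W D))"
    then have A [measurable]: "A \<in> sets borel" by simp
    have m: "exit_point W D \<in> restrict_space (P x) ?S \<rightarrow>\<^sub>M borel" by (rule measurable_restrict_space1) measurable
    have w: "ennreal (exit_value 0 (\<lambda>_. 1) (exit_time W D \<omega>) (exit_point W D \<omega>)) = indicator ?S \<omega>" for \<omega>
      by (simp add: exit_value_def indicator_def)
    have [measurable]: "(\<lambda>\<omega>. indicator ?S \<omega> :: ennreal) \<in> borel_measurable (P x)"
      using S by (simp add: borel_measurable_indicator_iff)
    have "emeasure (distr (restrict_space (P x) ?S) borel (exit_point W D)) A =
        emeasure (P x) (exit_point W D -` A \<inter> (space (P x) \<inter> ?S))"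
      unfolding emeasure_distr[OF m A] space_restrict_space Int_commute[of ?S]
      by (rule emeasure_restrict_space[OF S]) auto
    also have "\<dots> = (\<integral>\<^sup>+\<omega>. indicator (exit_point W D -` A \<inter> (space (P x) \<inter> ?S)) \<omega> \<partial>P x)"
    proof -
      have "exit_point W D -` A \<inter> (space (P x) \<inter> ?S) = (exit_point W D -` A \<inter> space (P x)) \<inter> (?S \<inter> space (P x))" by auto
      also have "\<dots> \<in> sets (P x)" using S by measurable
      finally show ?thesis by simp
    qed
    also have "\<dots> = (\<integral>\<^sup>+\<omega>. indicator ?S \<omega> * indicator (exit_point W D -` A \<inter> space (P x)) \<omega> \<partial>P x)"
      by (intro nn_integral_cong) (auto simp: indicator_def)
    also have "\<dots> = emeasure (distr (density (P x) (\<lambda>\<omega>. indicator ?S \<omega>)) borel (exit_point W D)) A"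
      by (subst emeasure_distr) (auto simp: emeasure_density)
    finally show "emeasure (distr (restrict_space (P x) ?S) borel (exit_point W D)) A =
        emeasure (distr (density (P x) (\<lambda>\<omega>. ennreal (exit_value 0 (\<lambda>_. 1) (exit_time W D \<omega>) (exit_point W D \<omega>)))) borel (exit_point W D)) A"
      unfolding w .
  qed simp
  then show ?thesis unfolding harmonic_measure_def exit_law_def by simp
qed

text \<open>The discount is positive at finite exit times, so the right-hand side, and with it the
  class of null sets, is the same for all \<open>lam\<close>.\<close>

lemma exit_mean_indicator_eq_0_iff:
  assumes A [measurable]: "A \<in> sets borel" and lam: "0 \<le> lam"
  shows "exit_mean lam (indicator A) x = 0 \<longleftrightarrow> (AE \<omega> in P x. \<not> (exit_time W D \<omega> < \<infinity> \<and> exit_point W D \<omega> \<in> A))"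
proof -
  have i: "integrable (P x) (\<lambda>\<omega>. exit_value lam (indicator A) (exit_time W D \<omega>) (exit_point W D \<omega>))"
    by (rule integrable_exit_value[where C=1]) (use lam in \<open>auto simp: indicator_def\<close>)
  have "exit_mean lam (indicator A) x = 0 \<longleftrightarrow>
      (AE \<omega> in P x. exit_value lam (indicator A) (exit_time W D \<omega>) (exit_point W D \<omega>) = 0)"
    unfolding exit_mean_eq[OF borel_measurable_indicator[OF A]]
    by (rule integral_nonneg_eq_0_iff_AE[OF i]) (simp add: exit_value_def)
  also have "\<dots> \<longleftrightarrow> (AE \<omega> in P x. \<not> (exit_time W D \<omega> < \<infinity> \<and> exit_point W D \<omega> \<in> A))"
    by (intro AE_cong) (auto simp: exit_value_def indicator_def)
  finally show ?thesis .
qed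

text \<open>Two moves: propagation of zeros changes the pole at fixed \<open>lam\<close>, then
  \<open>exit_mean_indicator_eq_0_iff\<close> changes \<open>lam\<close> at the new pole.\<close>

lemma exit_law_absolutely_continuous:
  assumes conn: "connected D" and x: "x \<in> D" "x' \<in> D" and lam: "0 \<le> lam" "0 \<le> lam'"
  shows "absolutely_continuous (exit_law lam x) (exit_law lam' x')"
  unfolding absolutely_continuous_def
proof
  fix A assume "A \<in> null_sets (exit_law lam x)"
  then have A: "A \<in> sets (restrict_space borel (frontier D))" "emeasure (exit_law lam x) A = 0" by auto
  then have Ab [measurable]: "A \<in> sets borel" unfolding sets_frontier_iff by simp
  have fm: "(indicator A :: 'a \<Rightarrow> real) \<in> borel_measurable borel" by measurable
  have "0 \<le> exit_mean lam (indicator A) x" by (rule exit_mean_nonneg) auto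
  then have "exit_mean lam (indicator A) x = 0" using A emeasure_exit_law[OF A(1) lam(1), of x] by (simp add: ennreal_eq_0_iff)
  then have "exit_mean lam (indicator A) x' = 0"
    by (intro exit_mean_zero_propagates[OF fm _ _ lam(1) conn x(1) _ x(2), where C=1]) (auto simp: indicator_def)
  then have "exit_mean lam' (indicator A) x' = 0"
    using exit_mean_indicator_eq_0_iff[OF Ab] lam by simp
  then show "A \<in> null_sets (exit_law lam' x')"
    using A(1) emeasure_exit_law[OF A(1) lam(2), of x'] by (simp add: null_sets_def)
qed

end

section \<open>The Dirichlet problem and uniqueness of the representing measure\<close>

locale regular_brownian_domain = brownian_domain +
  assumes regular: "\<And>y. y \<in> frontier D \<Longrightarrow> measure (P y) {\<omega>\<in>space (P y). exit_time W D \<omega> = 0} = 1"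
begin

lemma exit_mean_dirichlet:
  assumes f: "f \<in> borel_measurable borel" "\<And>y. \<bar>f y\<bar> \<le> C" "continuous_on (frontier D) f" and \<mu>: "0 < \<mu>"
  shows "continuous_on (closure D) (exit_mean (\<mu>\<^sup>2 / 2) f)" "panharmonic_on \<mu> D (exit_mean (\<mu>\<^sup>2 / 2) f)"
    "\<And>y. y \<in> frontier D \<Longrightarrow> exit_mean (\<mu>\<^sup>2 / 2) f y = f y" "\<bar>exit_mean (\<mu>\<^sup>2 / 2) f x\<bar> \<le> C"
proof -
  have l: "0 \<le> \<mu>\<^sup>2 / 2" by simp
  show "continuous_on (closure D) (exit_mean (\<mu>\<^sup>2 / 2) f)"
    by (rule exit_mean_continuous[OF f(1,2) l f(3) regular])
  show "panharmonic_on \<mu> D (exit_mean (\<mu>\<^sup>2 / 2) f)"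
    using exit_mean_regular[OF f(1,2) l] by (simp add: panharmonic_on_def)
  show "exit_mean (\<mu>\<^sup>2 / 2) f y = f y" if "y \<in> frontier D" for y
    by (rule exit_mean_frontier[OF f(1) regular[OF that]])
  show "\<bar>exit_mean (\<mu>\<^sup>2 / 2) f x\<bar> \<le> C" by (rule exit_mean_bound[OF f(1) l f(2)])
qed

text \<open>Both sides are bounded solutions with the same boundary values; the comparison principle
  is applied in both directions.\<close>

lemma panharmonic_eq_exit_mean:
  assumes u: "continuous_on (closure D) u" "bounded (u ` closure D)" "panharmonic_on \<mu> D u" and \<mu>: "0 < \<mu>" and x: "x \<in> D"
  shows "u x = exit_mean (\<mu>\<^sup>2 / 2) (\<lambda>y. indicator (frontier D) y *\<^sub>R u y) x"
proof -
  let ?f = "\<lambda>y. indicator (frontier D) y *\<^sub>R u y"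
  obtain C where C: "\<And>y. y \<in> closure D \<Longrightarrow> \<bar>u y\<bar> \<le> C" using u(2) by (auto simp: bounded_iff)
  have fc: "frontier D \<subseteq> closure D" by (auto simp: frontier_def)
  have C0: "0 \<le> C" using C[of x] x closure_subset by fastforce
  have cu: "continuous_on (frontier D) u" by (rule continuous_on_subset[OF u(1) fc])
  have f: "?f \<in> borel_measurable borel" by (rule borel_measurable_continuous_on_indicator[OF frontier_borel cu])
  have fC: "\<bar>?f y\<bar> \<le> C" for y using C[of y] C0 fc by (auto simp: indicator_def)
  have cf: "continuous_on (frontier D) ?f" by (rule continuous_on_cong[THEN iffD2, OF refl _ cu]) simp
  note v = exit_mean_dirichlet[OF f fC cf \<mu>]
  have vu: "exit_mean (\<mu>\<^sup>2 / 2) ?f w = u w" if "w \<in> frontier D" for w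
    using v(3)[OF that] that by simp
  have le: "u w \<le> exit_mean (\<mu>\<^sup>2 / 2) ?f w" "exit_mean (\<mu>\<^sup>2 / 2) ?f w \<le> u w" if "w \<in> frontier D" for w
    using vu[OF that] by linarith+
  have "u x \<le> exit_mean (\<mu>\<^sup>2 / 2) ?f x"
    by (rule panharmonic_comparison[OF open_D \<mu> u(3) v(2) u(1) v(1) C v(4) le(1) x])
  moreover have "exit_mean (\<mu>\<^sup>2 / 2) ?f x \<le> u x"
    by (rule panharmonic_comparison[OF open_D \<mu> v(2) u(3) v(1) u(1) v(4) C le(2) x])
  ultimately show ?thesis by simp
qed

lemma represents_exit_law:
  assumes \<mu>: "0 < \<mu>" and x: "x \<in> D"
  shows "represents_panharmonic \<mu> D x (exit_law (\<mu>\<^sup>2 / 2) x)"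
  unfolding represents_panharmonic_def
proof (intro conjI allI impI)
  fix u assume u: "continuous_on (closure D) u \<and> bounded (u ` closure D) \<and> panharmonic_on \<mu> D u"
  obtain C where C: "\<And>y. y \<in> closure D \<Longrightarrow> \<bar>u y\<bar> \<le> C" using u by (auto simp: bounded_iff)
  have fc: "frontier D \<subseteq> closure D" by (auto simp: frontier_def)
  have cu: "continuous_on (frontier D) u" using continuous_on_subset[OF _ fc] u by blast
  have f: "(\<lambda>y. indicator (frontier D) y *\<^sub>R u y) \<in> borel_measurable borel"
    by (rule borel_measurable_continuous_on_indicator[OF frontier_borel cu])
  have b: "\<bar>u y\<bar> \<le> C" if "y \<in> frontier D" for y using C fc that by blast
  note I = exit_law_integral[OF f _ b, of "\<mu>\<^sup>2 / 2" x]
  show "integrable (exit_law (\<mu>\<^sup>2 / 2) x) u" by (rule I) simp_all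
  show "u x = (\<integral>y. u y \<partial>exit_law (\<mu>\<^sup>2 / 2) x)"
    using panharmonic_eq_exit_mean[of u \<mu> x] u \<mu> x I(2) by simp
qed simp

text \<open>A bounded continuous f on the frontier is the boundary value of its own exit mean, so
  the representation property fixes its integral. This determines the measure of closed sets and
  then the measure.\<close>

lemma represents_panharmonic_unique:
  assumes H: "represents_panharmonic \<mu> D x H" and \<mu>: "0 < \<mu>" and x: "x \<in> D"
  shows "H = exit_law (\<mu>\<^sup>2 / 2) x"
proof -
  let ?L = "exit_law (\<mu>\<^sup>2 / 2) x"
  have L: "represents_panharmonic \<mu> D x ?L" by (rule represents_exit_law[OF \<mu> x])
  have fint: "integrable K f \<and> (\<integral>y. f y \<partial>K) = exit_mean (\<mu>\<^sup>2 / 2) (\<lambda>y. indicator (frontier D) y *\<^sub>R f y) x"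
    if K: "represents_panharmonic \<mu> D x K" and f: "continuous_on UNIV f" "\<And>y. \<bar>f y\<bar> \<le> 1" for K and f :: "'a \<Rightarrow> real"
  proof -
    let ?f = "\<lambda>y. indicator (frontier D) y *\<^sub>R f y"
    have sK: "space K = frontier D"
      using K sets_eq_imp_space_eq[of K "restrict_space borel (frontier D)"] by (simp add: represents_panharmonic_def space_restrict_space)
    have cf: "continuous_on (frontier D) f" using continuous_on_subset[OF f(1)] by blast
    have fm: "?f \<in> borel_measurable borel" by (rule borel_measurable_continuous_on_indicator[OF frontier_borel cf])
    have fC: "\<bar>?f y\<bar> \<le> 1" for y using f(2)[of y] by (auto simp: indicator_def)
    have cf': "continuous_on (frontier D) ?f" by (rule continuous_on_cong[THEN iffD2, OF refl _ cf]) simp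
    note v = exit_mean_dirichlet[OF fm fC cf' \<mu>]
    have "bounded (exit_mean (\<mu>\<^sup>2 / 2) ?f ` closure D)" unfolding bounded_iff using v(4) by auto
    then have "integrable K (exit_mean (\<mu>\<^sup>2 / 2) ?f)" "exit_mean (\<mu>\<^sup>2 / 2) ?f x = (\<integral>y. exit_mean (\<mu>\<^sup>2 / 2) ?f y \<partial>K)"
      using K v(1,2) unfolding represents_panharmonic_def by blast+
    moreover have "exit_mean (\<mu>\<^sup>2 / 2) ?f y = f y" if "y \<in> space K" for y using v(3)[of y] that sK by simp
    ultimately show ?thesis
      using Bochner_Integration.integrable_cong[OF refl, of K "exit_mean (\<mu>\<^sup>2 / 2) ?f" f]
        Bochner_Integration.integral_cong[OF refl, of K "exit_mean (\<mu>\<^sup>2 / 2) ?f" f] by simp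
  qed
  have fin: "finite_measure K" if K: "represents_panharmonic \<mu> D x K" for K
  proof -
    \<comment> \<open>Testing with the constant 1 gives finite total mass.\<close>
    have "integrable K (\<lambda>_. 1 :: real)" using fint[OF K, of "\<lambda>_. 1"] by simp
    then show ?thesis by (intro finite_measureI) (auto simp: integrable_iff_bounded)
  qed
  \<comment> \<open>The limit on the right does not mention K, so all representing measures agree on
    closed sets.\<close>
  have cl: "measure K (S \<inter> frontier D) = lim (\<lambda>n. exit_mean (\<mu>\<^sup>2 / 2) (\<lambda>y. indicator (frontier D) y *\<^sub>R max 0 (1 - real n * infdist y S)) x)"
    if K: "represents_panharmonic \<mu> D x K" and S: "closed S" "S \<noteq> {}" for K S
  proof -
    interpret K: finite_measure K by (rule fin[OF K])
    have sets: "sets K = sets (restrict_space borel (frontier D))" using K by (simp add: represents_panharmonic_def)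
    have sK: "space K = frontier D" using sets_eq_imp_space_eq[OF sets] by (simp add: space_restrict_space)
    have SF: "S \<inter> frontier D \<in> sets K"
      unfolding sets sets_frontier_iff using S frontier_borel by auto
    let ?g = "\<lambda>n y. max 0 (1 - real n * infdist y S)"
    have g: "continuous_on UNIV (?g n)" "\<bar>?g n y\<bar> \<le> 1" for n y
      by (intro continuous_intros) (simp add: max_def infdist_nonneg)
    have "(\<lambda>n. \<integral>y. ?g n y \<partial>K) \<longlonglongrightarrow> (\<integral>y. indicator (S \<inter> frontier D) y \<partial>K)"
    proof (rule integral_dominated_convergence[where w="\<lambda>_. 1"])
      show "(\<lambda>y. indicator (S \<inter> frontier D) y) \<in> borel_measurable K" using SF by (intro borel_measurable_indicator)
      show "?g n \<in> borel_measurable K" for n using fint[OF K g(1)[of n] g(2)[of n]] by auto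
      show "AE y in K. (\<lambda>n. ?g n y) \<longlonglongrightarrow> indicator (S \<inter> frontier D) y"
        using indicator_closed_limit[OF S] sK by (auto intro!: AE_I2 simp: indicator_inter_arith)
      show "AE y in K. norm (?g n y) \<le> 1" for n using g(2) by simp
    qed simp
    then have lim: "(\<lambda>n. exit_mean (\<mu>\<^sup>2 / 2) (\<lambda>y. indicator (frontier D) y *\<^sub>R ?g n y) x) \<longlonglongrightarrow> (\<integral>y. indicator (S \<inter> frontier D) y \<partial>K)"
      using fint[OF K g(1) g(2)] by simp
    have "(\<integral>y. indicator (S \<inter> frontier D) y \<partial>K) = measure K (S \<inter> frontier D)" using SF sK by simp
    then show ?thesis unfolding limI[OF lim] by (rule sym)
  qed
  have m: "(\<lambda>y. y) \<in> K \<rightarrow>\<^sub>M borel" if "represents_panharmonic \<mu> D x K" for K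
  proof -
    have s: "sets K = sets (restrict_space borel (frontier D))" using that by (simp add: represents_panharmonic_def)
    show ?thesis unfolding measurable_cong_sets[OF s refl] by (rule measurable_restrict_space1) simp
  qed
  \<comment> \<open>The generator argument lives on the whole space, so both measures are pushed
    forward along the inclusion of the frontier.\<close>
  have ext: "distr H borel (\<lambda>y. y) = distr ?L borel (\<lambda>y. y)"
  proof (rule finite_measure_eqI_closed)
    show "finite_measure (distr H borel (\<lambda>y. y))" by (rule finite_measure.finite_measure_distr[OF fin[OF H] m[OF H]])
    fix S :: "'a set" assume S: "closed S"
    show "emeasure (distr H borel (\<lambda>y. y)) S = emeasure (distr ?L borel (\<lambda>y. y)) S"
    proof (cases "S = {}")
      case False
      have e: "emeasure (distr K borel (\<lambda>y. y)) S = ennreal (lim (\<lambda>n. exit_mean (\<mu>\<^sup>2 / 2) (\<lambda>y. indicator (frontier D) y *\<^sub>R max 0 (1 - real n * infdist y S)) x))"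
        if K: "represents_panharmonic \<mu> D x K" for K
      proof -
        interpret K: finite_measure K by (rule fin[OF K])
        have sK: "space K = frontier D"
          using K sets_eq_imp_space_eq[of K "restrict_space borel (frontier D)"] by (simp add: represents_panharmonic_def space_restrict_space)
        have "emeasure (distr K borel (\<lambda>y. y)) S = emeasure K (S \<inter> frontier D)"
          using m[OF K] S sK by (simp add: emeasure_distr)
        then show ?thesis using cl[OF K S False] by (simp add: K.emeasure_eq_measure)
      qed
      show ?thesis unfolding e[OF H] e[OF L] ..
    qed simp
  qed simp_all
  show ?thesis
  proof (rule measure_eqI)
    show "sets H = sets ?L" using H by (simp add: represents_panharmonic_def)
    fix A assume A: "A \<in> sets H"
    have A': "A \<in> sets borel" "A \<subseteq> frontier D" using A H sets_frontier_iff by (auto simp: represents_panharmonic_def)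
    have e: "emeasure (distr K borel (\<lambda>y. y)) A = emeasure K A" if K: "represents_panharmonic \<mu> D x K" for K
    proof -
      have sK: "space K = frontier D"
        using K sets_eq_imp_space_eq[of K "restrict_space borel (frontier D)"] by (simp add: represents_panharmonic_def space_restrict_space)
      show ?thesis using m[OF K] A' sK by (simp add: emeasure_distr Int_absorb2)
    qed
    show "emeasure H A = emeasure ?L A" using e[OF H] e[OF L] ext by simp
  qed
qed

lemma panharmonic_measure_eq:
  assumes "0 \<le> \<mu>" "x \<in> D"
  shows "panharmonic_measure P W \<mu> D x = exit_law (\<mu>\<^sup>2 / 2) x"
proof (cases "\<mu> = 0")
  case True
  then show ?thesis by (simp add: panharmonic_measure_def harmonic_measure_eq)
next
  case False
  then have "0 < \<mu>" using assms by simp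
  then have "(THE H. represents_panharmonic \<mu> D x H) = exit_law (\<mu>\<^sup>2 / 2) x"
    using assms(2) by (intro the_equality represents_exit_law represents_panharmonic_unique)
  then show ?thesis using False by (simp add: panharmonic_measure_def)
qed

end

text \<open>The kernel lives on t > 0, where the exponential is strictly decreasing in \<mu> \<ge> 0
  for every t; strict pointwise inequalities survive integration against a probability
  measure.\<close>

lemma Z_decreasing_bounded:
  assumes \<kappa>: "\<kappa> \<in> restrict_space borel F \<rightarrow>\<^sub>M prob_algebra (restrict_space borel {0<..})" and y: "y \<in> F"
  shows "strict_antimono_on {0..} (\<lambda>\<mu>. Z \<kappa> \<mu> y)" and "0 < Z \<kappa> \<mu> y" and "Z \<kappa> \<mu> y \<le> 1"
    and "ennreal (Z \<kappa> \<mu> y) = (\<integral>\<^sup>+t. ennreal (exp (- (\<mu>\<^sup>2 / 2) * t)) \<partial>\<kappa> y)"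
proof -
  have "\<kappa> y \<in> space (prob_algebra (restrict_space borel {0<..}))"
    by (rule measurable_space[OF \<kappa>]) (use y in \<open>simp add: space_restrict_space\<close>)
  then have s: "sets (\<kappa> y) = sets (restrict_space borel {0<..})" and p: "prob_space (\<kappa> y)"
    by (auto simp: space_prob_algebra)
  interpret prob_space "\<kappa> y" by (rule p)
  have sp: "space (\<kappa> y) = {0<..}" using sets_eq_imp_space_eq[OF s] by (simp add: space_restrict_space)
  have m: "(\<lambda>t. exp (- (\<mu>\<^sup>2 / 2) * t)) \<in> borel_measurable (\<kappa> y)" for \<mu> :: real
    unfolding measurable_cong_sets[OF s refl] by (rule measurable_restrict_space1) measurable
  have b: "exp (- (\<mu>\<^sup>2 / 2) * t) \<le> 1" if "t \<in> space (\<kappa> y)" for \<mu> t :: real using that sp by simp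
  have i: "integrable (\<kappa> y) (\<lambda>t. exp (- (\<mu>\<^sup>2 / 2) * t))" for \<mu> :: real
    by (rule integrable_const_bound[where B=1]) (use m b in auto)
  have ne: "emeasure (\<kappa> y) (space (\<kappa> y)) \<noteq> 0" by (simp add: emeasure_space_1)
  show "strict_antimono_on {0..} (\<lambda>\<mu>. Z \<kappa> \<mu> y)"
  proof (rule monotone_onI)
    fix \<mu> \<nu> :: real assume "\<mu> \<in> {0..}" "\<nu> \<in> {0..}" "\<mu> < \<nu>"
    then have "\<mu>\<^sup>2 < \<nu>\<^sup>2" by (intro power_strict_mono) auto
    then have "exp (- (\<nu>\<^sup>2 / 2) * t) < exp (- (\<mu>\<^sup>2 / 2) * t)" if "t \<in> space (\<kappa> y)" for t
      using that sp by simp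
    then show "Z \<kappa> \<nu> y < Z \<kappa> \<mu> y"
      unfolding Z_def by (intro integral_less_AE_space[OF i i _ ne] AE_I2)
  qed
  have "(\<integral>t. 0 \<partial>\<kappa> y) < Z \<kappa> \<mu> y"
    unfolding Z_def by (intro integral_less_AE_space[OF _ i _ ne] AE_I2) auto
  then show "0 < Z \<kappa> \<mu> y" by simp
  have "Z \<kappa> \<mu> y \<le> (\<integral>t. 1 \<partial>\<kappa> y)" unfolding Z_def by (intro integral_mono[OF i] b) auto
  then show "Z \<kappa> \<mu> y \<le> 1" by (simp add: prob_space)
  show "ennreal (Z \<kappa> \<mu> y) = (\<integral>\<^sup>+t. ennreal (exp (- (\<mu>\<^sup>2 / 2) * t)) \<partial>\<kappa> y)"
    unfolding Z_def by (rule nn_integral_eq_integral[OF i, symmetric]) simp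
qed

section \<open>The density with respect to harmonic measure\<close>

context brownian_domain
begin

text \<open>The kernel property concerns product sets. For fixed A it says that the law of tau on
  the event that W tau lies in A is the mixture of the kernels over A; the exponential is then
  integrated against this mixture.\<close>

lemma exit_law_density:
  assumes ker: "exit_time_kernel P W D x \<kappa>" and x: "x \<in> D"
  shows "Z \<kappa> \<mu> \<in> borel_measurable (harmonic_measure P W D x)"
    and "density (harmonic_measure P W D x) (\<lambda>y. ennreal (Z \<kappa> \<mu> y)) = exit_law (\<mu>\<^sup>2 / 2) x"
proof -
  let ?H = "harmonic_measure P W D x" and ?N = "restrict_space borel {0<..} :: real measure"
  have \<kappa>: "\<kappa> \<in> restrict_space borel (frontier D) \<rightarrow>\<^sub>M prob_algebra ?N"
    and joint: "\<And>A B. A \<in> sets (restrict_space borel (frontier D)) \<Longrightarrow> B \<in> sets ?N \<Longrightarrow>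
      emeasure (P x) {\<omega>\<in>space (P x). exit_time W D \<omega> < \<infinity> \<and> exit_point W D \<omega> \<in> A \<and> real_of_ereal (exit_time W D \<omega>) \<in> B} =
      (\<integral>\<^sup>+ y. emeasure (\<kappa> y) B * indicator A y \<partial>?H)"
    using ker by (auto simp: exit_time_kernel_def)
  have sH: "sets ?H = sets (restrict_space borel (frontier D))" by (simp add: harmonic_measure_eq)
  have spH: "space ?H = frontier D" by (simp add: harmonic_measure_eq)
  have \<kappa>H: "\<kappa> \<in> ?H \<rightarrow>\<^sub>M subprob_algebra ?N"
    unfolding measurable_cong_sets[OF sH refl] by (rule measurable_prob_algebraD[OF \<kappa>])
  have e: "(\<lambda>t. exp (- (\<mu>\<^sup>2 / 2) * t)) \<in> borel_measurable ?N" by (rule measurable_restrict_space1) measurable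
  show Zm: "Z \<kappa> \<mu> \<in> borel_measurable ?H"
    using measurable_compose[OF \<kappa>H integral_measurable_subprob_algebra[OF e]] unfolding Z_def .
  show "density ?H (\<lambda>y. ennreal (Z \<kappa> \<mu> y)) = exit_law (\<mu>\<^sup>2 / 2) x"
  proof (rule measure_eqI)
    show "sets (density ?H (\<lambda>y. ennreal (Z \<kappa> \<mu> y))) = sets (exit_law (\<mu>\<^sup>2 / 2) x)" by (simp add: sH)
    fix A assume "A \<in> sets (density ?H (\<lambda>y. ennreal (Z \<kappa> \<mu> y)))"
    then have A: "A \<in> sets (restrict_space borel (frontier D))" by (simp add: sH)
    show "emeasure (density ?H (\<lambda>y. ennreal (Z \<kappa> \<mu> y))) A = emeasure (exit_law (\<mu>\<^sup>2 / 2) x) A"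
    \<comment> \<open>The rules for \<open>bind\<close> ask for a nonempty space, and a nonempty A
      guarantees a nonempty frontier.\<close>
    proof (cases "A = {}")
      case False
    have AH: "A \<in> sets ?H" using A by (simp add: sH)
    have Ab [measurable]: "A \<in> sets borel" using A unfolding sets_frontier_iff by simp
    let ?g = "\<lambda>t. ennreal (exp (- (\<mu>\<^sup>2 / 2) * t))"
    let ?T = "\<lambda>\<omega>. real_of_ereal (exit_time W D \<omega>)"
    \<comment> \<open>Positivity of the exit time is built in so that ?T maps \<open>E\<close> into
      the space of the kernels; for a pole in \<open>D\<close> it holds almost surely on finite exit
      times.\<close>
    define E where "E = {\<omega>\<in>space (P x). exit_time W D \<omega> < \<infinity> \<and> exit_point W D \<omega> \<in> A \<and> ?T \<omega> \<in> {0<..}}"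
    have E: "E \<in> sets (P x)" unfolding E_def by measurable
    have gm: "?g \<in> borel_measurable ?N" by (rule measurable_restrict_space1) measurable
    have Tm: "?T \<in> restrict_space (P x) E \<rightarrow>\<^sub>M ?N"
      by (rule measurable_restrict_space2) (auto simp: space_restrict_space E_def intro: measurable_restrict_space1)
    have dist: "distr (restrict_space (P x) E) ?N ?T = density ?H (indicator A) \<bind> \<kappa>"
    proof -
      have \<kappa>d: "\<kappa> \<in> density ?H (indicator A) \<rightarrow>\<^sub>M subprob_algebra ?N" using \<kappa>H by simp
      have ne: "space (density ?H (indicator A)) \<noteq> {}" using \<open>A \<noteq> {}\<close> A spH unfolding sets_frontier_iff by auto
      show ?thesis
      proof (rule measure_eqI)
        show "sets (distr (restrict_space (P x) E) ?N ?T) = sets (density ?H (indicator A) \<bind> \<kappa>)"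
          using sets_bind[OF sets_kernel[OF \<kappa>d] ne] by simp
        fix B assume "B \<in> sets (distr (restrict_space (P x) E) ?N ?T)"
        then have B: "B \<in> sets ?N" by simp
        then have B': "B \<subseteq> {0<..}" by (auto simp: sets_restrict_space)
        have "emeasure (distr (restrict_space (P x) E) ?N ?T) B = emeasure (P x) (?T -` B \<inter> E)"
          using Tm B E sets.sets_into_space[OF E]
          by (simp add: emeasure_distr emeasure_restrict_space space_restrict_space Int_absorb2)
        also have "?T -` B \<inter> E = {\<omega>\<in>space (P x). exit_time W D \<omega> < \<infinity> \<and> exit_point W D \<omega> \<in> A \<and> ?T \<omega> \<in> B}"
          using B' by (auto simp: E_def)
        also have "emeasure (P x) \<dots> = (\<integral>\<^sup>+ y. emeasure (\<kappa> y) B * indicator A y \<partial>?H)" by (rule joint[OF A B])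
        also have "\<dots> = (\<integral>\<^sup>+ y. emeasure (\<kappa> y) B \<partial>density ?H (indicator A))"
          using AH measurable_compose[OF \<kappa>H measurable_emeasure_subprob_algebra[OF B]]
          by (subst nn_integral_density) (auto simp: mult.commute)
        also have "\<dots> = emeasure (density ?H (indicator A) \<bind> \<kappa>) B" by (rule emeasure_bind[OF ne \<kappa>d B, symmetric])
        finally show "emeasure (distr (restrict_space (P x) E) ?N ?T) B = emeasure (density ?H (indicator A) \<bind> \<kappa>) B" .
      qed
    qed
    have "emeasure (density ?H (\<lambda>y. ennreal (Z \<kappa> \<mu> y))) A = (\<integral>\<^sup>+y. ennreal (Z \<kappa> \<mu> y) * indicator A y \<partial>?H)"
      using Zm AH by (intro emeasure_density) auto
    also have "\<dots> = (\<integral>\<^sup>+y. indicator A y * (\<integral>\<^sup>+t. ?g t \<partial>\<kappa> y) \<partial>?H)"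
      using Z_decreasing_bounded(4)[OF \<kappa>] spH by (intro nn_integral_cong) (simp add: mult.commute)
    also have "\<dots> = (\<integral>\<^sup>+y. (\<integral>\<^sup>+t. ?g t \<partial>\<kappa> y) \<partial>density ?H (indicator A))"
      using AH measurable_compose[OF \<kappa>H nn_integral_measurable_subprob_algebra[OF gm]]
      by (subst nn_integral_density) auto
    also have "\<dots> = (\<integral>\<^sup>+t. ?g t \<partial>(density ?H (indicator A) \<bind> \<kappa>))"
      by (rule nn_integral_bind[OF gm, symmetric]) (use \<kappa>H in simp)
    also have "\<dots> = (\<integral>\<^sup>+\<omega>. ?g (?T \<omega>) \<partial>restrict_space (P x) E)"
      unfolding dist[symmetric] by (rule nn_integral_distr[OF Tm]) (use gm in simp)
    also have "\<dots> = (\<integral>\<^sup>+\<omega>. ?g (?T \<omega>) * indicator E \<omega> \<partial>P x)"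
      using E sets.sets_into_space[OF E] by (intro nn_integral_restrict_space) (simp add: Int_absorb2)
    also have "\<dots> = (\<integral>\<^sup>+\<omega>. ennreal (exit_value (\<mu>\<^sup>2 / 2) (indicator A) (exit_time W D \<omega>) (exit_point W D \<omega>)) \<partial>P x)"
    proof (rule nn_integral_cong_AE)
      show "AE \<omega> in P x. ?g (?T \<omega>) * indicator E \<omega> = ennreal (exit_value (\<mu>\<^sup>2 / 2) (indicator A) (exit_time W D \<omega>) (exit_point W D \<omega>))"
        using W_start[of x] AE_space
      proof eventually_elim
        case (elim \<omega>)
        show ?case
        proof (cases "exit_time W D \<omega> < \<infinity>")
          case True
          then obtain T where "0 < T" "exit_time W D \<omega> = ereal T"
            using exit_frontier[OF elim(2)] elim(1) x by metis
          then show ?thesis using elim(2) by (auto simp: E_def exit_value_def indicator_def)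
        next
          case False
          then show ?thesis by (simp add: E_def exit_value_def)
        qed
      qed
    qed
    also have "\<dots> = ennreal (exit_mean (\<mu>\<^sup>2 / 2) (indicator A) x)"
    proof -
      have "integrable (P x) (\<lambda>\<omega>. exit_value (\<mu>\<^sup>2 / 2) (indicator A) (exit_time W D \<omega>) (exit_point W D \<omega>))"
        by (rule integrable_exit_value[where C=1]) (auto simp: indicator_def)
      then show ?thesis by (subst exit_mean_eq) (auto intro!: nn_integral_eq_integral simp: exit_value_def)
    qed
    finally show ?thesis
      by (simp add: emeasure_exit_law[OF A])
    qed simp
  qed
qed

end

theorem theorem3p2:
  fixes P :: "real ^ 'n \<Rightarrow> 'w measure"
    and W :: "real \<Rightarrow> 'w \<Rightarrow> real ^ 'n"
    and D :: "(real ^ 'n) set"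
  assumes "2 \<le> CARD('n)"
    and "brownian_family P W"
    and "regular_domain P W D"
  shows "(\<forall>\<mu>\<ge>0. \<forall>\<nu>\<ge>0. \<forall>x\<in>D. \<forall>x'\<in>D.
            absolutely_continuous (panharmonic_measure P W \<mu> D x) (panharmonic_measure P W \<nu> D x') \<and>
            absolutely_continuous (panharmonic_measure P W \<nu> D x') (panharmonic_measure P W \<mu> D x)) \<and>
         (\<forall>x\<in>D. \<forall>\<kappa>. exit_time_kernel P W D x \<kappa> \<longrightarrow>
            (\<forall>\<mu>\<ge>0. Z \<kappa> \<mu> \<in> borel_measurable (harmonic_measure P W D x) \<and>
               density (harmonic_measure P W D x) (\<lambda>y. ennreal (Z \<kappa> \<mu> y))
                 = panharmonic_measure P W \<mu> D x) \<and>
            (\<forall>y\<in>frontier D. strict_antimono_on {0..} (\<lambda>\<mu>. Z \<kappa> \<mu> y)) \<and>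
            (\<forall>\<mu>\<ge>0. \<forall>y\<in>frontier D. 0 < Z \<kappa> \<mu> y \<and> Z \<kappa> \<mu> y \<le> 1))"
proof -
  interpret regular_brownian_domain P W D
    by unfold_locales (use assms in \<open>auto simp: regular_domain_def\<close>)
  have conn: "connected D" using assms(3) by (simp add: regular_domain_def)
  have kernel: "\<kappa> \<in> restrict_space borel (frontier D) \<rightarrow>\<^sub>M prob_algebra (restrict_space borel {0<..})"
    if "exit_time_kernel P W D x \<kappa>" for x \<kappa>
    using that by (simp add: exit_time_kernel_def)
  show ?thesis
  proof (intro conjI allI impI ballI)
    fix \<mu> \<nu> :: real and x x' assume *: "0 \<le> \<mu>" "0 \<le> \<nu>" "x \<in> D" "x' \<in> D"
    show "absolutely_continuous (panharmonic_measure P W \<mu> D x) (panharmonic_measure P W \<nu> D x')"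
      "absolutely_continuous (panharmonic_measure P W \<nu> D x') (panharmonic_measure P W \<mu> D x)"
      using * by (simp_all add: panharmonic_measure_eq exit_law_absolutely_continuous[OF conn])
  next
    fix x \<kappa> and \<mu> :: real assume *: "x \<in> D" "exit_time_kernel P W D x \<kappa>" "0 \<le> \<mu>"
    show "Z \<kappa> \<mu> \<in> borel_measurable (harmonic_measure P W D x)"
      by (rule exit_law_density(1)[OF *(2,1)])
    show "density (harmonic_measure P W D x) (\<lambda>y. ennreal (Z \<kappa> \<mu> y)) = panharmonic_measure P W \<mu> D x"
      unfolding panharmonic_measure_eq[OF *(3,1)] by (rule exit_law_density(2)[OF *(2,1)])
  next
    fix x \<kappa> y assume "exit_time_kernel P W D x \<kappa>" "y \<in> frontier D"
    then show "strict_antimono_on {0..} (\<lambda>\<mu>. Z \<kappa> \<mu> y)" using Z_decreasing_bounded(1)[OF kernel] by blast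
  next
    fix x \<kappa> y and \<mu> :: real assume "exit_time_kernel P W D x \<kappa>" "y \<in> frontier D"
    then show "0 < Z \<kappa> \<mu> y" "Z \<kappa> \<mu> y \<le> 1" using Z_decreasing_bounded(2,3)[OF kernel] by blast+
  qed
qed

end
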